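(* The bimodules $B_1,\dots,B_n$ satisfy the Temperley-Lieb relations: for $i,j\in\{1,\dots,n\}$, $$B_j\ast B_i\ast B_j\cong B_j\quad\text{if } |i-j|=1,$$ $$B_i\ast B_j\cong B_j\ast B_i\quad\text{if } |i-j|>1,$$ $$B_i\ast B_i\cong B_i\oplus B_i[-2],$$ where all isomorphisms hold in $\bar R-\mathrm{mod}_{\mathbb Z}-\bar R$.
   Context: **Weyl lines.** Let $n\ge 1$, $k$ a field of characteristic $0$, $\mathcal{W}=S_{n+1}$ (Coxeter group of type $A_n$) with simple reflections $s_i=(i,i+1)$, $1\le i\le n$; $T$ is the set of reflections (transpositions). $V$ is the $n$-dimensional geometric (reflection) representation of $\mathcal{W}$ over $k$ and $H_t\subset V$ the reflecting hyperplane of $t\in T$. A Weyl line is a one-dimensional subspace of $V$ that is an intersection of reflecting hyperplanes (for $n=1$, $V$ itself); it is transverse to $t\in T$ if it is not contained in $H_t$. $Z\subset V$ is the union of all Weyl lines; $V_t\subset Z$ is the union of the Weyl lines transverse to $t$; $V_i:=V_{s_i}$. **Rings.** $\mathcal{O}(X)$ is the algebra of regular functions on a closed subvariety $X\subset V$. $\bar R=\mathcal{O}(Z)$, $R_i=\mathcal{O}(V_i)$, graded as quotients of $\mathcal{O}(V)$ with $V^*$ in degree $2$; $R_i^{s_i}$ is the subring of $s_i$-invariants. $\bar R-\mathrm{mod}_{\mathbb Z}-\bar R$ is the category of $\mathbb{Z}$-graded $(\bar R,\bar R)$-bimodules with morphisms homogeneous of degree $0$; $(M[k])_i=M_{i+k}$.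 **Product.** For $B,B'$ in $\bar R-\mathrm{mod}_{\mathbb Z}-\bar R$, let $V_B^r\subset Z$ (resp. $V_{B'}^\ell\subset Z$) be the closed subvariety defined by the right annihilator of $B$ (resp. the left annihilator of $B'$) in $\bar R$, and set $B\ast B'=B\otimes_{\bar R}\mathcal{O}(V_B^r\cap V_{B'}^\ell)\otimes_{\bar R}B'$. Set $B_i=R_i\otimes_{R_i^{s_i}}R_i$. The $\ast$-product of a finite sequence of the $B_i$ is, up to isomorphism in $\bar R-\mathrm{mod}_{\mathbb Z}-\bar R$, independent of the bracketing. *)

theory Defs
  imports
    "HOL-Algebra.Module"
    "HOL-Algebra.AbelCoset"
    "HOL-Algebra.Generated_Groups"
    "HOL-Algebra.Free_Abelian_Groups"
    "HOL-Combinatorics.Transposition"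
begin

section \<open>Weyl lines in type A\<close>

text \<open>
  The geometric representation of \<open>S\<^bsub>n+1\<^esub>\<close> is realised as the space of vectors of
  \<open>k\<^bsup>n+1\<^esup>\<close> with coordinate sum \<open>0\<close>, with permutation of coordinates.
  The simple roots are \<open>\<alpha>\<^sub>i = e\<^sub>i - e\<^bsub>i+1\<^esub>\<close>, and \<open>s\<^sub>i x = x - (x\<^sub>i - x\<^bsub>i+1\<^esub>) \<alpha>\<^sub>i\<close>.
  Vectors are functions on \<open>nat\<close> that vanish outside \<open>{1..n+1}\<close>.
\<close>

definition geom_rep :: "nat \<Rightarrow> (nat \<Rightarrow> 'k::field_char_0) set" where
  "geom_rep n = {x. (\<forall>i. i \<notin> {1..n+1} \<longrightarrow> x i = 0) \<and> (\<Sum>i\<in>{1..n+1}. x i) = 0}"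

definition act :: "(nat \<Rightarrow> nat) \<Rightarrow> (nat \<Rightarrow> 'k) \<Rightarrow> (nat \<Rightarrow> 'k)" where
  "act w x = x \<circ> inv_into UNIV w"

definition simple_reflection :: "nat \<Rightarrow> nat \<Rightarrow> nat" where
  "simple_reflection i = Transposition.transpose i (i + 1)"

definition reflections :: "nat \<Rightarrow> (nat \<Rightarrow> nat) set" where
  "reflections n = {Transposition.transpose a b | a b. a \<in> {1..n+1} \<and> b \<in> {1..n+1} \<and> a \<noteq> b}"

definition hyperplane :: "nat \<Rightarrow> (nat \<Rightarrow> nat) \<Rightarrow> (nat \<Rightarrow> 'k::field_char_0) set" where
  "hyperplane n t = {x \<in> geom_rep n. act t x = x}"

text \<open>The empty intersection is the whole space, which is a line exactly when \<open>n = 1\<close>.\<close>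

definition weyl_lines :: "nat \<Rightarrow> (nat \<Rightarrow> 'k::field_char_0) set set" where
  "weyl_lines n = {L. (\<exists>S \<subseteq> reflections n. L = geom_rep n \<inter> (\<Inter>t\<in>S. hyperplane n t)) \<and>
                      (\<exists>v. v \<noteq> (\<lambda>_. 0) \<and> L = {\<lambda>i. c * v i | c. True})}"

definition weyl_union :: "nat \<Rightarrow> (nat \<Rightarrow> 'k::field_char_0) set" where
  "weyl_union n = \<Union> (weyl_lines n)"

definition transverse_union :: "nat \<Rightarrow> (nat \<Rightarrow> nat) \<Rightarrow> (nat \<Rightarrow> 'k::field_char_0) set" where
  "transverse_union n t = \<Union> {L \<in> weyl_lines n. \<not> L \<subseteq> hyperplane n t}"


section \<open>Graded rings of regular functions\<close>

record 'a graded_ring = "'a ring" +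
  rhomog :: "int \<Rightarrow> 'a set"

text \<open>
  Polynomial functions are written in the coordinates of the ambient \<open>k\<^bsup>n+1\<^esup>\<close>, whose
  restrictions to the representation span its dual space.
\<close>

inductive hom_poly :: "nat \<Rightarrow> nat \<Rightarrow> ((nat \<Rightarrow> 'k::field_char_0) \<Rightarrow> 'k) \<Rightarrow> bool" for n :: nat where
  const: "hom_poly n 0 (\<lambda>x. c)"
| coord: "i \<in> {1..n+1} \<Longrightarrow> hom_poly n 1 (\<lambda>x. x i)"
| add: "hom_poly n d f \<Longrightarrow> hom_poly n d g \<Longrightarrow> hom_poly n d (\<lambda>x. f x + g x)"
| mult: "hom_poly n d f \<Longrightarrow> hom_poly n e g \<Longrightarrow> hom_poly n (d + e) (\<lambda>x. f x * g x)"

definition poly_fun :: "nat \<Rightarrow> ((nat \<Rightarrow> 'k::field_char_0) \<Rightarrow> 'k) \<Rightarrow> bool" where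
  "poly_fun n f \<longleftrightarrow> (\<exists>N g. (\<forall>d\<le>N. hom_poly n d (g d)) \<and> f = (\<lambda>x. \<Sum>d\<le>N. g d x))"

text \<open>
  The regular functions on a closed \<open>X\<close> are the restrictions to \<open>X\<close> of polynomial functions;
  this is the coordinate ring of the reduced variety \<open>X\<close>, because every \<open>X\<close> that occurs is a
  union of lines defined over the infinite field \<open>k\<close> or consists of the origin alone.
  Linear forms have degree \<open>2\<close>.
\<close>

definition reg_homog :: "nat \<Rightarrow> (nat \<Rightarrow> 'k::field_char_0) set \<Rightarrow> int \<Rightarrow> ((nat \<Rightarrow> 'k) \<Rightarrow> 'k) set" where
  "reg_homog n X e =
     (if e \<ge> 0 \<and> even e then {restrict f X | f. hom_poly n (nat (e div 2)) f} else {\<lambda>x\<in>X. 0})"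

definition reg_ring :: "nat \<Rightarrow> (nat \<Rightarrow> 'k::field_char_0) set \<Rightarrow> ((nat \<Rightarrow> 'k) \<Rightarrow> 'k) graded_ring" where
  "reg_ring n X = \<lparr>
     carrier = {restrict f X | f. poly_fun n f},
     monoid.mult = (\<lambda>f g. \<lambda>x\<in>X. f x * g x),
     one = (\<lambda>x\<in>X. 1),
     ring.zero = (\<lambda>x\<in>X. 0),
     add = (\<lambda>f g. \<lambda>x\<in>X. f x + g x),
     rhomog = reg_homog n X\<rparr>"

definition weyl_ring :: "nat \<Rightarrow> ((nat \<Rightarrow> 'k::field_char_0) \<Rightarrow> 'k) graded_ring" where
  "weyl_ring n = reg_ring n (weyl_union n)"

definition invariant_ring ::
  "nat \<Rightarrow> (nat \<Rightarrow> nat) \<Rightarrow> (nat \<Rightarrow> 'k::field_char_0) set \<Rightarrow> ((nat \<Rightarrow> 'k) \<Rightarrow> 'k) graded_ring" where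
  "invariant_ring n w X = (let I = {f. \<forall>x\<in>X. f (act w x) = f x} in (reg_ring n X)
     \<lparr>carrier := carrier (reg_ring n X) \<inter> I, rhomog := (\<lambda>d. reg_homog n X d \<inter> I)\<rparr>)"


section \<open>Graded bimodules\<close>

text \<open>The fields \<open>mult\<close> and \<open>one\<close>, inherited from the record of rings, play no role.\<close>

record ('a, 'b, 'm) bimod = "('a, 'm) module" +
  rsmult :: "'m \<Rightarrow> 'b \<Rightarrow> 'm"
  homog :: "int \<Rightarrow> 'm set"

definition right_module :: "('a, 'b, 'm) bimod \<Rightarrow> ('b, 'm) module" where
  "right_module M = \<lparr>carrier = carrier M, monoid.mult = monoid.mult M, one = one M,
     ring.zero = \<zero>\<^bsub>M\<^esub>, add = add M, smult = (\<lambda>b m. rsmult M m b)\<rparr>"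

text \<open>
  The rings considered here are commutative, so that right modules are modules in the sense of
  the library.
\<close>

definition graded_bimodule ::
  "'a graded_ring \<Rightarrow> 'b graded_ring \<Rightarrow> ('a, 'b, 'm) bimod \<Rightarrow> bool" where
  "graded_bimodule A B M \<longleftrightarrow>
     module A M \<and> module B (right_module M) \<and>
     (\<forall>a\<in>carrier A. \<forall>m\<in>carrier M. \<forall>b\<in>carrier B.
        rsmult M (a \<odot>\<^bsub>M\<^esub> m) b = a \<odot>\<^bsub>M\<^esub> rsmult M m b) \<and>
     (\<forall>d. additive_subgroup (homog M d) M) \<and>
     (\<forall>m\<in>carrier M. \<exists>!c. (\<forall>d. c d \<in> homog M d) \<and> finite {d. c d \<noteq> \<zero>\<^bsub>M\<^esub>} \<and>
        m = finsum M c {d. c d \<noteq> \<zero>\<^bsub>M\<^esub>}) \<and>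
     (\<forall>d e. \<forall>a\<in>rhomog A d. \<forall>m\<in>homog M e. a \<odot>\<^bsub>M\<^esub> m \<in> homog M (d + e)) \<and>
     (\<forall>d e. \<forall>m\<in>homog M d. \<forall>b\<in>rhomog B e. rsmult M m b \<in> homog M (d + e))"

definition graded_bimod_hom ::
  "'a graded_ring \<Rightarrow> 'b graded_ring \<Rightarrow> ('a, 'b, 'm) bimod \<Rightarrow> ('a, 'b, 'n) bimod \<Rightarrow> ('m \<Rightarrow> 'n) set" where
  "graded_bimod_hom A B M N = {h \<in> hom (add_monoid M) (add_monoid N).
     (\<forall>a\<in>carrier A. \<forall>m\<in>carrier M. h (a \<odot>\<^bsub>M\<^esub> m) = a \<odot>\<^bsub>N\<^esub> h m) \<and>
     (\<forall>m\<in>carrier M. \<forall>b\<in>carrier B. h (rsmult M m b) = rsmult N (h m) b) \<and>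
     (\<forall>d. h ` homog M d \<subseteq> homog N d)}"

definition graded_bimod_iso ::
  "'a graded_ring \<Rightarrow> 'b graded_ring \<Rightarrow> ('a, 'b, 'm) bimod \<Rightarrow> ('a, 'b, 'n) bimod \<Rightarrow> bool" where
  "graded_bimod_iso A B M N \<longleftrightarrow>
     graded_bimodule A B M \<and> graded_bimodule A B N \<and>
     (\<exists>h\<in>graded_bimod_hom A B M N. \<exists>h'\<in>graded_bimod_hom A B N M.
        (\<forall>m\<in>carrier M. h' (h m) = m) \<and> (\<forall>m\<in>carrier N. h (h' m) = m))"

definition shift :: "('a, 'b, 'm) bimod \<Rightarrow> int \<Rightarrow> ('a, 'b, 'm) bimod" where
  "shift M k = M\<lparr>homog := (\<lambda>i. homog M (i + k))\<rparr>"

definition direct_sum :: "('a, 'b, 'm) bimod \<Rightarrow> ('a, 'b, 'n) bimod \<Rightarrow> ('a, 'b, 'm \<times> 'n) bimod" where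
  "direct_sum M N = \<lparr>
     carrier = carrier M \<times> carrier N,
     monoid.mult = undefined,
     one = undefined,
     ring.zero = (\<zero>\<^bsub>M\<^esub>, \<zero>\<^bsub>N\<^esub>),
     add = (\<lambda>(x, y) (x', y'). (x \<oplus>\<^bsub>M\<^esub> x', y \<oplus>\<^bsub>N\<^esub> y')),
     smult = (\<lambda>a (x, y). (a \<odot>\<^bsub>M\<^esub> x, a \<odot>\<^bsub>N\<^esub> y)),
     rsmult = (\<lambda>(x, y) b. (rsmult M x b, rsmult N y b)),
     homog = (\<lambda>d. homog M d \<times> homog N d)\<rparr>"

text \<open>
  The tensor product over \<open>S\<close> is the free abelian group on pairs modulo the subgroup
  generated by the bilinearity and balancing relations; its elements are cosets.
\<close>

definition tensor_free ::
  "('a, 's, 'm) bimod \<Rightarrow> ('s, 'b, 'n) bimod \<Rightarrow> ('m \<times> 'n \<Rightarrow>\<^sub>0 int) monoid" where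
  "tensor_free M N = free_Abelian_group (carrier M \<times> carrier N)"

definition tensor_rel ::
  "'s graded_ring \<Rightarrow> ('a, 's, 'm) bimod \<Rightarrow> ('s, 'b, 'n) bimod \<Rightarrow> ('m \<times> 'n \<Rightarrow>\<^sub>0 int) set" where
  "tensor_rel S M N = generate (tensor_free M N)
     ({frag_of (x \<oplus>\<^bsub>M\<^esub> x', y) - frag_of (x, y) - frag_of (x', y) | x x' y.
         x \<in> carrier M \<and> x' \<in> carrier M \<and> y \<in> carrier N} \<union>
      {frag_of (x, y \<oplus>\<^bsub>N\<^esub> y') - frag_of (x, y) - frag_of (x, y') | x y y'.
         x \<in> carrier M \<and> y \<in> carrier N \<and> y' \<in> carrier N} \<union>
      {frag_of (rsmult M x s, y) - frag_of (x, s \<odot>\<^bsub>N\<^esub> y) | x s y.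
         x \<in> carrier M \<and> s \<in> carrier S \<and> y \<in> carrier N})"

definition tensor ::
  "'s graded_ring \<Rightarrow> ('a, 's, 'm) bimod \<Rightarrow> ('s, 'b, 'n) bimod \<Rightarrow>
   ('a, 'b, ('m \<times> 'n \<Rightarrow>\<^sub>0 int) set) bimod" where
  "tensor S M N = (let F = tensor_free M N; K = tensor_rel S M N in \<lparr>
     carrier = carrier (F Mod K),
     monoid.mult = undefined,
     one = undefined,
     ring.zero = one (F Mod K),
     add = monoid.mult (F Mod K),
     smult = (\<lambda>a C. \<Union>c\<in>C. K #>\<^bsub>F\<^esub> frag_extend (\<lambda>(x, y). frag_of (a \<odot>\<^bsub>M\<^esub> x, y)) c),
     rsmult = (\<lambda>C b. \<Union>c\<in>C. K #>\<^bsub>F\<^esub> frag_extend (\<lambda>(x, y). frag_of (x, rsmult N y b)) c),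
     homog = (\<lambda>d. generate (F Mod K)
       {K #>\<^bsub>F\<^esub> frag_of (x, y) | x y i j. x \<in> homog M i \<and> y \<in> homog N j \<and> i + j = d})\<rparr>)"


section \<open>The bimodules and their product\<close>

text \<open>
  The regular functions on \<open>X\<close> as a bimodule.  The actions are defined for functions \<open>f\<close> on
  any superset of \<open>X\<close>: these act through restriction to \<open>X\<close>.
\<close>

definition reg_bimod ::
  "nat \<Rightarrow> (nat \<Rightarrow> 'k::field_char_0) set \<Rightarrow>
   ((nat \<Rightarrow> 'k) \<Rightarrow> 'k, (nat \<Rightarrow> 'k) \<Rightarrow> 'k, (nat \<Rightarrow> 'k) \<Rightarrow> 'k) bimod" where
  "reg_bimod n X = \<lparr>
     carrier = carrier (reg_ring n X),
     monoid.mult = monoid.mult (reg_ring n X),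
     one = one (reg_ring n X),
     ring.zero = \<zero>\<^bsub>reg_ring n X\<^esub>,
     add = add (reg_ring n X),
     smult = (\<lambda>f m. \<lambda>x\<in>X. f x * m x),
     rsmult = (\<lambda>m f. \<lambda>x\<in>X. m x * f x),
     homog = rhomog (reg_ring n X)\<rparr>"

definition left_support ::
  "nat \<Rightarrow> ((nat \<Rightarrow> 'k::field_char_0) \<Rightarrow> 'k, 'b, 'm) bimod \<Rightarrow> (nat \<Rightarrow> 'k) set" where
  "left_support n M = {z \<in> weyl_union n. \<forall>f\<in>carrier (weyl_ring n).
     (\<forall>m\<in>carrier M. f \<odot>\<^bsub>M\<^esub> m = \<zero>\<^bsub>M\<^esub>) \<longrightarrow> f z = 0}"

definition right_support ::
  "nat \<Rightarrow> ('a, (nat \<Rightarrow> 'k::field_char_0) \<Rightarrow> 'k, 'm) bimod \<Rightarrow> (nat \<Rightarrow> 'k) set" where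
  "right_support n M = {z \<in> weyl_union n. \<forall>f\<in>carrier (weyl_ring n).
     (\<forall>m\<in>carrier M. rsmult M m f = \<zero>\<^bsub>M\<^esub>) \<longrightarrow> f z = 0}"

definition star_prod ::
  "nat \<Rightarrow> ('a, (nat \<Rightarrow> 'k::field_char_0) \<Rightarrow> 'k, 'm) bimod \<Rightarrow> ((nat \<Rightarrow> 'k) \<Rightarrow> 'k, 'b, 'n) bimod \<Rightarrow>
   ('a, 'b, (('m \<times> ((nat \<Rightarrow> 'k) \<Rightarrow> 'k) \<Rightarrow>\<^sub>0 int) set \<times> 'n \<Rightarrow>\<^sub>0 int) set) bimod" where
  "star_prod n M N =
     tensor (weyl_ring n)
       (tensor (weyl_ring n) M (reg_bimod n (right_support n M \<inter> left_support n N)))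
       N"

type_synonym 'k TL_bimod =
  "((nat \<Rightarrow> 'k) \<Rightarrow> 'k, (nat \<Rightarrow> 'k) \<Rightarrow> 'k,
    (((nat \<Rightarrow> 'k) \<Rightarrow> 'k) \<times> ((nat \<Rightarrow> 'k) \<Rightarrow> 'k) \<Rightarrow>\<^sub>0 int) set) bimod"

definition TL_gen :: "nat \<Rightarrow> nat \<Rightarrow> 'k::field_char_0 TL_bimod" where
  "TL_gen n i = (let s = simple_reflection i; X = transverse_union n s in
     tensor (invariant_ring n s X) (reg_bimod n X) (reg_bimod n X))"

abbreviation weyl_bimod_iso ::
  "nat \<Rightarrow> ((nat \<Rightarrow> 'k::field_char_0) \<Rightarrow> 'k, (nat \<Rightarrow> 'k) \<Rightarrow> 'k, 'm) bimod \<Rightarrow>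
   ((nat \<Rightarrow> 'k) \<Rightarrow> 'k, (nat \<Rightarrow> 'k) \<Rightarrow> 'k, 'n) bimod \<Rightarrow> bool" where
  "weyl_bimod_iso n M N \<equiv> graded_bimod_iso (weyl_ring n) (weyl_ring n) M N"

end

theory Submission
  imports "HOL-Computational_Algebra.Polynomial" Defs
begin

text \<open>
  All bimodules of the theorem are spaces of polynomial functions on explicit sets, and the
  product \<open>\<star>\<close> is composition of these sets.

  Let \<open>t\<close> be the transposition of \<open>a\<close> and \<open>b\<close> and let \<open>X\<close> be the union of the Weyl lines transverse to
  \<open>t\<close>.  The linear form \<open>x\<^sub>a - x\<^sub>b\<close> changes sign under \<open>t\<close> and vanishes on \<open>X\<close> only at the origin.
  Hence \<open>\<O>(X)\<close> is free over its \<open>t\<close>-invariants with basis \<open>1\<close> and \<open>x\<^sub>a - x\<^sub>b\<close>, and an element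
  of the bimodule of \<open>t\<close> can be recovered from the values of \<open>f(x) g(y)\<close> at the pairs \<open>(x, x)\<close> and
  \<open>(x, t x)\<close>: the bimodule is the space of polynomial functions on the set \<open>refl_pairs\<close> of
  these pairs (\<open>reflection_bimod_iso\<close>).

  If \<open>M\<close> consists of the functions on a set \<open>P\<close> of pairs and \<open>N\<close> is the bimodule of a reflection,
  then \<open>M \<star> N\<close> consists of the functions on the fibre product of \<open>P\<close> and \<open>refl_pairs\<close>, that is, on the
  \<open>(x, y, z)\<close> with \<open>(x, y) \<in> P\<close> and \<open>(y, z) \<in> refl_pairs\<close> (\<open>star_prod_reflection\<close>).  The functions
  on the intersection of the supports, which are the middle factor of the product, restrict \<open>y\<close> to
  the right ends of \<open>P\<close> that are also left ends of \<open>refl_pairs\<close>.  The three relations then become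
  statements about such sets.

  \<^item> For the square, \<open>y\<close> is \<open>x\<close> or \<open>t x\<close>, so a function of \<open>(x, y, z)\<close> is \<open>u(x, z) + (y\<^sub>a - y\<^sub>b) v(x, z)\<close>.
    This is a direct sum, and the form \<open>y\<^sub>a - y\<^sub>b\<close> of degree \<open>2\<close> causes the shift
    (\<open>triple_bimod_direct_sum\<close>).

  \<^item> For commuting reflections \<open>s\<close> and \<open>t\<close>, both products consist of the functions on the \<open>(x, z)\<close> with
    \<open>x\<close> transverse to both and \<open>z\<close> in its orbit under the group generated by \<open>s\<close> and \<open>t\<close>
    (\<open>commuting_iso\<close>).

  \<^item> For adjacent reflections, type A enters: a vector on a Weyl line takes only two values
    (\<open>weyl_line_two_valued\<close>).  So if \<open>s\<close> is the transposition of \<open>c\<close> and \<open>b\<close>, then \<open>X\<close> is the union of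
    \<open>Y\<close> and \<open>t Y\<close>, where \<open>Y\<close> is the set of vectors of \<open>X\<close> transverse to \<open>s\<close> as well; moreover the
    map that folds \<open>X\<close> onto \<open>Y\<close> is linear (\<open>fold_onto_separated\<close>), so that \<open>\<O>(Y)\<close> is
    identified with the invariants of \<open>t\<close> on \<open>\<O>(X)\<close>, and likewise with those of \<open>s\<close>.  In the triple
    product the middle vectors all have to be one element of \<open>Y\<close>, and forgetting it leaves the
    set \<open>refl_pairs\<close> of \<open>t\<close> (\<open>adjacent_triple_iso\<close>).

  To identify a tensor product with a concrete bimodule, \<open>tensor_iso_of_pairing\<close> compares the
  defining relations with the kernel of the induced map on the free abelian group.
\<close>

type_synonym 'k vec = "nat \<Rightarrow> 'k"

type_synonym ('k, 'm) vec_bimod = "('k vec \<Rightarrow> 'k, 'k vec \<Rightarrow> 'k, 'm) bimod"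

section \<open>Isomorphisms of graded bimodules\<close>

lemma right_module_simps [simp]:
  "carrier (right_module M) = carrier M" "add (right_module M) = add M"
  "ring.zero (right_module M) = \<zero>\<^bsub>M\<^esub>" "smult (right_module M) b m = rsmult M m b"
  by (simp_all add: right_module_def)

lemma finsum_transport:
  assumes M: "abelian_monoid M" and N: "abelian_monoid N"
    and h0: "h \<zero>\<^bsub>M\<^esub> = \<zero>\<^bsub>N\<^esub>"
    and hadd: "\<And>x y. x \<in> carrier M \<Longrightarrow> y \<in> carrier M \<Longrightarrow> h (x \<oplus>\<^bsub>M\<^esub> y) = h x \<oplus>\<^bsub>N\<^esub> h y"
    and hin: "\<And>x. x \<in> carrier M \<Longrightarrow> h x \<in> carrier N"
    and "finite A" "c \<in> A \<rightarrow> carrier M"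
  shows "h (finsum M c A) = finsum N (\<lambda>d. h (c d)) A"
  using assms(6,7)
proof (induction A rule: finite_induct)
  case empty
  then show ?case using h0 by (simp add: abelian_monoid.finsum_empty[OF M] abelian_monoid.finsum_empty[OF N])
next
  case (insert x F)
  then have "finsum M c F \<in> carrier M" by (intro abelian_monoid.finsum_closed[OF M]) auto
  moreover have "(\<lambda>d. h (c d)) \<in> F \<rightarrow> carrier N" "h (c x) \<in> carrier N"
    using insert.prems hin by auto
  ultimately show ?case
    using insert by (simp add: abelian_monoid.finsum_insert[OF M] abelian_monoid.finsum_insert[OF N] hadd)
qed

lemma graded_bimoduleI:
  assumes "module A M" "module B (right_module M)"
    and "\<And>a m b. a \<in> carrier A \<Longrightarrow> m \<in> carrier M \<Longrightarrow> b \<in> carrier B \<Longrightarrow>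
          rsmult M (a \<odot>\<^bsub>M\<^esub> m) b = a \<odot>\<^bsub>M\<^esub> rsmult M m b"
    and "\<And>d. additive_subgroup (homog M d) M"
    and "\<And>m. m \<in> carrier M \<Longrightarrow> \<exists>!c. (\<forall>d. c d \<in> homog M d) \<and> finite {d. c d \<noteq> \<zero>\<^bsub>M\<^esub>} \<and>
        m = finsum M c {d. c d \<noteq> \<zero>\<^bsub>M\<^esub>}"
    and "\<And>a m d e. a \<in> rhomog A d \<Longrightarrow> m \<in> homog M e \<Longrightarrow> a \<odot>\<^bsub>M\<^esub> m \<in> homog M (d + e)"
    and "\<And>m b d e. m \<in> homog M d \<Longrightarrow> b \<in> rhomog B e \<Longrightarrow> rsmult M m b \<in> homog M (d + e)"
  shows "graded_bimodule A B M"
  unfolding graded_bimodule_def by (intro conjI ballI allI; rule assms; assumption)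

lemma homog_in_carrier:
  assumes "graded_bimodule A B M" "m \<in> homog M d"
  shows "m \<in> carrier M"
proof -
  have "additive_subgroup (homog M d) M" using assms(1) unfolding graded_bimodule_def by blast
  then show ?thesis using assms(2) by (meson additive_subgroup.a_Hcarr)
qed

lemma graded_bimodule_abelian_group:
  assumes "graded_bimodule A B M" shows "abelian_group M"
  using assms unfolding graded_bimodule_def module_def by blast

lemma graded_bimodule_closed:
  assumes "graded_bimodule A B M" "m \<in> carrier M"
  shows "a \<in> carrier A \<Longrightarrow> a \<odot>\<^bsub>M\<^esub> m \<in> carrier M" "b \<in> carrier B \<Longrightarrow> rsmult M m b \<in> carrier M"
proof -
  have A: "module A M" and B: "module B (right_module M)"
    using assms(1) unfolding graded_bimodule_def by blast+
  show "a \<in> carrier A \<Longrightarrow> a \<odot>\<^bsub>M\<^esub> m \<in> carrier M"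
    using module.smult_closed[OF A] assms(2) by blast
  show "b \<in> carrier B \<Longrightarrow> rsmult M m b \<in> carrier M"
    using module.smult_closed[OF B] assms(2) by simp
qed

lemma graded_bimodule_decomp:
  assumes "graded_bimodule A B M" "m \<in> carrier M"
  shows "\<exists>c. (\<forall>d. c d \<in> homog M d) \<and> finite {d. c d \<noteq> \<zero>\<^bsub>M\<^esub>} \<and> m = finsum M c {d. c d \<noteq> \<zero>\<^bsub>M\<^esub>}"
proof -
  have "\<forall>m\<in>carrier M. \<exists>!c. (\<forall>d. c d \<in> homog M d) \<and> finite {d. c d \<noteq> \<zero>\<^bsub>M\<^esub>} \<and>
      m = finsum M c {d. c d \<noteq> \<zero>\<^bsub>M\<^esub>}"
    using assms(1) unfolding graded_bimodule_def by (elim conjE)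
  from ex1_implies_ex[OF bspec[OF this assms(2)]] show ?thesis .
qed

text \<open>
  Each axiom of a graded bimodule can be checked after applying an injective map that respects
  all operations.  Hence it is never necessary to verify the axioms inside a tensor product:
  they are transported from a concrete bimodule.
\<close>

lemma graded_bimod_iso_transport:
  fixes M :: "('a, 'b, 'm) bimod" and N :: "('a, 'b, 'n) bimod"
  assumes N: "graded_bimodule A B N"
    and rA: "\<And>d. rhomog A d \<subseteq> carrier A" and rB: "\<And>d. rhomog B d \<subseteq> carrier B"
    and bij: "bij_betw h (carrier M) (carrier N)"
    and zero: "\<zero>\<^bsub>M\<^esub> \<in> carrier M"
    and h0: "h \<zero>\<^bsub>M\<^esub> = \<zero>\<^bsub>N\<^esub>"
    and add_closed: "\<And>x y. x \<in> carrier M \<Longrightarrow> y \<in> carrier M \<Longrightarrow> x \<oplus>\<^bsub>M\<^esub> y \<in> carrier M"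
    and hadd: "\<And>x y. x \<in> carrier M \<Longrightarrow> y \<in> carrier M \<Longrightarrow> h (x \<oplus>\<^bsub>M\<^esub> y) = h x \<oplus>\<^bsub>N\<^esub> h y"
    and l_closed: "\<And>a x. a \<in> carrier A \<Longrightarrow> x \<in> carrier M \<Longrightarrow> a \<odot>\<^bsub>M\<^esub> x \<in> carrier M"
    and hl: "\<And>a x. a \<in> carrier A \<Longrightarrow> x \<in> carrier M \<Longrightarrow> h (a \<odot>\<^bsub>M\<^esub> x) = a \<odot>\<^bsub>N\<^esub> h x"
    and r_closed: "\<And>b x. b \<in> carrier B \<Longrightarrow> x \<in> carrier M \<Longrightarrow> rsmult M x b \<in> carrier M"
    and hr: "\<And>b x. b \<in> carrier B \<Longrightarrow> x \<in> carrier M \<Longrightarrow> h (rsmult M x b) = rsmult N (h x) b"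
    and homog_sub: "\<And>d. homog M d \<subseteq> carrier M"
    and homog: "\<And>d. h ` homog M d = homog N d"
  shows "graded_bimod_iso A B M N"
proof -
  have mN: "module A N" "module B (right_module N)"
    and comm: "\<And>a m b. a \<in> carrier A \<Longrightarrow> m \<in> carrier N \<Longrightarrow> b \<in> carrier B \<Longrightarrow>
          rsmult N (a \<odot>\<^bsub>N\<^esub> m) b = a \<odot>\<^bsub>N\<^esub> rsmult N m b"
    and sub: "\<And>d. additive_subgroup (homog N d) N"
    and dec: "\<And>m. m \<in> carrier N \<Longrightarrow> \<exists>!c. (\<forall>d. c d \<in> homog N d) \<and> finite {d. c d \<noteq> \<zero>\<^bsub>N\<^esub>} \<and>
        m = finsum N c {d. c d \<noteq> \<zero>\<^bsub>N\<^esub>}"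
    and gl: "\<And>d e a m. a\<in>rhomog A d \<Longrightarrow> m \<in> homog N e \<Longrightarrow> a \<odot>\<^bsub>N\<^esub> m \<in> homog N (d + e)"
    and gr: "\<And>d e b m. m \<in> homog N d \<Longrightarrow> b\<in>rhomog B e \<Longrightarrow> rsmult N m b \<in> homog N (d + e)"
    using N unfolding graded_bimodule_def by blast+
  interpret N: module A N by fact
  interpret NR: module B "right_module N" by fact
  define g where "g = inv_into (carrier M) h"
  have gin: "g y \<in> carrier M" if "y \<in> carrier N" for y
    using bij that unfolding g_def bij_betw_def by (metis inv_into_into)
  have hg: "h (g y) = y" if "y \<in> carrier N" for y
    using bij that unfolding g_def by (metis bij_betw_inv_into_right)
  have gh: "g (h x) = x" if "x \<in> carrier M" for x
    using bij that unfolding g_def by (metis bij_betw_inv_into_left)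
  have hin: "h x \<in> carrier N" if "x \<in> carrier M" for x
    using bij that bij_betwE by blast
  have inj: "x = y" if "h x = h y" "x \<in> carrier M" "y \<in> carrier M" for x y
    using that gh by metis

  have assoc: "x \<oplus>\<^bsub>M\<^esub> y \<oplus>\<^bsub>M\<^esub> z = x \<oplus>\<^bsub>M\<^esub> (y \<oplus>\<^bsub>M\<^esub> z)"
    if "x \<in> carrier M" "y \<in> carrier M" "z \<in> carrier M" for x y z
    by (rule inj) (simp_all add: that hadd add_closed hin N.add.m_assoc)
  have acomm: "x \<oplus>\<^bsub>M\<^esub> y = y \<oplus>\<^bsub>M\<^esub> x" if "x \<in> carrier M" "y \<in> carrier M" for x y
    by (rule inj) (simp_all add: that hadd add_closed hin N.add.m_comm)
  have "abelian_group M"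
  proof (rule abelian_groupI)
    fix x assume x: "x \<in> carrier M"
    show "\<zero>\<^bsub>M\<^esub> \<oplus>\<^bsub>M\<^esub> x = x" by (rule inj) (simp_all add: x hadd zero add_closed h0 hin)
    show "\<exists>y\<in>carrier M. y \<oplus>\<^bsub>M\<^esub> x = \<zero>\<^bsub>M\<^esub>"
    proof
      show i: "g (\<ominus>\<^bsub>N\<^esub> h x) \<in> carrier M" by (simp add: gin hin x)
      show "g (\<ominus>\<^bsub>N\<^esub> h x) \<oplus>\<^bsub>M\<^esub> x = \<zero>\<^bsub>M\<^esub>"
        by (rule inj) (simp_all add: i x hadd zero add_closed h0 hin hg N.l_neg)
    qed
  qed (use zero add_closed assoc acomm in auto)
  then interpret M: abelian_group M .
  have modL: "module A M"
  proof (rule moduleI)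
    show "cring A" by (rule N.is_cring)
  next
    fix a b x assume *: "a \<in> carrier A" "b \<in> carrier A" "x \<in> carrier M"
    show "(a \<oplus>\<^bsub>A\<^esub> b) \<odot>\<^bsub>M\<^esub> x = a \<odot>\<^bsub>M\<^esub> x \<oplus>\<^bsub>M\<^esub> b \<odot>\<^bsub>M\<^esub> x"
      by (rule inj) (simp_all add: * hl hadd l_closed hin N.smult_l_distr)
    show "(a \<otimes>\<^bsub>A\<^esub> b) \<odot>\<^bsub>M\<^esub> x = a \<odot>\<^bsub>M\<^esub> (b \<odot>\<^bsub>M\<^esub> x)"
      by (rule inj) (simp_all add: * hl hadd l_closed hin N.smult_assoc1)
  next
    fix a x y assume *: "a \<in> carrier A" "x \<in> carrier M" "y \<in> carrier M"
    show "a \<odot>\<^bsub>M\<^esub> (x \<oplus>\<^bsub>M\<^esub> y) = a \<odot>\<^bsub>M\<^esub> x \<oplus>\<^bsub>M\<^esub> a \<odot>\<^bsub>M\<^esub> y"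
      by (rule inj) (simp_all add: * hl hadd l_closed hin N.smult_r_distr)
  next
    fix x assume *: "x \<in> carrier M"
    show "\<one>\<^bsub>A\<^esub> \<odot>\<^bsub>M\<^esub> x = x"
      by (rule inj) (simp_all add: * hl l_closed hin)
  qed (use \<open>abelian_group M\<close> l_closed in auto)
  have modR: "module B (right_module M)"
  proof (rule moduleI)
    show "cring B" by (rule NR.is_cring)
    show "abelian_group (right_module M)"
      using zero add_closed by (intro abelian_groupI)
        (auto simp: assoc acomm M.add.m_lcomm intro: M.add.l_inv_ex)
  next
    fix a b x assume *: "a \<in> carrier B" "b \<in> carrier B" "x \<in> carrier (right_module M)"
    show "(a \<oplus>\<^bsub>B\<^esub> b) \<odot>\<^bsub>right_module M\<^esub> x =
        a \<odot>\<^bsub>right_module M\<^esub> x \<oplus>\<^bsub>right_module M\<^esub> b \<odot>\<^bsub>right_module M\<^esub> x"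
      using NR.smult_l_distr[of a b "h x"] *
      by (intro inj) (simp_all add: hr hadd r_closed hin)
    show "(a \<otimes>\<^bsub>B\<^esub> b) \<odot>\<^bsub>right_module M\<^esub> x =
        a \<odot>\<^bsub>right_module M\<^esub> (b \<odot>\<^bsub>right_module M\<^esub> x)"
      using NR.smult_assoc1[of a b "h x"] *
      by (intro inj) (simp_all add: hr hadd r_closed hin)
  next
    fix a x y
    assume *: "a \<in> carrier B" "x \<in> carrier (right_module M)" "y \<in> carrier (right_module M)"
    show "a \<odot>\<^bsub>right_module M\<^esub> (x \<oplus>\<^bsub>right_module M\<^esub> y) =
        a \<odot>\<^bsub>right_module M\<^esub> x \<oplus>\<^bsub>right_module M\<^esub> a \<odot>\<^bsub>right_module M\<^esub> y"
      using NR.smult_r_distr[of a "h x" "h y"] *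
      by (intro inj) (simp_all add: hr hadd r_closed hin add_closed)
  next
    fix x assume *: "x \<in> carrier (right_module M)"
    show "\<one>\<^bsub>B\<^esub> \<odot>\<^bsub>right_module M\<^esub> x = x"
      using NR.smult_one[of "h x"] *
      by (intro inj) (simp_all add: hr r_closed hin)
  qed (use r_closed in auto)
  have comm': "rsmult M (a \<odot>\<^bsub>M\<^esub> m) b = a \<odot>\<^bsub>M\<^esub> rsmult M m b"
    if "a \<in> carrier A" "m \<in> carrier M" "b \<in> carrier B" for a m b
    by (rule inj) (simp_all add: that hl hr l_closed r_closed comm hin)
  have hgr: "m \<in> homog M d \<longleftrightarrow> h m \<in> homog N d" if "m \<in> carrier M" for m d
  proof
    assume "h m \<in> homog N d"
    then obtain m' where "m' \<in> homog M d" "h m = h m'" using homog[of d] by blast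
    then show "m \<in> homog M d" using inj that homog_sub by blast
  qed (use homog in blast)
  have hom0: "\<zero>\<^bsub>M\<^esub> \<in> homog M d" for d
    using hgr[OF zero] h0 additive_subgroup.zero_closed[OF sub] by metis
  have hneg: "h (\<ominus>\<^bsub>M\<^esub> x) = \<ominus>\<^bsub>N\<^esub> h x" if x: "x \<in> carrier M" for x
    using hadd[of "\<ominus>\<^bsub>M\<^esub> x" x] x by (simp add: M.l_neg h0 hin N.add.inv_equality)
  have sub': "additive_subgroup (homog M d) M" for d
  proof (rule additive_subgroup.intro, unfold_locales)
    interpret S: additive_subgroup "homog N d" N by (rule sub)
    show "homog M d \<subseteq> carrier (add_monoid M)" using homog_sub by simp
    show "x \<otimes>\<^bsub>add_monoid M\<^esub> y \<in> homog M d" if "x \<in> homog M d" "y \<in> homog M d" for x y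
    proof -
      have c: "x \<in> carrier M" "y \<in> carrier M" using that homog_sub by blast+
      then show ?thesis using that by (simp add: hgr add_closed hadd)
    qed
    show "\<one>\<^bsub>add_monoid M\<^esub> \<in> homog M d" using hom0 by simp
    show "inv\<^bsub>add_monoid M\<^esub> x \<in> homog M d" if "x \<in> homog M d" for x
    proof -
      have c: "x \<in> carrier M" using that homog_sub by blast
      then show ?thesis using that hneg[OF c] hgr[OF c]
        by (simp add: hgr[OF M.a_inv_closed[OF c]] flip: a_inv_def)
    qed
  qed
  have dec': "\<exists>!c. (\<forall>d. c d \<in> homog M d) \<and> finite {d. c d \<noteq> \<zero>\<^bsub>M\<^esub>} \<and>
        m = finsum M c {d. c d \<noteq> \<zero>\<^bsub>M\<^esub>}" if m: "m \<in> carrier M" for m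
  proof -
    \<comment> \<open>Decompositions of \<open>m\<close> and of \<open>h m\<close> correspond under \<open>h\<close>.\<close>
    have transfer: "(\<forall>d. c d \<in> homog M d) \<and> finite {d. c d \<noteq> \<zero>\<^bsub>M\<^esub>} \<and> m = finsum M c {d. c d \<noteq> \<zero>\<^bsub>M\<^esub>} \<longleftrightarrow>
       (\<forall>d. h (c d) \<in> homog N d) \<and> finite {d. h (c d) \<noteq> \<zero>\<^bsub>N\<^esub>} \<and>
       h m = finsum N (\<lambda>d. h (c d)) {d. h (c d) \<noteq> \<zero>\<^bsub>N\<^esub>}"
      if c: "\<And>d. c d \<in> carrier M" for c :: "int \<Rightarrow> 'm"
    proof -
      have eq: "{d. c d \<noteq> \<zero>\<^bsub>M\<^esub>} = {d. h (c d) \<noteq> \<zero>\<^bsub>N\<^esub>}"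
        using inj[OF _ c zero] h0 by metis
      have "h (finsum M c {d. c d \<noteq> \<zero>\<^bsub>M\<^esub>}) = finsum N (\<lambda>d. h (c d)) {d. h (c d) \<noteq> \<zero>\<^bsub>N\<^esub>}"
        if "finite {d. c d \<noteq> \<zero>\<^bsub>M\<^esub>}"
        unfolding eq[symmetric]
        by (rule finsum_transport) (use that c h0 hadd hin M.abelian_monoid_axioms N.abelian_monoid_axioms in auto)
      moreover have "finsum M c {d. c d \<noteq> \<zero>\<^bsub>M\<^esub>} \<in> carrier M"
        using c by (intro M.finsum_closed) auto
      ultimately show ?thesis using hgr[OF c] inj m unfolding eq by metis
    qed
    let ?P = "\<lambda>c. (\<forall>d. c d \<in> homog N d) \<and> finite {d. c d \<noteq> \<zero>\<^bsub>N\<^esub>} \<and>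
        h m = finsum N c {d. c d \<noteq> \<zero>\<^bsub>N\<^esub>}"
    have ex1: "\<exists>!c. ?P c" by (rule dec[OF hin[OF m]])
    define c where "c = (THE c. ?P c)"
    have "?P c" unfolding c_def by (rule theI'[OF ex1])
    then have c: "\<forall>d. c d \<in> homog N d" "finite {d. c d \<noteq> \<zero>\<^bsub>N\<^esub>}"
        "h m = finsum N c {d. c d \<noteq> \<zero>\<^bsub>N\<^esub>}" by blast+
    have uniq: "c' = c" if "?P c'" for c' using ex1 \<open>?P c\<close> that by blast
    have cin: "c d \<in> carrier N" for d using c(1) homog_in_carrier[OF N] by blast
    show ?thesis
    proof (rule ex1I[of _ "\<lambda>d. g (c d)"])
      show "(\<forall>d. g (c d) \<in> homog M d) \<and> finite {d. g (c d) \<noteq> \<zero>\<^bsub>M\<^esub>} \<and>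
         m = finsum M (\<lambda>d. g (c d)) {d. g (c d) \<noteq> \<zero>\<^bsub>M\<^esub>}"
        by (subst transfer) (use c cin in \<open>simp_all add: gin hg\<close>)
    next
      fix c' assume c': "(\<forall>d. c' d \<in> homog M d) \<and> finite {d. c' d \<noteq> \<zero>\<^bsub>M\<^esub>} \<and>
         m = finsum M c' {d. c' d \<noteq> \<zero>\<^bsub>M\<^esub>}"
      then have c'in: "c' d \<in> carrier M" for d using homog_sub by blast
      have "(\<lambda>d. h (c' d)) = c"
        using c' unfolding transfer[OF c'in] by (intro uniq)
      then show "c' = (\<lambda>d. g (c d))" using gh[OF c'in] by auto
    qed
  qed
  have gl': "a \<odot>\<^bsub>M\<^esub> m \<in> homog M (d + e)" if "a \<in> rhomog A d" "m \<in> homog M e" for a m d e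
  proof -
    have "m \<in> carrier M" "a \<in> carrier A" using that homog_sub rA by blast+
    then show ?thesis using that gl[of a d "h m" e] by (simp add: hgr l_closed hl)
  qed
  have gr': "rsmult M m b \<in> homog M (d + e)" if "m \<in> homog M d" "b \<in> rhomog B e" for m b d e
  proof -
    have "m \<in> carrier M" "b \<in> carrier B" using that homog_sub rB by blast+
    then show ?thesis using that gr[of "h m" d b e] by (simp add: hgr r_closed hr)
  qed
  have M_graded: "graded_bimodule A B M"
    by (rule graded_bimoduleI[OF modL modR comm' sub' dec' gl' gr'])
  moreover have "h \<in> graded_bimod_hom A B M N"
    unfolding graded_bimod_hom_def using hin hadd hl hr homog by (auto simp: hom_def)
  moreover have "g \<in> graded_bimod_hom A B N M"
  proof -
    have "g (x \<oplus>\<^bsub>N\<^esub> y) = g x \<oplus>\<^bsub>M\<^esub> g y" if "x \<in> carrier N" "y \<in> carrier N" for x y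
      using that by (intro inj) (simp_all add: gin hg hadd add_closed)
    moreover have "g (a \<odot>\<^bsub>N\<^esub> x) = a \<odot>\<^bsub>M\<^esub> g x" if "a \<in> carrier A" "x \<in> carrier N" for a x
      using that by (intro inj) (simp_all add: gin hg hl l_closed)
    moreover have "g (rsmult N x b) = rsmult M (g x) b" if "b \<in> carrier B" "x \<in> carrier N" for b x
      using that NR.smult_closed[of b x] by (intro inj) (simp_all add: gin hg hr r_closed)
    moreover have "g ` homog N d \<subseteq> homog M d" for d
    proof -
      have "g (h x) \<in> homog M d" if "x \<in> homog M d" for x
        using gh homog_sub that by (metis subsetD)
      then show ?thesis unfolding homog[of d, symmetric] by blast
    qed
    ultimately show ?thesis unfolding graded_bimod_hom_def by (auto simp: hom_def gin)
  qed
  ultimately show ?thesis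
    unfolding graded_bimod_iso_def using N gh hg by blast
qed

lemma graded_bimod_isoE:
  assumes "graded_bimod_iso A B M N"
  obtains h where "graded_bimodule A B M" "graded_bimodule A B N" "bij_betw h (carrier M) (carrier N)"
    "h \<zero>\<^bsub>M\<^esub> = \<zero>\<^bsub>N\<^esub>"
    "\<And>x. x \<in> carrier M \<Longrightarrow> h x \<in> carrier N"
    "\<And>x y. x \<in> carrier M \<Longrightarrow> y \<in> carrier M \<Longrightarrow> h (x \<oplus>\<^bsub>M\<^esub> y) = h x \<oplus>\<^bsub>N\<^esub> h y"
    "\<And>a x. a \<in> carrier A \<Longrightarrow> x \<in> carrier M \<Longrightarrow> h (a \<odot>\<^bsub>M\<^esub> x) = a \<odot>\<^bsub>N\<^esub> h x"
    "\<And>b x. b \<in> carrier B \<Longrightarrow> x \<in> carrier M \<Longrightarrow> h (rsmult M x b) = rsmult N (h x) b"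
    "\<And>d. h ` homog M d = homog N d"
proof -
  obtain h h' where h: "h \<in> graded_bimod_hom A B M N" and h': "h' \<in> graded_bimod_hom A B N M"
    and hh: "\<And>m. m \<in> carrier M \<Longrightarrow> h' (h m) = m" "\<And>m. m \<in> carrier N \<Longrightarrow> h (h' m) = m"
    and M: "graded_bimodule A B M" and N: "graded_bimodule A B N"
    using assms unfolding graded_bimod_iso_def by blast
  have hin: "\<And>x. x \<in> carrier M \<Longrightarrow> h x \<in> carrier N"
    and h'in: "\<And>x. x \<in> carrier N \<Longrightarrow> h' x \<in> carrier M"
    and hadd: "\<And>x y. x \<in> carrier M \<Longrightarrow> y \<in> carrier M \<Longrightarrow> h (x \<oplus>\<^bsub>M\<^esub> y) = h x \<oplus>\<^bsub>N\<^esub> h y"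
    using h h' by (auto simp: graded_bimod_hom_def hom_def)
  interpret M: abelian_group M by (rule graded_bimodule_abelian_group[OF M])
  interpret N: abelian_group N by (rule graded_bimodule_abelian_group[OF N])
  show ?thesis
  proof (rule that[OF M N])
    show "bij_betw h (carrier M) (carrier N)"
      by (rule bij_betwI[where g = h']) (use hin h'in hh in auto)
    have "h \<zero>\<^bsub>M\<^esub> \<oplus>\<^bsub>N\<^esub> h \<zero>\<^bsub>M\<^esub> = h \<zero>\<^bsub>M\<^esub>" using hadd[of "\<zero>\<^bsub>M\<^esub>" "\<zero>\<^bsub>M\<^esub>"] by simp
    then show "h \<zero>\<^bsub>M\<^esub> = \<zero>\<^bsub>N\<^esub>" by (simp add: hin)
    show "h ` homog M d = homog N d" for d
    proof
      show "h ` homog M d \<subseteq> homog N d" using h by (auto simp: graded_bimod_hom_def)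
      have "h' ` homog N d \<subseteq> homog M d" using h' by (auto simp: graded_bimod_hom_def)
      then show "homog N d \<subseteq> h ` homog M d"
        using hh(2) homog_in_carrier[OF N] by (metis (no_types) imageI subset_iff)
    qed
  qed (use h hin hadd in \<open>auto simp: graded_bimod_hom_def\<close>)
qed

lemma graded_bimod_iso_refl:
  assumes "graded_bimodule A B M"
  shows "graded_bimod_iso A B M M"
proof -
  have id: "(\<lambda>m. m) \<in> graded_bimod_hom A B M M"
    by (simp add: graded_bimod_hom_def hom_def)
  show ?thesis
    unfolding graded_bimod_iso_def by (intro conjI assms bexI[OF _ id]) simp_all
qed

lemma graded_bimod_iso_sym:
  "graded_bimod_iso A B M N \<Longrightarrow> graded_bimod_iso A B N M"
  unfolding graded_bimod_iso_def by blast

lemma graded_bimod_hom_comp: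
  assumes "h \<in> graded_bimod_hom A B M N" "g \<in> graded_bimod_hom A B N Q"
  shows "g \<circ> h \<in> graded_bimod_hom A B M Q"
proof -
  have "h ` homog M d \<subseteq> homog N d" "g ` homog N d \<subseteq> homog Q d" for d
    using assms by (simp_all add: graded_bimod_hom_def)
  then have "(g \<circ> h) ` homog M d \<subseteq> homog Q d" for d
    unfolding image_comp[symmetric] by blast
  then show ?thesis
    using assms unfolding graded_bimod_hom_def by (simp add: hom_def Pi_iff)
qed

lemma graded_bimod_iso_trans:
  assumes "graded_bimod_iso A B M N" "graded_bimod_iso A B N Q"
  shows "graded_bimod_iso A B M Q"
proof -
  obtain h h' where h: "h \<in> graded_bimod_hom A B M N" "h' \<in> graded_bimod_hom A B N M"
      "\<forall>m\<in>carrier M. h' (h m) = m" "\<forall>m\<in>carrier N. h (h' m) = m"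
    using assms(1) unfolding graded_bimod_iso_def by blast
  obtain g g' where g: "g \<in> graded_bimod_hom A B N Q" "g' \<in> graded_bimod_hom A B Q N"
      "\<forall>m\<in>carrier N. g' (g m) = m" "\<forall>m\<in>carrier Q. g (g' m) = m"
    using assms(2) unfolding graded_bimod_iso_def by blast
  have "h m \<in> carrier N" if "m \<in> carrier M" for m
    using h(1) that by (auto simp: graded_bimod_hom_def hom_def)
  moreover have "g' m \<in> carrier N" if "m \<in> carrier Q" for m
    using g(2) that by (auto simp: graded_bimod_hom_def hom_def)
  ultimately have "(\<forall>m\<in>carrier M. (h' \<circ> g') ((g \<circ> h) m) = m) \<and> (\<forall>m\<in>carrier Q. (g \<circ> h) ((h' \<circ> g') m) = m)"
    using h g by simp
  moreover have "graded_bimodule A B M" "graded_bimodule A B Q"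
    using assms unfolding graded_bimod_iso_def by blast+
  ultimately show ?thesis
    unfolding graded_bimod_iso_def
    using graded_bimod_hom_comp[OF h(1) g(1)] graded_bimod_hom_comp[OF g(2) h(2)] by blast
qed

lemma left_support_mono:
  fixes M :: "('k::field_char_0, 'm) vec_bimod"
    and N :: "('k, 'n) vec_bimod"
  assumes iso: "weyl_bimod_iso n M N"
  shows "left_support n M \<subseteq> left_support n N"
proof -
  obtain h where M: "graded_bimodule (weyl_ring n) (weyl_ring n) M"
    and h: "bij_betw h (carrier M) (carrier N)"
    "h \<zero>\<^bsub>M\<^esub> = \<zero>\<^bsub>N\<^esub>"
    "\<And>a x. a \<in> carrier (weyl_ring n) \<Longrightarrow> x \<in> carrier M \<Longrightarrow> h (a \<odot>\<^bsub>M\<^esub> x) = a \<odot>\<^bsub>N\<^esub> h x"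
    by (rule graded_bimod_isoE[OF iso]) blast
  interpret M: abelian_group M by (rule graded_bimodule_abelian_group[OF M])
  have "f \<odot>\<^bsub>M\<^esub> m = \<zero>\<^bsub>M\<^esub>"
    if "f \<in> carrier (weyl_ring n)" "\<forall>m\<in>carrier N. f \<odot>\<^bsub>N\<^esub> m = \<zero>\<^bsub>N\<^esub>" "m \<in> carrier M" for f m
  proof -
    have "h (f \<odot>\<^bsub>M\<^esub> m) = h \<zero>\<^bsub>M\<^esub>" using that h bij_betwE[OF h(1)] by simp
    then show ?thesis
      using inj_onD[OF bij_betw_imp_inj_on[OF h(1)]] graded_bimodule_closed(1)[OF M] that by blast
  qed
  then show ?thesis unfolding left_support_def by blast
qed

lemma right_support_mono:
  fixes M :: "('k::field_char_0, 'm) vec_bimod"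
    and N :: "('k, 'n) vec_bimod"
  assumes iso: "weyl_bimod_iso n M N"
  shows "right_support n M \<subseteq> right_support n N"
proof -
  obtain h where M: "graded_bimodule (weyl_ring n) (weyl_ring n) M"
    and h: "bij_betw h (carrier M) (carrier N)"
    "h \<zero>\<^bsub>M\<^esub> = \<zero>\<^bsub>N\<^esub>"
    "\<And>a x. a \<in> carrier (weyl_ring n) \<Longrightarrow> x \<in> carrier M \<Longrightarrow> h (rsmult M x a) = rsmult N (h x) a"
    by (rule graded_bimod_isoE[OF iso]) blast
  interpret M: abelian_group M by (rule graded_bimodule_abelian_group[OF M])
  have "rsmult M m f = \<zero>\<^bsub>M\<^esub>"
    if "f \<in> carrier (weyl_ring n)" "\<forall>m\<in>carrier N. rsmult N m f = \<zero>\<^bsub>N\<^esub>" "m \<in> carrier M" for f m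
  proof -
    have "h (rsmult M m f) = h \<zero>\<^bsub>M\<^esub>" using that h bij_betwE[OF h(1)] by simp
    then show ?thesis
      using inj_onD[OF bij_betw_imp_inj_on[OF h(1)]] graded_bimodule_closed(2)[OF M] that by blast
  qed
  then show ?thesis unfolding right_support_def by blast
qed

lemma left_support_cong:
  "weyl_bimod_iso n M N \<Longrightarrow> left_support n M = left_support n N"
  by (simp add: graded_bimod_iso_sym left_support_mono subset_antisym)

lemma right_support_cong:
  "weyl_bimod_iso n M N \<Longrightarrow> right_support n M = right_support n N"
  by (simp add: graded_bimod_iso_sym right_support_mono subset_antisym)

section \<open>Tensor products determined by a pairing\<close>

text \<open>
  An element \<open>m\<close> of \<open>M\<close> with \<open>m \<otimes> f = 0\<close> for the evident reason that \<open>m\<close> lies in \<open>M\<close> times the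
  annihilator of \<open>f\<close>.  Two summands are enough for all tensor products below.
\<close>

definition tensor_kills ::
  "('s, 'x) ring_scheme \<Rightarrow> ('a, 's, 'm) bimod \<Rightarrow> ('s, 'b, 'n) bimod \<Rightarrow> 'm \<Rightarrow> 'n \<Rightarrow> bool" where
  "tensor_kills S M N m f \<longleftrightarrow> (\<exists>e1\<in>carrier M. \<exists>e2\<in>carrier M. \<exists>s1\<in>carrier S. \<exists>s2\<in>carrier S.
     m = rsmult M e1 s1 \<oplus>\<^bsub>M\<^esub> rsmult M e2 s2 \<and> s1 \<odot>\<^bsub>N\<^esub> f = \<zero>\<^bsub>N\<^esub> \<and> s2 \<odot>\<^bsub>N\<^esub> f = \<zero>\<^bsub>N\<^esub>)"

text \<open>
  The map that a balanced pairing induces on \<open>M \<otimes> N\<close> is studied through its lift \<open>ev\<close> to the free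
  abelian group on pairs, where it is compared with the subgroup \<open>K\<close> of relations.
\<close>

locale balanced_pairing =
  M: abelian_group M + N: abelian_group N + Q: abelian_group Q
  for S :: "'s graded_ring" and M :: "('a, 's, 'm) bimod" and N :: "('s, 'b, 'n) bimod"
    and Q :: "('a, 'b, 'q) bimod" +
  fixes \<phi> :: "'m \<Rightarrow> 'n \<Rightarrow> 'q"
  assumes M_closed: "x \<in> carrier M \<Longrightarrow> s \<in> carrier S \<Longrightarrow> rsmult M x s \<in> carrier M"
    and N_closed: "y \<in> carrier N \<Longrightarrow> s \<in> carrier S \<Longrightarrow> s \<odot>\<^bsub>N\<^esub> y \<in> carrier N"
    and pair_closed: "x \<in> carrier M \<Longrightarrow> y \<in> carrier N \<Longrightarrow> \<phi> x y \<in> carrier Q"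
    and pair_add_left: "x \<in> carrier M \<Longrightarrow> x' \<in> carrier M \<Longrightarrow> y \<in> carrier N \<Longrightarrow>
      \<phi> (x \<oplus>\<^bsub>M\<^esub> x') y = \<phi> x y \<oplus>\<^bsub>Q\<^esub> \<phi> x' y"
    and pair_add_right: "x \<in> carrier M \<Longrightarrow> y \<in> carrier N \<Longrightarrow> y' \<in> carrier N \<Longrightarrow>
      \<phi> x (y \<oplus>\<^bsub>N\<^esub> y') = \<phi> x y \<oplus>\<^bsub>Q\<^esub> \<phi> x y'"
    and pair_balanced: "x \<in> carrier M \<Longrightarrow> s \<in> carrier S \<Longrightarrow> y \<in> carrier N \<Longrightarrow>
      \<phi> (rsmult M x s) y = \<phi> x (s \<odot>\<^bsub>N\<^esub> y)"
begin

abbreviation "pairs \<equiv> carrier M \<times> carrier N"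
abbreviation "Fr \<equiv> tensor_free M N"
abbreviation "K \<equiv> tensor_rel S M N"

lemma Fr_carrier: "c \<in> carrier Fr \<longleftrightarrow> Poly_Mapping.keys c \<subseteq> pairs"
  by (simp add: tensor_free_def)

lemma Fr_simps: "c \<otimes>\<^bsub>Fr\<^esub> d = c + d" "\<one>\<^bsub>Fr\<^esub> = 0"
  by (simp_all add: tensor_free_def)

lemma Fr_comm_group: "comm_group Fr"
  unfolding tensor_free_def by (rule abelian_free_Abelian_group)

lemma Fr_frag_of: "x \<in> carrier M \<Longrightarrow> y \<in> carrier N \<Longrightarrow> frag_of (x, y) \<in> carrier Fr"
  by (simp add: tensor_free_def)

lemma Fr_diff: "c \<in> carrier Fr \<Longrightarrow> d \<in> carrier Fr \<Longrightarrow> c - d \<in> carrier Fr"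
  unfolding Fr_carrier by (rule order_trans[OF keys_diff Un_least])

lemma Fr_inv: "c \<in> carrier Fr \<Longrightarrow> inv\<^bsub>Fr\<^esub> c = - c"
  by (simp add: tensor_free_def)

abbreviation "rels \<equiv> {frag_of (x \<oplus>\<^bsub>M\<^esub> x', y) - frag_of (x, y) - frag_of (x', y) | x x' y.
         x \<in> carrier M \<and> x' \<in> carrier M \<and> y \<in> carrier N} \<union>
      {frag_of (x, y \<oplus>\<^bsub>N\<^esub> y') - frag_of (x, y) - frag_of (x, y') | x y y'.
         x \<in> carrier M \<and> y \<in> carrier N \<and> y' \<in> carrier N} \<union>
      {frag_of (rsmult M x s, y) - frag_of (x, s \<odot>\<^bsub>N\<^esub> y) | x s y.
         x \<in> carrier M \<and> s \<in> carrier S \<and> y \<in> carrier N}"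

lemma rels_in_Fr: "rels \<subseteq> carrier Fr"
  by (intro Un_least; clarify; intro Fr_diff Fr_frag_of M.a_closed N.a_closed M_closed N_closed; assumption)

lemma rels_in_K: "rels \<subseteq> K"
  unfolding tensor_rel_def by (rule subsetI) (rule generate.incl)

lemma K_subgroup: "subgroup K Fr"
proof -
  interpret Fr: comm_group Fr by (rule Fr_comm_group)
  show ?thesis unfolding tensor_rel_def by (rule Fr.generate_is_subgroup[OF rels_in_Fr])
qed

lemma K_in_Fr: "k \<in> K \<Longrightarrow> k \<in> carrier Fr"
  using K_subgroup subgroup.subset by blast

lemma K_zero: "0 \<in> K"
  using subgroup.one_closed[OF K_subgroup] by (simp add: Fr_simps)

lemma K_add: "k \<in> K \<Longrightarrow> l \<in> K \<Longrightarrow> k + l \<in> K"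
  using subgroup.m_closed[OF K_subgroup] by (simp add: Fr_simps)

lemma K_neg: "k \<in> K \<Longrightarrow> - k \<in> K"
  using subgroup.m_inv_closed[OF K_subgroup] by (metis Fr_inv K_in_Fr)

lemma K_diff: "k \<in> K \<Longrightarrow> l \<in> K \<Longrightarrow> k - l \<in> K"
  using K_add[OF _ K_neg] by simp

lemma K_add_left: "x \<in> carrier M \<Longrightarrow> x' \<in> carrier M \<Longrightarrow> y \<in> carrier N \<Longrightarrow>
   frag_of (x \<oplus>\<^bsub>M\<^esub> x', y) - frag_of (x, y) - frag_of (x', y) \<in> K"
  by (rule subsetD[OF rels_in_K]) blast

lemma K_add_right: "x \<in> carrier M \<Longrightarrow> y \<in> carrier N \<Longrightarrow> y' \<in> carrier N \<Longrightarrow>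
   frag_of (x, y \<oplus>\<^bsub>N\<^esub> y') - frag_of (x, y) - frag_of (x, y') \<in> K"
  by (rule subsetD[OF rels_in_K]) blast

lemma K_balanced: "x \<in> carrier M \<Longrightarrow> s \<in> carrier S \<Longrightarrow> y \<in> carrier N \<Longrightarrow>
   frag_of (rsmult M x s, y) - frag_of (x, s \<odot>\<^bsub>N\<^esub> y) \<in> K"
  by (rule subsetD[OF rels_in_K]) blast

lemma K_zero_left: "y \<in> carrier N \<Longrightarrow> frag_of (\<zero>\<^bsub>M\<^esub>, y) \<in> K"
  using K_neg[OF K_add_left[of "\<zero>\<^bsub>M\<^esub>" "\<zero>\<^bsub>M\<^esub>" y]] by simp

lemma K_zero_right: "x \<in> carrier M \<Longrightarrow> frag_of (x, \<zero>\<^bsub>N\<^esub>) \<in> K"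
  using K_neg[OF K_add_right[of x "\<zero>\<^bsub>N\<^esub>" "\<zero>\<^bsub>N\<^esub>"]] by simp

lemma K_kills:
  assumes "tensor_kills S M N m f" "f \<in> carrier N"
  shows "frag_of (m, f) \<in> K"
proof -
  obtain e1 e2 s1 s2 where e: "e1 \<in> carrier M" "e2 \<in> carrier M" "s1 \<in> carrier S" "s2 \<in> carrier S"
    and m: "m = rsmult M e1 s1 \<oplus>\<^bsub>M\<^esub> rsmult M e2 s2"
    and s: "s1 \<odot>\<^bsub>N\<^esub> f = \<zero>\<^bsub>N\<^esub>" "s2 \<odot>\<^bsub>N\<^esub> f = \<zero>\<^bsub>N\<^esub>"
    using assms(1) unfolding tensor_kills_def by blast
  have "frag_of (rsmult M e1 s1, f) \<in> K"
    using K_add[OF K_balanced[OF e(1,3) assms(2)] K_zero_right[OF e(1)]] s by simp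
  moreover have "frag_of (rsmult M e2 s2, f) \<in> K"
    using K_add[OF K_balanced[OF e(2,4) assms(2)] K_zero_right[OF e(2)]] s by simp
  ultimately have "frag_of (rsmult M e1 s1, f) + frag_of (rsmult M e2 s2, f)
      + (frag_of (m, f) - frag_of (rsmult M e1 s1, f) - frag_of (rsmult M e2 s2, f)) \<in> K"
    unfolding m by (intro K_add K_add_left M_closed e assms(2))
  then show ?thesis by simp
qed

definition ev :: "('m \<times> 'n \<Rightarrow>\<^sub>0 int) \<Rightarrow> 'q" where
  "ev = (SOME h. h \<in> hom Fr (add_monoid Q) \<and> (\<forall>x\<in>carrier M. \<forall>y\<in>carrier N. h (frag_of (x, y)) = \<phi> x y))"

lemma ev: "ev \<in> hom Fr (add_monoid Q)"
    "x \<in> carrier M \<Longrightarrow> y \<in> carrier N \<Longrightarrow> ev (frag_of (x, y)) = \<phi> x y"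
proof -
  have "(\<lambda>(x, y). \<phi> x y) ` pairs \<subseteq> carrier (add_monoid Q)"
    using pair_closed by auto
  then obtain h where "h \<in> hom Fr (add_monoid Q)" "\<And>p. p \<in> pairs \<Longrightarrow> h (frag_of p) = (\<lambda>(x, y). \<phi> x y) p"
    unfolding tensor_free_def by (rule comm_group.free_Abelian_group_universal[OF Q.a_comm_group]) blast
  then have "\<exists>h. h \<in> hom Fr (add_monoid Q) \<and> (\<forall>x\<in>carrier M. \<forall>y\<in>carrier N. h (frag_of (x, y)) = \<phi> x y)"
    by (intro exI[of _ h]) auto
  from someI_ex[OF this] show "ev \<in> hom Fr (add_monoid Q)"
    "x \<in> carrier M \<Longrightarrow> y \<in> carrier N \<Longrightarrow> ev (frag_of (x, y)) = \<phi> x y"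
    unfolding ev_def by blast+
qed

sublocale ev: group_hom Fr "add_monoid Q" ev
  using Fr_comm_group Q.a_comm_group ev(1)
  by (simp add: group_hom_def group_hom_axioms_def comm_group_def)

lemma ev_closed: "c \<in> carrier Fr \<Longrightarrow> ev c \<in> carrier Q"
  using ev.hom_closed by simp

lemma ev_zero: "ev 0 = \<zero>\<^bsub>Q\<^esub>"
  using ev.hom_one by (simp add: Fr_simps)

lemma ev_add: "c \<in> carrier Fr \<Longrightarrow> d \<in> carrier Fr \<Longrightarrow> ev (c + d) = ev c \<oplus>\<^bsub>Q\<^esub> ev d"
  using ev.hom_mult by (simp add: Fr_simps)

lemma ev_neg: "c \<in> carrier Fr \<Longrightarrow> ev (- c) = \<ominus>\<^bsub>Q\<^esub> ev c"
  using ev.hom_inv[of c] by (simp add: Fr_inv a_inv_def)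

lemma ev_diff: "c \<in> carrier Fr \<Longrightarrow> d \<in> carrier Fr \<Longrightarrow> ev (c - d) = ev c \<ominus>\<^bsub>Q\<^esub> ev d"
  using ev_add[of c "- d"] ev_neg[of d] Fr_diff[of 0 d] Fr_simps Fr_carrier by (simp add: a_minus_def)

lemma K_in_kernel: "K \<subseteq> kernel Fr (add_monoid Q) ev"
proof -
  have kernelI: "c \<in> kernel Fr (add_monoid Q) ev" if "c \<in> rels" "ev c = \<zero>\<^bsub>Q\<^esub>" for c
    using that(2) subsetD[OF rels_in_Fr that(1)] unfolding kernel_def by simp
  have cancel: "(a \<oplus>\<^bsub>Q\<^esub> b) \<ominus>\<^bsub>Q\<^esub> a \<ominus>\<^bsub>Q\<^esub> b = \<zero>\<^bsub>Q\<^esub>" if "a \<in> carrier Q" "b \<in> carrier Q" for a b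
    using that by (simp add: Q.minus_eq Q.a_comm[of a b] Q.a_assoc Q.r_neg)
  have "rels \<subseteq> kernel Fr (add_monoid Q) ev"
  proof
    fix c assume c: "c \<in> rels"
    then consider
      (1) x x' y where "c = frag_of (x \<oplus>\<^bsub>M\<^esub> x', y) - frag_of (x, y) - frag_of (x', y)"
        "x \<in> carrier M" "x' \<in> carrier M" "y \<in> carrier N"
      | (2) x y y' where "c = frag_of (x, y \<oplus>\<^bsub>N\<^esub> y') - frag_of (x, y) - frag_of (x, y')"
        "x \<in> carrier M" "y \<in> carrier N" "y' \<in> carrier N"
      | (3) x s y where "c = frag_of (rsmult M x s, y) - frag_of (x, s \<odot>\<^bsub>N\<^esub> y)"
        "x \<in> carrier M" "s \<in> carrier S" "y \<in> carrier N"
      by blast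
    then have "ev c = \<zero>\<^bsub>Q\<^esub>"
    proof cases
      case 1
      then show ?thesis
        by (simp add: ev_diff Fr_diff Fr_frag_of ev(2) pair_add_left pair_closed cancel)
    next
      case 2
      then show ?thesis
        by (simp add: ev_diff Fr_diff Fr_frag_of ev(2) pair_add_right pair_closed cancel)
    next
      case 3
      then show ?thesis
        by (simp add: ev_diff Fr_frag_of ev(2) M_closed N_closed pair_balanced pair_closed Q.minus_eq Q.r_neg)
    qed
    then show "c \<in> kernel Fr (add_monoid Q) ev" by (rule kernelI[OF c])
  qed
  then show ?thesis
    unfolding tensor_rel_def by (intro ev.G.generate_subgroup_incl ev.subgroup_kernel)
qed

lemma ev_K: "k \<in> K \<Longrightarrow> ev k = \<zero>\<^bsub>Q\<^esub>"
  using K_in_kernel unfolding kernel_def by auto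

text \<open>
  Balancing moves the coefficients of \<open>y = s\<^sub>1 f\<^sub>1 + s\<^sub>2 f\<^sub>2\<close> to the left factor.
\<close>

lemma mod_K_normal_form:
  assumes c: "c \<in> carrier Fr"
    and f: "f1 \<in> carrier N" "f2 \<in> carrier N"
    and gen: "\<And>y. y \<in> carrier N \<Longrightarrow> \<exists>s1\<in>carrier S. \<exists>s2\<in>carrier S. y = s1 \<odot>\<^bsub>N\<^esub> f1 \<oplus>\<^bsub>N\<^esub> s2 \<odot>\<^bsub>N\<^esub> f2"
  shows "\<exists>m1\<in>carrier M. \<exists>m2\<in>carrier M. c - frag_of (m1, f1) - frag_of (m2, f2) \<in> K"
proof -
  have "Poly_Mapping.keys c \<subseteq> pairs" using c by (simp add: Fr_carrier)
  then show ?thesis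
  proof (induction c rule: frag_induction)
    case zero
    have "0 - frag_of (\<zero>\<^bsub>M\<^esub>, f1) - frag_of (\<zero>\<^bsub>M\<^esub>, f2) \<in> K"
      by (intro K_diff K_zero K_zero_left f)
    then show ?case by blast
  next
    case (one p)
    obtain x y where p: "p = (x, y)" "x \<in> carrier M" "y \<in> carrier N"
      using one by (cases p) auto
    obtain s1 s2 where s: "s1 \<in> carrier S" "s2 \<in> carrier S" "y = s1 \<odot>\<^bsub>N\<^esub> f1 \<oplus>\<^bsub>N\<^esub> s2 \<odot>\<^bsub>N\<^esub> f2"
      using gen[OF p(3)] by blast
    have "(frag_of (x, y) - frag_of (x, s1 \<odot>\<^bsub>N\<^esub> f1) - frag_of (x, s2 \<odot>\<^bsub>N\<^esub> f2))
       - (frag_of (rsmult M x s1, f1) - frag_of (x, s1 \<odot>\<^bsub>N\<^esub> f1))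
       - (frag_of (rsmult M x s2, f2) - frag_of (x, s2 \<odot>\<^bsub>N\<^esub> f2)) \<in> K" (is "?k \<in> K")
      unfolding s(3) by (intro K_diff K_add_right K_balanced p s f N_closed)
    moreover have "?k = frag_of p - frag_of (rsmult M x s1, f1) - frag_of (rsmult M x s2, f2)"
      by (simp add: p(1))
    ultimately show ?case using M_closed p s by metis
  next
    case (diff a b)
    then obtain a1 a2 b1 b2 where m: "a1 \<in> carrier M" "a2 \<in> carrier M" "b1 \<in> carrier M" "b2 \<in> carrier M"
      and k: "a - frag_of (a1, f1) - frag_of (a2, f2) \<in> K" "b - frag_of (b1, f1) - frag_of (b2, f2) \<in> K"
      by blast
    have sub: "frag_of (u, f) - frag_of (u \<ominus>\<^bsub>M\<^esub> v, f) - frag_of (v, f) \<in> K"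
      if "u \<in> carrier M" "v \<in> carrier M" "f \<in> carrier N" for u v f
    proof -
      have "u \<ominus>\<^bsub>M\<^esub> v \<oplus>\<^bsub>M\<^esub> v = u" using that by (simp add: M.minus_eq M.a_assoc M.l_neg)
      then show ?thesis using K_add_left[of "u \<ominus>\<^bsub>M\<^esub> v" v f] that by simp
    qed
    have "(a - frag_of (a1, f1) - frag_of (a2, f2)) - (b - frag_of (b1, f1) - frag_of (b2, f2))
      + (frag_of (a1, f1) - frag_of (a1 \<ominus>\<^bsub>M\<^esub> b1, f1) - frag_of (b1, f1))
      + (frag_of (a2, f2) - frag_of (a2 \<ominus>\<^bsub>M\<^esub> b2, f2) - frag_of (b2, f2)) \<in> K" (is "?k \<in> K")
      by (intro K_add K_diff[OF k] sub m f)
    moreover have "?k = a - b - frag_of (a1 \<ominus>\<^bsub>M\<^esub> b1, f1) - frag_of (a2 \<ominus>\<^bsub>M\<^esub> b2, f2)"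
      by simp
    ultimately show ?case using M.minus_closed m by metis
  qed
qed

text \<open>
  By the normal form, an element of the kernel of the pairing is \<open>m\<^sub>1 \<otimes> f\<^sub>1 + m\<^sub>2 \<otimes> f\<^sub>2\<close> with
  \<open>\<phi> m\<^sub>1 f\<^sub>1 + \<phi> m\<^sub>2 f\<^sub>2 = 0\<close>; the hypothesis \<open>indep\<close> says that both summands are then zero.
\<close>

lemma kernel_ev:
  assumes f: "f1 \<in> carrier N" "f2 \<in> carrier N"
    and gen: "\<And>y. y \<in> carrier N \<Longrightarrow> \<exists>s1\<in>carrier S. \<exists>s2\<in>carrier S. y = s1 \<odot>\<^bsub>N\<^esub> f1 \<oplus>\<^bsub>N\<^esub> s2 \<odot>\<^bsub>N\<^esub> f2"
    and indep: "\<And>m1 m2. m1 \<in> carrier M \<Longrightarrow> m2 \<in> carrier M \<Longrightarrow> \<phi> m1 f1 \<oplus>\<^bsub>Q\<^esub> \<phi> m2 f2 = \<zero>\<^bsub>Q\<^esub> \<Longrightarrow>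
      tensor_kills S M N m1 f1 \<and> tensor_kills S M N m2 f2"
  shows "kernel Fr (add_monoid Q) ev = K"
proof
  show "kernel Fr (add_monoid Q) ev \<subseteq> K"
  proof
    fix c assume "c \<in> kernel Fr (add_monoid Q) ev"
    then have c: "c \<in> carrier Fr" "ev c = \<zero>\<^bsub>Q\<^esub>" by (auto simp: kernel_def)
    obtain m1 m2 where m: "m1 \<in> carrier M" "m2 \<in> carrier M"
      and k: "c - frag_of (m1, f1) - frag_of (m2, f2) \<in> K"
      using mod_K_normal_form[OF c(1) f gen] by blast
    have "ev (frag_of (m1, f1) + frag_of (m2, f2)) = ev (c - (c - frag_of (m1, f1) - frag_of (m2, f2)))"
      by (simp add: add.commute)
    also have "\<dots> = \<zero>\<^bsub>Q\<^esub>"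
      using ev_diff[OF c(1) K_in_Fr[OF k]] ev_K[OF k] c(2) by (simp add: Q.minus_eq)
    finally have "\<phi> m1 f1 \<oplus>\<^bsub>Q\<^esub> \<phi> m2 f2 = \<zero>\<^bsub>Q\<^esub>"
      using m f by (simp add: ev_add Fr_frag_of ev(2))
    then have "frag_of (m1, f1) \<in> K" "frag_of (m2, f2) \<in> K"
      using indep[OF m] K_kills f by blast+
    then have "(c - frag_of (m1, f1) - frag_of (m2, f2)) + frag_of (m1, f1) + frag_of (m2, f2) \<in> K"
      using K_add k by blast
    then show "c \<in> K" by simp
  qed
qed (rule K_in_kernel)

lemma coset_eq_fibre:
  assumes ker: "kernel Fr (add_monoid Q) ev = K" and c: "c \<in> carrier Fr"
  shows "K #>\<^bsub>Fr\<^esub> c = {d \<in> carrier Fr. ev d = ev c}"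
proof
  show "K #>\<^bsub>Fr\<^esub> c \<subseteq> {d \<in> carrier Fr. ev d = ev c}"
    using c K_in_Fr by (auto simp: r_coset_def Fr_simps ev_add ev_K ev_closed)
      (metis Fr_simps(1) ev.G.m_closed)
  show "{d \<in> carrier Fr. ev d = ev c} \<subseteq> K #>\<^bsub>Fr\<^esub> c"
  proof clarify
    fix d assume d: "d \<in> carrier Fr" "ev d = ev c"
    then have "d - c \<in> kernel Fr (add_monoid Q) ev"
      using c by (simp add: kernel_def Fr_diff ev_diff Q.minus_eq Q.r_neg ev_closed)
    then show "d \<in> K #>\<^bsub>Fr\<^esub> c"
      unfolding ker r_coset_def Fr_simps by (auto intro!: bexI[of _ "d - c"])
  qed
qed

text \<open>
  The actions on a tensor product are unions over all representatives of a coset.  Since cosets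
  are fibres of \<open>ev\<close>, an operation that corresponds under \<open>ev\<close> to an endomorphism \<open>\<alpha>\<close> of \<open>Q\<close> gives
  the same coset for each representative.
\<close>

lemma act_on_coset:
  assumes ker: "kernel Fr (add_monoid Q) ev = K" and c: "c \<in> carrier Fr"
    and u: "\<And>x y. x \<in> carrier M \<Longrightarrow> y \<in> carrier N \<Longrightarrow> u (x, y) \<in> pairs"
    and hom: "\<alpha> \<in> hom (add_monoid Q) (add_monoid Q)"
    and comm: "\<And>x y. x \<in> carrier M \<Longrightarrow> y \<in> carrier N \<Longrightarrow> ev (frag_of (u (x, y))) = \<alpha> (\<phi> x y)"
  shows "frag_extend (\<lambda>p. frag_of (u p)) c \<in> carrier Fr"
    "ev (frag_extend (\<lambda>p. frag_of (u p)) c) = \<alpha> (ev c)"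
    "(\<Union>d\<in>K #>\<^bsub>Fr\<^esub> c. K #>\<^bsub>Fr\<^esub> frag_extend (\<lambda>p. frag_of (u p)) d) =
      K #>\<^bsub>Fr\<^esub> frag_extend (\<lambda>p. frag_of (u p)) c"
proof -
  let ?E = "frag_extend (\<lambda>p. frag_of (u p))"
  interpret \<alpha>: group_hom "add_monoid Q" "add_monoid Q" \<alpha>
    using hom Q.a_comm_group by (simp add: group_hom_def group_hom_axioms_def comm_group_def)
  have \<alpha>0: "\<alpha> \<zero>\<^bsub>Q\<^esub> = \<zero>\<^bsub>Q\<^esub>" using \<alpha>.hom_one by simp
  have \<alpha>d: "\<alpha> (a \<ominus>\<^bsub>Q\<^esub> b) = \<alpha> a \<ominus>\<^bsub>Q\<^esub> \<alpha> b" if "a \<in> carrier Q" "b \<in> carrier Q" for a b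
    using that \<alpha>.hom_mult[of a "\<ominus>\<^bsub>Q\<^esub> b"] \<alpha>.hom_inv[of b] by (simp add: Q.minus_eq flip: a_inv_def)
  have E: "?E d \<in> carrier Fr \<and> ev (?E d) = \<alpha> (ev d)" if d: "d \<in> carrier Fr" for d
  proof -
    have "Poly_Mapping.keys d \<subseteq> pairs" using d by (simp add: Fr_carrier)
    then have "d \<in> carrier Fr \<and> ?E d \<in> carrier Fr \<and> ev (?E d) = \<alpha> (ev d)"
    proof (induction d rule: frag_induction)
      case zero
      then show ?case by (simp add: Fr_carrier ev_zero \<alpha>0)
    next
      case (one p)
      then obtain x y where "p = (x, y)" "x \<in> carrier M" "y \<in> carrier N" by (cases p) auto
      then show ?case using u[of x y] comm[of x y] by (auto simp: Fr_carrier ev(2))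
    next
      case (diff a b)
      then show ?case by (simp add: frag_extend_diff Fr_diff ev_diff \<alpha>d ev_closed)
    qed
    then show ?thesis by blast
  qed
  show 1: "?E c \<in> carrier Fr" "ev (?E c) = \<alpha> (ev c)" using E[OF c] by blast+
  have "K #>\<^bsub>Fr\<^esub> ?E d = K #>\<^bsub>Fr\<^esub> ?E c" if "d \<in> K #>\<^bsub>Fr\<^esub> c" for d
  proof -
    have d: "d \<in> carrier Fr" "ev d = ev c" using that coset_eq_fibre[OF ker c] by auto
    show ?thesis using E[OF d(1)] 1 d(2) by (simp add: coset_eq_fibre[OF ker])
  qed
  moreover have "c \<in> K #>\<^bsub>Fr\<^esub> c" using c by (simp add: coset_eq_fibre[OF ker])
  ultimately show "(\<Union>d\<in>K #>\<^bsub>Fr\<^esub> c. K #>\<^bsub>Fr\<^esub> ?E d) = K #>\<^bsub>Fr\<^esub> ?E c" by blast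
qed

text \<open>
  The induced map is onto because the values of the pairing span the graded pieces of \<open>Q\<close>, and it
  is injective by \<open>kernel_ev\<close>.
\<close>

theorem tensor_iso_of_pairing:
  assumes Q_graded: "graded_bimodule A B Q"
    and ring_grading: "\<And>d. rhomog A d \<subseteq> carrier A" "\<And>d. rhomog B d \<subseteq> carrier B"
    and left: "\<And>a x. a \<in> carrier A \<Longrightarrow> x \<in> carrier M \<Longrightarrow> a \<odot>\<^bsub>M\<^esub> x \<in> carrier M"
      "\<And>a x y. a \<in> carrier A \<Longrightarrow> x \<in> carrier M \<Longrightarrow> y \<in> carrier N \<Longrightarrow> \<phi> (a \<odot>\<^bsub>M\<^esub> x) y = a \<odot>\<^bsub>Q\<^esub> \<phi> x y"
    and right: "\<And>b y. b \<in> carrier B \<Longrightarrow> y \<in> carrier N \<Longrightarrow> rsmult N y b \<in> carrier N"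
      "\<And>b x y. b \<in> carrier B \<Longrightarrow> x \<in> carrier M \<Longrightarrow> y \<in> carrier N \<Longrightarrow> \<phi> x (rsmult N y b) = rsmult Q (\<phi> x y) b"
    and homog_sub: "\<And>d. homog M d \<subseteq> carrier M" "\<And>d. homog N d \<subseteq> carrier N"
    and homog_Q: "\<And>d. homog Q d = generate (add_monoid Q)
      {\<phi> x y | x y i j. x \<in> homog M i \<and> y \<in> homog N j \<and> i + j = d}"
    and f: "f1 \<in> carrier N" "f2 \<in> carrier N"
    and gen: "\<And>y. y \<in> carrier N \<Longrightarrow> \<exists>s1\<in>carrier S. \<exists>s2\<in>carrier S. y = s1 \<odot>\<^bsub>N\<^esub> f1 \<oplus>\<^bsub>N\<^esub> s2 \<odot>\<^bsub>N\<^esub> f2"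
    and indep: "\<And>m1 m2. m1 \<in> carrier M \<Longrightarrow> m2 \<in> carrier M \<Longrightarrow> \<phi> m1 f1 \<oplus>\<^bsub>Q\<^esub> \<phi> m2 f2 = \<zero>\<^bsub>Q\<^esub> \<Longrightarrow>
      tensor_kills S M N m1 f1 \<and> tensor_kills S M N m2 f2"
  shows "graded_bimod_iso A B (tensor S M N) Q"
proof -
  have ker: "kernel Fr (add_monoid Q) ev = K" by (rule kernel_ev[OF f gen indep])
  interpret QA: module A Q using Q_graded unfolding graded_bimodule_def by blast
  interpret QB: module B "right_module Q" using Q_graded unfolding graded_bimodule_def by blast
  have surj: "ev ` carrier Fr = carrier (add_monoid Q)"
  proof
    show "ev ` carrier Fr \<subseteq> carrier (add_monoid Q)" using ev_closed by auto
    have im: "subgroup (ev ` carrier Fr) (add_monoid Q)" by (rule ev.img_is_subgroup)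
    have hom_im: "homog Q d \<subseteq> ev ` carrier Fr" for d
    proof -
      have "\<phi> x y \<in> ev ` carrier Fr" if "x \<in> homog M i" "y \<in> homog N j" for x y i j
      proof -
        have "x \<in> carrier M" "y \<in> carrier N" using that homog_sub by auto
        then show ?thesis by (intro image_eqI[of _ _ "frag_of (x, y)"]) (simp_all add: ev(2) Fr_frag_of)
      qed
      then show ?thesis unfolding homog_Q by (intro group.generate_subgroup_incl[OF comm_group.axioms(2)[OF Q.a_comm_group] _ im]) auto
    qed
    show "carrier (add_monoid Q) \<subseteq> ev ` carrier Fr"
    proof
      fix q assume "q \<in> carrier (add_monoid Q)"
      then have "q \<in> carrier Q" by simp
      then obtain c where c: "\<forall>d. c d \<in> homog Q d" "finite {d. c d \<noteq> \<zero>\<^bsub>Q\<^esub>}"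
          "q = finsum Q c {d. c d \<noteq> \<zero>\<^bsub>Q\<^esub>}"
        using graded_bimodule_decomp[OF Q_graded] by metis
      have "finsum Q c D \<in> ev ` carrier Fr" if "finite D" for D
        using that
      proof (induction D rule: finite_induct)
        case empty
        then show ?case using subgroup.one_closed[OF im] by simp
      next
        case (insert d D)
        have "c e \<in> carrier Q" for e using c(1) homog_in_carrier[OF Q_graded] by blast
        then have "finsum Q c (insert d D) = c d \<oplus>\<^bsub>Q\<^esub> finsum Q c D"
          using insert by (intro Q.finsum_insert) auto
        moreover have "c d \<in> ev ` carrier Fr" using hom_im c(1) by blast
        ultimately show ?case
          using subgroup.m_closed[OF im, of "c d" "finsum Q c D"] insert by simp
      qed
      then show "q \<in> ev ` carrier Fr" using c by simp
    qed
  qed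
  define h where "h = (\<lambda>C. the_elem (ev ` C))"
  have h: "h \<in> iso (Fr Mod K) (add_monoid Q)"
    using ev.FactGroup_iso_set[OF surj] unfolding ker h_def .
  have h_coset: "h (K #>\<^bsub>Fr\<^esub> c) = ev c" if c: "c \<in> carrier Fr" for c
  proof -
    have "ev ` (K #>\<^bsub>Fr\<^esub> c) = {ev c}" using c by (auto simp: coset_eq_fibre[OF ker c])
    then show ?thesis by (simp add: h_def)
  qed
  have cosets: "carrier (Fr Mod K) = {K #>\<^bsub>Fr\<^esub> c | c. c \<in> carrier Fr}"
    by (auto simp: FactGroup_def RCOSETS_def)
  have "K \<lhd> Fr" using ev.normal_kernel unfolding ker .
  then interpret FK: group "Fr Mod K" by (rule normal.factorgroup_is_group)
  interpret h: group_hom "Fr Mod K" "add_monoid Q" h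
    using h by unfold_locales (simp add: iso_def)
  have tens: "carrier (tensor S M N) = carrier (Fr Mod K)" "\<zero>\<^bsub>tensor S M N\<^esub> = \<one>\<^bsub>Fr Mod K\<^esub>"
    "add (tensor S M N) = monoid.mult (Fr Mod K)"
    "\<And>a C. a \<odot>\<^bsub>tensor S M N\<^esub> C = (\<Union>c\<in>C. K #>\<^bsub>Fr\<^esub> frag_extend (\<lambda>p. frag_of (case p of (x, y) \<Rightarrow> (a \<odot>\<^bsub>M\<^esub> x, y))) c)"
    "\<And>b C. rsmult (tensor S M N) C b = (\<Union>c\<in>C. K #>\<^bsub>Fr\<^esub> frag_extend (\<lambda>p. frag_of (case p of (x, y) \<Rightarrow> (x, rsmult N y b))) c)"
    "\<And>d. homog (tensor S M N) d = generate (Fr Mod K)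
       {K #>\<^bsub>Fr\<^esub> frag_of (x, y) | x y i j. x \<in> homog M i \<and> y \<in> homog N j \<and> i + j = d}"
    by (simp_all add: tensor_def Let_def case_prod_unfold)
  have left_act: "a \<odot>\<^bsub>tensor S M N\<^esub> C \<in> carrier (tensor S M N) \<and> h (a \<odot>\<^bsub>tensor S M N\<^esub> C) = a \<odot>\<^bsub>Q\<^esub> h C"
    if a: "a \<in> carrier A" and C: "C \<in> carrier (tensor S M N)" for a C
  proof -
    obtain c where c: "c \<in> carrier Fr" "C = K #>\<^bsub>Fr\<^esub> c" using C unfolding tens(1) cosets by blast
    have hom: "(\<lambda>q. a \<odot>\<^bsub>Q\<^esub> q) \<in> hom (add_monoid Q) (add_monoid Q)"
      using a by (auto simp: hom_def QA.smult_r_distr)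
    note act = act_on_coset[OF ker c(1) _ hom, where u = "\<lambda>(x, y). (a \<odot>\<^bsub>M\<^esub> x, y)"]
    show ?thesis
      unfolding tens(1,4) c(2) cosets using act a left c(1) by (auto simp: h_coset ev(2))
  qed
  have right_act: "rsmult (tensor S M N) C b \<in> carrier (tensor S M N) \<and> h (rsmult (tensor S M N) C b) = rsmult Q (h C) b"
    if b: "b \<in> carrier B" and C: "C \<in> carrier (tensor S M N)" for b C
  proof -
    obtain c where c: "c \<in> carrier Fr" "C = K #>\<^bsub>Fr\<^esub> c" using C unfolding tens(1) cosets by blast
    have hom: "(\<lambda>q. rsmult Q q b) \<in> hom (add_monoid Q) (add_monoid Q)"
      using b QB.smult_r_distr[of b] QB.smult_closed[of b] by (auto simp: hom_def)
    note act = act_on_coset[OF ker c(1) _ hom, where u = "\<lambda>(x, y). (x, rsmult N y b)"]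
    show ?thesis
      unfolding tens(1,5) c(2) cosets using act b right c(1) by (auto simp: h_coset ev(2))
  qed
  have gens: "{K #>\<^bsub>Fr\<^esub> frag_of (x, y) | x y i j. x \<in> homog M i \<and> y \<in> homog N j \<and> i + j = d}
      \<subseteq> carrier (Fr Mod K)" (is "?G d \<subseteq> _") for d
    unfolding cosets using homog_sub Fr_frag_of by blast
  have h_gens: "h ` ?G d = {\<phi> x y | x y i j. x \<in> homog M i \<and> y \<in> homog N j \<and> i + j = d}" for d
  proof -
    have "h (K #>\<^bsub>Fr\<^esub> frag_of (x, y)) = \<phi> x y" if "x \<in> homog M i" "y \<in> homog N j" for x y i j
      using that homog_sub by (simp add: h_coset Fr_frag_of ev(2) subset_iff)
    note val = this
    show ?thesis
    proof (rule equalityI; clarify)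
      fix x y i j assume "x \<in> homog M i" "y \<in> homog N j"
      then show "\<exists>x' y' i' j'. h (K #>\<^bsub>Fr\<^esub> frag_of (x, y)) = \<phi> x' y' \<and>
          x' \<in> homog M i' \<and> y' \<in> homog N j' \<and> i' + j' = i + j"
        by (intro exI[of _ x] exI[of _ y] exI[of _ i] exI[of _ j]) (simp add: val)
    next
      fix x y i j assume xy: "x \<in> homog M i" "y \<in> homog N j"
      show "\<phi> x y \<in> h ` ?G (i + j)"
        by (rule image_eqI[where x = "K #>\<^bsub>Fr\<^esub> frag_of (x, y)"]) (use xy in \<open>simp add: val\<close>, use xy in blast)
    qed
  qed
  show ?thesis
  proof (rule graded_bimod_iso_transport[OF Q_graded ring_grading])
    show "bij_betw h (carrier (tensor S M N)) (carrier Q)"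
      using h by (simp add: iso_def tens(1))
    show "h \<zero>\<^bsub>tensor S M N\<^esub> = \<zero>\<^bsub>Q\<^esub>" using h.hom_one by (simp add: tens)
    show "x \<oplus>\<^bsub>tensor S M N\<^esub> y \<in> carrier (tensor S M N)"
      if "x \<in> carrier (tensor S M N)" "y \<in> carrier (tensor S M N)" for x y
      using FK.m_closed that by (simp add: tens)
    show "h (x \<oplus>\<^bsub>tensor S M N\<^esub> y) = h x \<oplus>\<^bsub>Q\<^esub> h y"
      if "x \<in> carrier (tensor S M N)" "y \<in> carrier (tensor S M N)" for x y
      using h.hom_mult that by (simp add: tens)
    show "homog (tensor S M N) d \<subseteq> carrier (tensor S M N)" for d
      unfolding tens by (rule FK.generate_incl[OF gens])
    show "h ` homog (tensor S M N) d = homog Q d" for d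
      unfolding tens homog_Q h.generate_img[OF gens, symmetric] h_gens ..
  qed (use FK.one_closed left_act right_act in \<open>simp_all add: tens(1,2)\<close>)
qed

end

section \<open>Bimodules of polynomial functions on cones\<close>

text \<open>
  A space of points \<open>p\<close> is given by a set \<open>W\<close> of vector-valued maps, and polynomial functions
  are polynomials in the coordinates \<open>1..n+1\<close> of these vectors.  For points that are pairs of
  vectors, \<open>W\<close> consists of the two projections.
\<close>

inductive poly_on :: "nat \<Rightarrow> ('p \<Rightarrow> nat \<Rightarrow> 'k::field_char_0) set \<Rightarrow> ('p \<Rightarrow> 'k) \<Rightarrow> bool" for n W where
  const: "poly_on n W (\<lambda>p. c)"
| coord: "v \<in> W \<Longrightarrow> i \<in> {1..n+1} \<Longrightarrow> poly_on n W (\<lambda>p. v p i)"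
| add: "poly_on n W f \<Longrightarrow> poly_on n W g \<Longrightarrow> poly_on n W (\<lambda>p. f p + g p)"
| mult: "poly_on n W f \<Longrightarrow> poly_on n W g \<Longrightarrow> poly_on n W (\<lambda>p. f p * g p)"

text \<open>
  Degrees are integers, and the zero function is homogeneous of each degree, so that products
  need no case distinction on the parity or the sign of degrees.
\<close>

inductive homog_on :: "nat \<Rightarrow> ('p \<Rightarrow> nat \<Rightarrow> 'k::field_char_0) set \<Rightarrow> int \<Rightarrow> ('p \<Rightarrow> 'k) \<Rightarrow> bool" for n W where
  zero: "homog_on n W e (\<lambda>p. 0)"
| const: "homog_on n W 0 (\<lambda>p. c)"
| coord: "v \<in> W \<Longrightarrow> i \<in> {1..n+1} \<Longrightarrow> homog_on n W 2 (\<lambda>p. v p i)"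
| add: "homog_on n W d f \<Longrightarrow> homog_on n W d g \<Longrightarrow> homog_on n W d (\<lambda>p. f p + g p)"
| mult: "homog_on n W d f \<Longrightarrow> homog_on n W e g \<Longrightarrow> homog_on n W (d + e) (\<lambda>p. f p * g p)"

lemma poly_on_minus: "poly_on n W f \<Longrightarrow> poly_on n W g \<Longrightarrow> poly_on n W (\<lambda>p. f p - g p)"
  using poly_on.add[OF _ poly_on.mult[OF poly_on.const[of n W "-1"]]] by simp

lemma homog_on_cmult: "homog_on n W d f \<Longrightarrow> homog_on n W d (\<lambda>p. c * f p)"
  using homog_on.mult[OF homog_on.const] by fastforce

lemma homog_on_minus: "homog_on n W d f \<Longrightarrow> homog_on n W d g \<Longrightarrow> homog_on n W d (\<lambda>p. f p - g p)"
  using homog_on.add[OF _ homog_on_cmult[of n W d g "-1"]] by simp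

lemma homog_on_sum:
  "finite A \<Longrightarrow> (\<And>x. x \<in> A \<Longrightarrow> homog_on n W d (f x)) \<Longrightarrow> homog_on n W d (\<lambda>p. \<Sum>x\<in>A. f x p)"
  by (induction A rule: finite_induct) (simp_all add: homog_on.zero homog_on.add)

lemma poly_on_sum:
  "finite A \<Longrightarrow> (\<And>x. x \<in> A \<Longrightarrow> poly_on n W (f x)) \<Longrightarrow> poly_on n W (\<lambda>p. \<Sum>x\<in>A. f x p)"
  by (induction A rule: finite_induct) (simp_all add: poly_on.const poly_on.add)

lemma homog_on_imp_poly_on: "homog_on n W d f \<Longrightarrow> poly_on n W f"
  by (induction rule: homog_on.induct) (auto intro: poly_on.intros)

lemma poly_on_decomp:
  assumes "poly_on n W f"
  shows "\<exists>A c. finite A \<and> (\<forall>d. homog_on n W d (c d)) \<and> f = (\<lambda>p. \<Sum>d\<in>A. c d p)"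
  using assms
proof (induction rule: poly_on.induct)
  case (const c)
  show ?case
    by (intro exI[of _ "{0}"] exI[of _ "\<lambda>d. if d = 0 then (\<lambda>p. c) else (\<lambda>p. 0)"])
      (simp add: homog_on.zero homog_on.const)
next
  case (coord v i)
  then show ?case
    by (intro exI[of _ "{2}"] exI[of _ "\<lambda>d. if d = 2 then (\<lambda>p. v p i) else (\<lambda>p. 0)"])
      (simp add: homog_on.zero homog_on.coord)
next
  case (add f g)
  then obtain A B c c' where A: "finite A" "\<forall>d. homog_on n W d (c d)" "f = (\<lambda>p. \<Sum>d\<in>A. c d p)"
    and B: "finite B" "\<forall>d. homog_on n W d (c' d)" "g = (\<lambda>p. \<Sum>d\<in>B. c' d p)" by blast
  let ?c = "\<lambda>d p. (if d \<in> A then c d p else 0) + (if d \<in> B then c' d p else 0)"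
  have "f p + g p = (\<Sum>d\<in>A \<union> B. ?c d p)" for p
    using A(1) B(1) unfolding A(3) B(3) sum.distrib
    by (simp add: sum.If_cases Int_absorb1 Int_absorb2)
  moreover have "homog_on n W d (?c d)" for d
  proof (rule homog_on.add)
    show "homog_on n W d (\<lambda>p. if d \<in> A then c d p else 0)"
      using A(2) by (cases "d \<in> A") (simp_all add: homog_on.zero)
    show "homog_on n W d (\<lambda>p. if d \<in> B then c' d p else 0)"
      using B(2) by (cases "d \<in> B") (simp_all add: homog_on.zero)
  qed
  ultimately show ?case using A(1) B(1) by (intro exI[of _ "A \<union> B"] exI[of _ ?c]) simp
next
  case (mult f g)
  then obtain A B c c' where A: "finite A" "\<forall>d. homog_on n W d (c d)" "f = (\<lambda>p. \<Sum>d\<in>A. c d p)"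
    and B: "finite B" "\<forall>d. homog_on n W d (c' d)" "g = (\<lambda>p. \<Sum>d\<in>B. c' d p)" by blast
  let ?pl = "\<lambda>(d, e). d + e" and ?T = "(\<lambda>(d, e). d + e) ` (A \<times> B)"
  let ?c = "\<lambda>s p. \<Sum>(d, e)\<in>{x \<in> A \<times> B. ?pl x = s}. c d p * c' e p"
  have fin: "finite (A \<times> B)" using A(1) B(1) by simp
  have "f p * g p = (\<Sum>s\<in>?T. ?c s p)" for p
  proof -
    have "f p * g p = (\<Sum>(d, e)\<in>A \<times> B. c d p * c' e p)"
      unfolding A(3) B(3) by (simp add: sum_product sum.cartesian_product)
    also have "\<dots> = (\<Sum>s\<in>?T. ?c s p)"
      by (rule sum.group[symmetric]) (use fin in auto)
    finally show ?thesis .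
  qed
  moreover have "homog_on n W s (?c s)" for s
  proof -
    have "homog_on n W s (\<lambda>p. \<Sum>x\<in>{x \<in> A \<times> B. ?pl x = s}. (\<lambda>(d, e). \<lambda>p. c d p * c' e p) x p)"
    proof (rule homog_on_sum)
      show "finite {x \<in> A \<times> B. ?pl x = s}" using fin by simp
      show "homog_on n W s ((\<lambda>(d, e). \<lambda>p. c d p * c' e p) x)" if "x \<in> {x \<in> A \<times> B. ?pl x = s}" for x
        using that A(2) B(2) by (cases x) (auto intro!: homog_on.mult)
    qed
    then show ?thesis by (simp add: case_prod_unfold)
  qed
  ultimately show ?case using fin by (intro exI[of _ ?T] exI[of _ ?c]) simp
qed

subsection \<open>Scaling\<close>

text \<open>
  Points carry no linear structure of their own, so \<open>q = t p\<close> is expressed by the coordinates.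
\<close>

definition scaled :: "nat \<Rightarrow> ('p \<Rightarrow> nat \<Rightarrow> 'k::field_char_0) set \<Rightarrow> 'k \<Rightarrow> 'p \<Rightarrow> 'p \<Rightarrow> bool" where
  "scaled n W t p q \<longleftrightarrow> (\<forall>v\<in>W. \<forall>i\<in>{1..n+1}. v q i = t * v p i)"

definition nonzero_pt :: "nat \<Rightarrow> ('p \<Rightarrow> nat \<Rightarrow> 'k::field_char_0) set \<Rightarrow> 'p \<Rightarrow> bool" where
  "nonzero_pt n W p \<longleftrightarrow> (\<exists>v\<in>W. \<exists>i\<in>{1..n+1}. v p i \<noteq> 0)"

text \<open>
  A nonzero point is required, since values at the origin are to be recovered from values elsewhere.
\<close>

definition cone :: "nat \<Rightarrow> ('p \<Rightarrow> nat \<Rightarrow> 'k::field_char_0) set \<Rightarrow> 'p set \<Rightarrow> bool" where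
  "cone n W P \<longleftrightarrow> (\<forall>p\<in>P. \<forall>t. \<exists>q\<in>P. scaled n W t p q) \<and> (\<exists>p\<in>P. nonzero_pt n W p)"

lemma homog_on_scaled:
  assumes "homog_on n W e f"
  shows "f = (\<lambda>p. 0) \<or> (\<exists>d. e = 2 * int d \<and> (\<forall>p q t. scaled n W t p q \<longrightarrow> f q = t ^ d * f p))"
  using assms
proof (induction rule: homog_on.induct)
  case (coord v i)
  then show ?case by (intro disjI2 exI[of _ 1]) (simp add: scaled_def)
next
  case (add d f g)
  then show ?case by (auto simp: distrib_left)
next
  case (mult d f e g)
  then consider "f = (\<lambda>p. 0)" | "g = (\<lambda>p. 0)"
    | d' e' where "d = 2 * int d'" "e = 2 * int e'" "\<forall>p q t. scaled n W t p q \<longrightarrow> f q = t ^ d' * f p"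
      "\<forall>p q t. scaled n W t p q \<longrightarrow> g q = t ^ e' * g p" by blast
  then show ?case
  proof cases
    case 3
    then show ?thesis by (intro disjI2 exI[of _ "d' + e'"]) (simp add: power_add)
  qed simp_all
qed auto

lemma poly_on_scaled:
  assumes "poly_on n W f"
  shows "\<exists>h. \<forall>t q. scaled n W t p q \<longrightarrow> f q = poly h t"
  using assms
proof (induction rule: poly_on.induct)
  case (const c)
  show ?case by (intro exI[of _ "[:c:]"]) simp
next
  case (coord v i)
  then show ?case by (intro exI[of _ "[:0, v p i:]"]) (simp add: scaled_def)
next
  case (add f g)
  then show ?case by (metis poly_add)
next
  case (mult f g)
  then show ?case by (metis poly_mult)
qed

lemma scaled_nonzero_pt: "scaled n W t p q \<Longrightarrow> t \<noteq> 0 \<Longrightarrow> nonzero_pt n W p \<Longrightarrow> nonzero_pt n W q"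
  unfolding scaled_def nonzero_pt_def by (metis no_zero_divisors)

text \<open>
  Along a line through the origin a polynomial function is a polynomial in the parameter, so
  its value at the origin is determined by the others.
\<close>

lemma vanish_on_cone:
  assumes f: "poly_on n W f" and P: "cone n W P"
    and van: "\<And>p. p \<in> P \<Longrightarrow> nonzero_pt n W p \<Longrightarrow> f p = 0" and q: "q \<in> P"
  shows "f q = 0"
proof (cases "nonzero_pt n W q")
  case False
  obtain p where p: "p \<in> P" "nonzero_pt n W p" using P unfolding cone_def by blast
  obtain h where h: "\<And>t q. scaled n W t p q \<Longrightarrow> f q = poly h t"
    using poly_on_scaled[OF f] by blast
  have "poly (pCons 0 h) t = 0" for t
  proof (cases "t = 0")
    case False
    obtain q where "q \<in> P" "scaled n W t p q" using P p unfolding cone_def by blast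
    then show ?thesis using h van scaled_nonzero_pt[OF _ False p(2)] by fastforce
  qed simp
  then have "pCons 0 h = 0" using poly_all_0_iff_0 by blast
  moreover have "scaled n W 0 p q" using False unfolding scaled_def nonzero_pt_def by simp
  ultimately show ?thesis using h by simp
qed (use van q in blast)

text \<open>
  At the multiple \<open>t p\<close> of a point \<open>p\<close> the component of degree \<open>2 k\<close> takes \<open>t\<^sup>k\<close> times its value at \<open>p\<close>.
  If the sum of the components vanishes, these values are the coefficients of a polynomial in \<open>t\<close>
  that vanishes on the infinite field.
\<close>

lemma homog_components_zero:
  assumes P: "cone n W P" and A: "finite A" and c: "\<And>d. d \<in> A \<Longrightarrow> homog_on n W d (c d)"
    and sum: "\<And>p. p \<in> P \<Longrightarrow> (\<Sum>d\<in>A. c d p) = 0" and d: "d \<in> A" and p: "p \<in> P"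
  shows "c d p = 0"
proof -
  let ?A = "{d \<in> A. c d \<noteq> (\<lambda>p. 0)}"
  let ?h = "\<Sum>d\<in>?A. monom (c d p) (nat (d div 2))"
  have deg: "\<exists>k. d = 2 * int k \<and> (\<forall>p q t. scaled n W t p q \<longrightarrow> c d q = t ^ k * c d p)"
    if "d \<in> ?A" for d
    using homog_on_scaled[OF c[of d]] that by auto
  have "poly ?h t = 0" for t
  proof -
    obtain q where q: "q \<in> P" "scaled n W t p q" using P p unfolding cone_def by blast
    have "c d q = poly (monom (c d p) (nat (d div 2))) t" if "d \<in> ?A" for d
      using deg[OF that] q(2) by (auto simp: poly_monom)
    then have "poly ?h t = (\<Sum>d\<in>?A. c d q)" by (simp add: poly_sum)
    also have "\<dots> = (\<Sum>d\<in>A. c d q)" by (rule sum.mono_neutral_left) (use A in auto)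
    finally show ?thesis using sum[OF q(1)] by simp
  qed
  then have h: "?h = 0" using poly_all_0_iff_0 by blast
  show ?thesis
  proof (cases "c d = (\<lambda>p. 0)")
    case False
    then have dA: "d \<in> ?A" using d by simp
    have "coeff ?h (nat (d div 2)) = (\<Sum>e\<in>?A. if e = d then c d p else 0)"
      unfolding coeff_sum
    proof (rule sum.cong)
      fix e assume e: "e \<in> ?A"
      obtain i j where "d = 2 * int i" "e = 2 * int j" using deg[OF e] deg[OF dA] by blast
      then show "coeff (monom (c e p) (nat (e div 2))) (nat (d div 2)) = (if e = d then c d p else 0)"
        by auto
    qed simp
    also have "\<dots> = c d p" using A dA by simp
    finally show ?thesis using h by simp
  qed simp
qed

subsection \<open>The bimodule of polynomial functions\<close>

lemma restrict_eq_iff: "restrict f P = restrict g P \<longleftrightarrow> (\<forall>p\<in>P. f p = g p)"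
  by (auto simp: fun_eq_iff restrict_def)

text \<open>
  Functions of one vector act from the two sides through the left end \<open>l p\<close> and the right end \<open>r p\<close>
  of a point.
\<close>

definition fun_bimod ::
  "nat \<Rightarrow> ('p \<Rightarrow> nat \<Rightarrow> 'k::field_char_0) set \<Rightarrow> 'p set \<Rightarrow> ('p \<Rightarrow> nat \<Rightarrow> 'k) \<Rightarrow> ('p \<Rightarrow> nat \<Rightarrow> 'k) \<Rightarrow>
   ('k vec \<Rightarrow> 'k, 'k vec \<Rightarrow> 'k, 'p \<Rightarrow> 'k) bimod" where
  "fun_bimod n W P l r = \<lparr>
     carrier = {restrict f P | f. poly_on n W f},
     monoid.mult = (\<lambda>f g. \<lambda>p\<in>P. f p * g p),
     one = (\<lambda>p\<in>P. 1),
     ring.zero = (\<lambda>p\<in>P. 0),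
     add = (\<lambda>f g. \<lambda>p\<in>P. f p + g p),
     smult = (\<lambda>a m. \<lambda>p\<in>P. a (l p) * m p),
     rsmult = (\<lambda>m b. \<lambda>p\<in>P. m p * b (r p)),
     homog = (\<lambda>e. {restrict f P | f. homog_on n W e f})\<rparr>"

lemma fun_bimod_simps [simp]:
  "add (fun_bimod n W P l r) = (\<lambda>f g. \<lambda>p\<in>P. f p + g p)"
  "\<zero>\<^bsub>fun_bimod n W P l r\<^esub> = (\<lambda>p\<in>P. 0)"
  "a \<odot>\<^bsub>fun_bimod n W P l r\<^esub> m = (\<lambda>p\<in>P. a (l p) * m p)"
  "rsmult (fun_bimod n W P l r) m b = (\<lambda>p\<in>P. m p * b (r p))"
  by (simp_all add: fun_bimod_def)

lemma carrier_fun_bimod: "carrier (fun_bimod n W P l r) = {restrict f P | f. poly_on n W f}"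
  by (simp add: fun_bimod_def)

lemma homog_fun_bimod: "homog (fun_bimod n W P l r) e = {restrict f P | f. homog_on n W e f}"
  by (simp add: fun_bimod_def)

lemma fun_bimodI:
  "poly_on n W f \<Longrightarrow> (\<And>p. p \<in> P \<Longrightarrow> m p = f p) \<Longrightarrow> restrict m P \<in> carrier (fun_bimod n W P l r)"
  unfolding carrier_fun_bimod by (rule CollectI, rule exI[of _ f]) (simp add: restrict_eq_iff)

lemma fun_bimod_homogI:
  "homog_on n W e f \<Longrightarrow> (\<And>p. p \<in> P \<Longrightarrow> m p = f p) \<Longrightarrow> restrict m P \<in> homog (fun_bimod n W P l r) e"
  unfolding homog_fun_bimod by (rule CollectI, rule exI[of _ f]) (simp add: restrict_eq_iff)

lemma fun_bimodE:
  assumes "m \<in> carrier (fun_bimod n W P l r)"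
  obtains f where "poly_on n W f" "m = restrict f P"
  using assms by (auto simp: carrier_fun_bimod)

lemma fun_bimod_homogE:
  assumes "m \<in> homog (fun_bimod n W P l r) e"
  obtains f where "homog_on n W e f" "m = restrict f P"
  using assms by (auto simp: homog_fun_bimod)

lemma abelian_group_fun_bimod: "abelian_group (fun_bimod n W P l r)"
proof (rule abelian_groupI)
  fix x y assume "x \<in> carrier (fun_bimod n W P l r)" "y \<in> carrier (fun_bimod n W P l r)"
  then obtain f g where "poly_on n W f" "x = restrict f P" "poly_on n W g" "y = restrict g P"
    by (elim fun_bimodE) blast
  then show "x \<oplus>\<^bsub>fun_bimod n W P l r\<^esub> y \<in> carrier (fun_bimod n W P l r)"
    by (simp add: fun_bimodI[OF poly_on.add[of n W f g]])
next
  show "\<zero>\<^bsub>fun_bimod n W P l r\<^esub> \<in> carrier (fun_bimod n W P l r)"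
    using fun_bimodI[OF poly_on.const[of n W 0]] by simp
next
  fix x assume x: "x \<in> carrier (fun_bimod n W P l r)"
  then obtain f where f: "poly_on n W f" "x = restrict f P" by (elim fun_bimodE)
  show "\<zero>\<^bsub>fun_bimod n W P l r\<^esub> \<oplus>\<^bsub>fun_bimod n W P l r\<^esub> x = x"
    using f by (simp add: restrict_eq_iff)
  show "\<exists>y\<in>carrier (fun_bimod n W P l r). y \<oplus>\<^bsub>fun_bimod n W P l r\<^esub> x = \<zero>\<^bsub>fun_bimod n W P l r\<^esub>"
  proof
    show "restrict (\<lambda>p. 0 - f p) P \<in> carrier (fun_bimod n W P l r)"
      by (rule fun_bimodI[OF poly_on_minus[OF poly_on.const f(1)]]) simp
  qed (use f in \<open>simp add: restrict_eq_iff\<close>)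
qed (simp_all add: restrict_eq_iff algebra_simps)

lemma finsum_fun_bimod:
  assumes "finite A" "\<And>d. d \<in> A \<Longrightarrow> c d \<in> carrier (fun_bimod n W P l r)"
  shows "finsum (fun_bimod n W P l r) c A = (\<lambda>p\<in>P. \<Sum>d\<in>A. c d p)"
proof -
  interpret abelian_group "fun_bimod n W P l r" by (rule abelian_group_fun_bimod)
  show ?thesis using assms
    by (induction A rule: finite_induct) (auto simp: Pi_iff restrict_eq_iff)
qed

text \<open>
  The rings that act: rings of polynomial functions on some \<open>Y\<close>, such as the regular functions
  on a union of lines or the invariants among them.
\<close>

definition fun_ring :: "nat \<Rightarrow> (('k::field_char_0) vec \<Rightarrow> 'k) graded_ring \<Rightarrow> 'k vec set \<Rightarrow> bool" where
  "fun_ring n A Y \<longleftrightarrow> cring A \<and>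
     (\<forall>a\<in>carrier A. \<exists>f. poly_on n {\<lambda>x. x} f \<and> (\<forall>y\<in>Y. a y = f y)) \<and>
     (\<forall>a\<in>carrier A. \<forall>b\<in>carrier A. \<forall>y\<in>Y. (a \<oplus>\<^bsub>A\<^esub> b) y = a y + b y \<and> (a \<otimes>\<^bsub>A\<^esub> b) y = a y * b y) \<and>
     (\<forall>y\<in>Y. \<zero>\<^bsub>A\<^esub> y = 0 \<and> \<one>\<^bsub>A\<^esub> y = 1) \<and>
     (\<forall>d. rhomog A d \<subseteq> carrier A \<and> (\<forall>a\<in>rhomog A d. \<exists>f. homog_on n {\<lambda>x. x} d f \<and> (\<forall>y\<in>Y. a y = f y)))"

lemma poly_on_pullback:
  assumes "poly_on n W f" "\<And>v i. v \<in> W \<Longrightarrow> i \<in> {1..n+1} \<Longrightarrow> poly_on n W' (\<lambda>p. v (\<pi> p) i)"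
  shows "poly_on n W' (\<lambda>p. f (\<pi> p))"
  using assms by (induction rule: poly_on.induct) (auto intro: poly_on.intros)

lemma homog_on_pullback:
  assumes "homog_on n W d f" "\<And>v i. v \<in> W \<Longrightarrow> i \<in> {1..n+1} \<Longrightarrow> homog_on n W' 2 (\<lambda>p. v (\<pi> p) i)"
  shows "homog_on n W' d (\<lambda>p. f (\<pi> p))"
  using assms by (induction rule: homog_on.induct) (auto intro: homog_on.intros)

lemma fun_ring_pullback:
  assumes A: "fun_ring n A Y" and u: "u \<in> W" "u ` P \<subseteq> Y"
  shows "a \<in> carrier A \<Longrightarrow> \<exists>f. poly_on n W f \<and> (\<forall>p\<in>P. a (u p) = f p)"
    "a \<in> rhomog A d \<Longrightarrow> \<exists>f. homog_on n W d f \<and> (\<forall>p\<in>P. a (u p) = f p)"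
proof -
  assume "a \<in> carrier A"
  then obtain f where f: "poly_on n {\<lambda>x. x} f" "\<forall>y\<in>Y. a y = f y" using A unfolding fun_ring_def by blast
  have "poly_on n W (\<lambda>p. f (u p))" by (rule poly_on_pullback[OF f(1)]) (simp add: poly_on.coord u(1))
  then show "\<exists>f. poly_on n W f \<and> (\<forall>p\<in>P. a (u p) = f p)" using f(2) u(2) by blast
next
  assume "a \<in> rhomog A d"
  then obtain f where f: "homog_on n {\<lambda>x. x} d f" "\<forall>y\<in>Y. a y = f y" using A unfolding fun_ring_def by blast
  have "homog_on n W d (\<lambda>p. f (u p))" by (rule homog_on_pullback[OF f(1)]) (simp add: homog_on.coord u(1))
  then show "\<exists>f. homog_on n W d f \<and> (\<forall>p\<in>P. a (u p) = f p)" using f(2) u(2) by blast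
qed

text \<open>
  A polynomial is a sum of homogeneous ones by \<open>poly_on_decomp\<close>, and the difference of two such
  sums that agree on a cone has zero components by \<open>homog_components_zero\<close>.
\<close>

lemma graded_decomposition_fun_bimod:
  assumes P: "cone n W P" and m: "m \<in> carrier (fun_bimod n W P l r)"
  defines "M \<equiv> fun_bimod n W P l r"
  shows "\<exists>!c. (\<forall>d. c d \<in> homog M d) \<and> finite {d. c d \<noteq> \<zero>\<^bsub>M\<^esub>} \<and>
        m = finsum M c {d. c d \<noteq> \<zero>\<^bsub>M\<^esub>}"
proof -
  have zM: "\<zero>\<^bsub>M\<^esub> = (\<lambda>p\<in>P. 0)" by (simp add: M_def)
  have sub: "c \<in> carrier M" if "c \<in> homog M d" for c d
    using that unfolding M_def by (elim fun_bimod_homogE) (auto intro!: fun_bimodI homog_on_imp_poly_on)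
  have fs: "finsum M c {d. c d \<noteq> \<zero>\<^bsub>M\<^esub>} = (\<lambda>p\<in>P. \<Sum>d\<in>A. c d p)"
    if "\<And>d. c d \<in> homog M d" "finite A" "{d. c d \<noteq> \<zero>\<^bsub>M\<^esub>} \<subseteq> A" for c A
  proof -
    have "finite {d. c d \<noteq> \<zero>\<^bsub>M\<^esub>}" using that finite_subset by blast
    then have "finsum M c {d. c d \<noteq> \<zero>\<^bsub>M\<^esub>} = (\<lambda>p\<in>P. \<Sum>d\<in>{d. c d \<noteq> \<zero>\<^bsub>M\<^esub>}. c d p)"
      unfolding M_def by (rule finsum_fun_bimod) (rule sub[OF that(1), unfolded M_def])
    also have "\<dots> = (\<lambda>p\<in>P. \<Sum>d\<in>A. c d p)"
      unfolding restrict_eq_iff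
      by (intro ballI sum.mono_neutral_left) (use that in \<open>auto simp: zM\<close>)
    finally show ?thesis .
  qed
  obtain f where f: "poly_on n W f" "m = restrict f P" using m by (elim fun_bimodE)
  obtain A c where A: "finite A" "\<And>d. homog_on n W d (c d)" "f = (\<lambda>p. \<Sum>d\<in>A. c d p)"
    using poly_on_decomp[OF f(1)] by blast
  define g where "g d = restrict (if d \<in> A then c d else (\<lambda>p. 0)) P" for d
  have g: "g d \<in> homog M d" for d
    unfolding g_def M_def by (rule fun_bimod_homogI[of _ _ _ "if d \<in> A then c d else (\<lambda>p. 0)"])
      (use A in \<open>auto simp: homog_on.zero\<close>)
  have gA: "{d. g d \<noteq> \<zero>\<^bsub>M\<^esub>} \<subseteq> A" by (auto simp: g_def zM)
  show ?thesis
  proof (rule ex1I[of _ g])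
    have "m = finsum M g {d. g d \<noteq> \<zero>\<^bsub>M\<^esub>}"
      unfolding fs[OF g A(1) gA] f(2) A(3) restrict_eq_iff by (auto simp: g_def intro: sum.cong)
    then show "(\<forall>d. g d \<in> homog M d) \<and> finite {d. g d \<noteq> \<zero>\<^bsub>M\<^esub>} \<and> m = finsum M g {d. g d \<noteq> \<zero>\<^bsub>M\<^esub>}"
      using g finite_subset[OF gA A(1)] by blast
  next
    fix c' assume c': "(\<forall>d. c' d \<in> homog M d) \<and> finite {d. c' d \<noteq> \<zero>\<^bsub>M\<^esub>} \<and>
      m = finsum M c' {d. c' d \<noteq> \<zero>\<^bsub>M\<^esub>}"
    let ?B = "A \<union> {d. c' d \<noteq> \<zero>\<^bsub>M\<^esub>}"
    have B: "finite ?B" using A(1) c' by blast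
    have eq: "(\<Sum>d\<in>?B. c' d p) = (\<Sum>d\<in>?B. g d p)" if p: "p \<in> P" for p
    proof -
      have "(\<lambda>p\<in>P. \<Sum>d\<in>?B. c' d p) = m"
        using fs[of c' ?B] c' B by (metis (no_types, lifting) Un_upper2)
      moreover have "(\<lambda>p\<in>P. \<Sum>d\<in>?B. g d p) = m"
        unfolding fs[OF g B, symmetric, OF order_trans[OF gA Un_upper1]] fs[OF g A(1) gA] f(2) A(3) restrict_eq_iff
        by (auto simp: g_def intro: sum.cong)
      ultimately show ?thesis using p by (metis (no_types, lifting) restrict_apply')
    qed
    have "\<forall>d. \<exists>k. homog_on n W d k \<and> c' d = restrict k P"
      using c' unfolding M_def by (meson fun_bimod_homogE)
    then obtain k where k: "\<And>d. homog_on n W d (k d)" "\<And>d. c' d = restrict (k d) P" by metis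
    have "\<forall>d. \<exists>k. homog_on n W d k \<and> g d = restrict k P"
      using g unfolding M_def by (meson fun_bimod_homogE)
    then obtain k' where k': "\<And>d. homog_on n W d (k' d)" "\<And>d. g d = restrict (k' d) P" by metis
    have "c' d = g d" for d
    proof (cases "d \<in> ?B")
      case True
      have "k d p - k' d p = 0" if "p \<in> P" for p
      proof (rule homog_components_zero[OF P B, where c = "\<lambda>d p. k d p - k' d p"])
        show "(\<Sum>d\<in>?B. k d p - k' d p) = 0" if "p \<in> P" for p
          using eq[OF that] that by (simp add: k(2) k'(2) sum_subtractf)
        show "homog_on n W d (\<lambda>p. k d p - k' d p)" for d by (rule homog_on_minus[OF k(1) k'(1)])
      qed (use True that in auto)
      then show ?thesis unfolding k(2) k'(2) restrict_eq_iff by simp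
    next
      case False
      then have "c' d = \<zero>\<^bsub>M\<^esub>" "g d = \<zero>\<^bsub>M\<^esub>" using gA by auto
      then show ?thesis by simp
    qed
    then show "c' = g" by blast
  qed
qed

lemma graded_bimodule_fun_bimod:
  assumes A: "fun_ring n A YA" and B: "fun_ring n B YB"
    and P: "cone n W P" and l: "l \<in> W" "l ` P \<subseteq> YA" and r: "r \<in> W" "r ` P \<subseteq> YB"
  shows "graded_bimodule A B (fun_bimod n W P l r)"
proof -
  let ?M = "fun_bimod n W P l r"
  have lY: "l p \<in> YA" and rY: "r p \<in> YB" if "p \<in> P" for p using l(2) r(2) that by auto
  note Apb = fun_ring_pullback[OF A l] and Bpb = fun_ring_pullback[OF B r]
  have A': "cring A" "\<And>a b y. a \<in> carrier A \<Longrightarrow> b \<in> carrier A \<Longrightarrow> y \<in> YA \<Longrightarrow> (a \<oplus>\<^bsub>A\<^esub> b) y = a y + b y"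
     "\<And>a b y. a \<in> carrier A \<Longrightarrow> b \<in> carrier A \<Longrightarrow> y \<in> YA \<Longrightarrow> (a \<otimes>\<^bsub>A\<^esub> b) y = a y * b y"
     "\<And>y. y \<in> YA \<Longrightarrow> \<one>\<^bsub>A\<^esub> y = 1"
    using A unfolding fun_ring_def by auto
  have B': "cring B" "\<And>a b y. a \<in> carrier B \<Longrightarrow> b \<in> carrier B \<Longrightarrow> y \<in> YB \<Longrightarrow> (a \<oplus>\<^bsub>B\<^esub> b) y = a y + b y"
     "\<And>a b y. a \<in> carrier B \<Longrightarrow> b \<in> carrier B \<Longrightarrow> y \<in> YB \<Longrightarrow> (a \<otimes>\<^bsub>B\<^esub> b) y = a y * b y"
     "\<And>y. y \<in> YB \<Longrightarrow> \<one>\<^bsub>B\<^esub> y = 1"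
    using B unfolding fun_ring_def by auto
  interpret M: abelian_group ?M by (rule abelian_group_fun_bimod)
  have lcl: "a \<odot>\<^bsub>?M\<^esub> m \<in> carrier ?M" if 1: "a \<in> carrier A" and 2: "m \<in> carrier ?M" for a m
  proof -
    obtain f g where "poly_on n W f" "\<forall>p\<in>P. a (l p) = f p" "poly_on n W g" "m = restrict g P"
      using Apb(1)[OF 1] fun_bimodE[OF 2] by metis
    then show ?thesis by (auto simp: mult.commute intro!: fun_bimodI[OF poly_on.mult[of n W f g]])
  qed
  have rcl: "rsmult ?M m b \<in> carrier ?M" if 1: "b \<in> carrier B" and 2: "m \<in> carrier ?M" for b m
  proof -
    obtain f g where "poly_on n W f" "\<forall>p\<in>P. b (r p) = f p" "poly_on n W g" "m = restrict g P"
      using Bpb(1)[OF 1] fun_bimodE[OF 2] by metis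
    then show ?thesis by (auto simp: mult.commute intro!: fun_bimodI[OF poly_on.mult[of n W f g]])
  qed
  show ?thesis
  proof (rule graded_bimoduleI)
    show "module A ?M"
      by (rule moduleI) (use A' lY lcl M.abelian_group_axioms in
        \<open>auto simp: restrict_eq_iff algebra_simps elim!: fun_bimodE\<close>)
    have "abelian_group (right_module ?M)"
      by (rule abelian_groupI) (use M.a_assoc M.a_comm M.l_neg M.a_inv_closed in \<open>auto simp del: fun_bimod_simps\<close>)
    then show "module B (right_module ?M)"
      by (intro moduleI) (use B' rY rcl in
        \<open>auto simp: restrict_eq_iff algebra_simps elim!: fun_bimodE\<close>)
    show "rsmult ?M (a \<odot>\<^bsub>?M\<^esub> m) b = a \<odot>\<^bsub>?M\<^esub> rsmult ?M m b" for a m b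
      by (simp add: restrict_eq_iff)
    show "additive_subgroup (homog ?M d) ?M" for d
    proof (rule additive_subgroup.intro, rule group.subgroupI)
      show "Group.group (add_monoid ?M)" by (rule M.add.is_group)
      show "homog ?M d \<subseteq> carrier (add_monoid ?M)"
        by (auto elim!: fun_bimod_homogE intro!: fun_bimodI homog_on_imp_poly_on)
      have "restrict (\<lambda>p. 0) P \<in> homog ?M d" by (rule fun_bimod_homogI[OF homog_on.zero]) simp
      then show "homog ?M d \<noteq> {}" by auto
      show "inv\<^bsub>add_monoid ?M\<^esub> m \<in> homog ?M d" if m: "m \<in> homog ?M d" for m
      proof -
        obtain f where f: "homog_on n W d f" "m = restrict f P" using m by (elim fun_bimod_homogE)
        let ?g = "restrict (\<lambda>p. - 1 * f p) P"
        have g: "?g \<in> homog ?M d" by (rule fun_bimod_homogI[OF homog_on_cmult[OF f(1), of "-1"]]) simp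
        have "m \<in> carrier ?M"
          unfolding f(2) by (rule fun_bimodI[OF homog_on_imp_poly_on[OF f(1)]]) simp
        moreover have "?g \<in> carrier ?M"
          by (rule fun_bimodI[OF homog_on_imp_poly_on[OF homog_on_cmult[OF f(1), of "-1"]]]) simp
        moreover have "?g \<oplus>\<^bsub>?M\<^esub> m = \<zero>\<^bsub>?M\<^esub>" using f by (simp add: restrict_eq_iff)
        ultimately have "\<ominus>\<^bsub>?M\<^esub> m = ?g" using M.minus_equality by blast
        then have "inv\<^bsub>add_monoid ?M\<^esub> m = ?g" by (simp add: a_inv_def)
        then show ?thesis using g by simp
      qed
      show "m \<otimes>\<^bsub>add_monoid ?M\<^esub> m' \<in> homog ?M d" if m: "m \<in> homog ?M d" and m': "m' \<in> homog ?M d" for m m'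
      proof -
        obtain f g where "homog_on n W d f" "m = restrict f P" "homog_on n W d g" "m' = restrict g P"
          using fun_bimod_homogE[OF m] fun_bimod_homogE[OF m'] by metis
        then show ?thesis by (simp add: fun_bimod_homogI[OF homog_on.add[of n W d f g]])
      qed
    qed
    show "\<exists>!c. (\<forall>d. c d \<in> homog ?M d) \<and> finite {d. c d \<noteq> \<zero>\<^bsub>?M\<^esub>} \<and>
        m = finsum ?M c {d. c d \<noteq> \<zero>\<^bsub>?M\<^esub>}" if "m \<in> carrier ?M" for m
      by (rule graded_decomposition_fun_bimod[OF P that])
    show "a \<odot>\<^bsub>?M\<^esub> m \<in> homog ?M (d + e)" if 1: "a \<in> rhomog A d" and 2: "m \<in> homog ?M e" for a m d e
    proof -
      obtain f g where "homog_on n W d f" "\<forall>p\<in>P. a (l p) = f p" "homog_on n W e g" "m = restrict g P"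
        using Apb(2)[OF 1] fun_bimod_homogE[OF 2] by metis
      then show ?thesis by (simp add: fun_bimod_homogI[OF homog_on.mult[of n W d f e g]])
    qed
    show "rsmult ?M m b \<in> homog ?M (d + e)" if 1: "m \<in> homog ?M d" and 2: "b \<in> rhomog B e" for m b d e
    proof -
      obtain f g where "homog_on n W e f" "\<forall>p\<in>P. b (r p) = f p" "homog_on n W d g" "m = restrict g P"
        using Bpb(2)[OF 2] fun_bimod_homogE[OF 1] by metis
      then show ?thesis by (simp add: fun_bimod_homogI[OF homog_on.mult[of n W d g e f]])
    qed
  qed
qed

section \<open>Tensor products of function bimodules\<close>

text \<open>
  Sums of products of functions of the two projections of \<open>t\<close>: the image of a tensor product.
\<close>

inductive product_span ::
  "nat \<Rightarrow> ('p \<Rightarrow> nat \<Rightarrow> 'k::field_char_0) set \<Rightarrow> ('q \<Rightarrow> nat \<Rightarrow> 'k) set \<Rightarrow> ('t \<Rightarrow> 'p) \<Rightarrow> ('t \<Rightarrow> 'q) \<Rightarrow>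
   int \<Rightarrow> ('t \<Rightarrow> 'k) \<Rightarrow> bool"
  for n W W' \<pi>l \<pi>r where
  prod: "homog_on n W i f \<Longrightarrow> homog_on n W' j g \<Longrightarrow>
    product_span n W W' \<pi>l \<pi>r (i + j) (\<lambda>t. f (\<pi>l t) * g (\<pi>r t))"
| add: "product_span n W W' \<pi>l \<pi>r d f \<Longrightarrow> product_span n W W' \<pi>l \<pi>r d g \<Longrightarrow>
    product_span n W W' \<pi>l \<pi>r d (\<lambda>t. f t + g t)"

lemma product_span_mult:
  assumes "product_span n W W' \<pi>l \<pi>r d f" "product_span n W W' \<pi>l \<pi>r e g"
  shows "product_span n W W' \<pi>l \<pi>r (d + e) (\<lambda>t. f t * g t)"
  using assms
proof (induction rule: product_span.induct)
  case (prod i u j v)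
  from prod(3) show ?case
  proof (induction rule: product_span.induct)
    case (prod i' u' j' v')
    have "product_span n W W' \<pi>l \<pi>r ((i + i') + (j + j')) (\<lambda>t. (u (\<pi>l t) * u' (\<pi>l t)) * (v (\<pi>r t) * v' (\<pi>r t)))"
      using product_span.prod[OF homog_on.mult[OF \<open>homog_on n W i u\<close> prod(1)] homog_on.mult[OF \<open>homog_on n W' j v\<close> prod(2)]] .
    then show ?case by (simp add: algebra_simps)
  next
    case (add e f g)
    then show ?case using product_span.add[OF add.IH] by (simp add: distrib_left)
  qed
next
  case (add d f g)
  then show ?case using product_span.add[of n W W' \<pi>l \<pi>r "d + e" "\<lambda>t. f t * _ t" "\<lambda>t. g t * _ t"]
    by (simp add: distrib_right)
qed

lemma homog_on_product_span:
  assumes "homog_on n W'' d f"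
    and gens: "\<And>w. w \<in> W'' \<Longrightarrow> (\<exists>v\<in>W. \<forall>t\<in>T. w t = v (\<pi>l t)) \<or> (\<exists>v\<in>W'. \<forall>t\<in>T. w t = v (\<pi>r t))"
  shows "\<exists>g. product_span n W W' \<pi>l \<pi>r d g \<and> (\<forall>t\<in>T. f t = g t)"
  using assms(1)
proof (induction rule: homog_on.induct)
  case (zero e)
  show ?case
    using product_span.prod[OF homog_on.zero[of n W e] homog_on.const[of n W' 1], of \<pi>l \<pi>r] by auto
next
  case (const c)
  show ?case
    using product_span.prod[OF homog_on.const[of n W c] homog_on.const[of n W' 1], of \<pi>l \<pi>r] by auto
next
  case (coord w i)
  from gens[OF coord(1)] show ?case
  proof (elim disjE bexE)
    fix v assume v: "v \<in> W" "\<forall>t\<in>T. w t = v (\<pi>l t)"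
    show ?thesis
      using product_span.prod[OF homog_on.coord[OF v(1) coord(2)] homog_on.const[of n W' 1], of \<pi>l \<pi>r] v(2) by auto
  next
    fix v assume v: "v \<in> W'" "\<forall>t\<in>T. w t = v (\<pi>r t)"
    show ?thesis
      using product_span.prod[OF homog_on.const[of n W 1] homog_on.coord[OF v(1) coord(2)], of \<pi>l \<pi>r] v(2) by auto
  qed
next
  case (add d f g)
  then obtain f' g' where "product_span n W W' \<pi>l \<pi>r d f'" "\<forall>t\<in>T. f t = f' t"
    "product_span n W W' \<pi>l \<pi>r d g'" "\<forall>t\<in>T. g t = g' t"
    by (elim exE conjE)
  then show ?case by (intro exI[of _ "\<lambda>t. f' t + g' t"]) (simp add: product_span.add)
next
  case (mult d f e g)
  then obtain f' g' where "product_span n W W' \<pi>l \<pi>r d f'" "\<forall>t\<in>T. f t = f' t"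
    "product_span n W W' \<pi>l \<pi>r e g'" "\<forall>t\<in>T. g t = g' t"
    by (elim exE conjE)
  then show ?case by (intro exI[of _ "\<lambda>t. f' t * g' t"]) (simp add: product_span_mult)
qed

lemma homog_on_pullback_on:
  assumes "homog_on n W d f"
    and "\<And>v i. v \<in> W \<Longrightarrow> i \<in> {1..n+1} \<Longrightarrow> \<exists>g. homog_on n W' 2 g \<and> (\<forall>t\<in>T. v (\<pi> t) i = g t)"
  shows "\<exists>g. homog_on n W' d g \<and> (\<forall>t\<in>T. f (\<pi> t) = g t)"
  using assms(1)
proof (induction rule: homog_on.induct)
  case (add d f g)
  then obtain f' g' where "homog_on n W' d f'" "\<forall>t\<in>T. f (\<pi> t) = f' t" "homog_on n W' d g'" "\<forall>t\<in>T. g (\<pi> t) = g' t"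
    by (elim exE conjE)
  then show ?case by (intro exI[of _ "\<lambda>t. f' t + g' t"]) (simp add: homog_on.add)
next
  case (mult d f e g)
  then obtain f' g' where "homog_on n W' d f'" "\<forall>t\<in>T. f (\<pi> t) = f' t" "homog_on n W' e g'" "\<forall>t\<in>T. g (\<pi> t) = g' t"
    by (elim exE conjE)
  then show ?case by (intro exI[of _ "\<lambda>t. f' t * g' t"]) (simp add: homog_on.mult)
next
  case (zero e)
  show ?case by (intro exI[of _ "\<lambda>t. 0"]) (simp add: homog_on.zero)
next
  case (const c)
  show ?case by (intro exI[of _ "\<lambda>t. c"]) (simp add: homog_on.const)
next
  case (coord v i)
  show ?case by (rule assms(2)[OF coord])
qed

lemma poly_on_pullback_on:
  assumes "poly_on n W f"
    and "\<And>v i. v \<in> W \<Longrightarrow> i \<in> {1..n+1} \<Longrightarrow> \<exists>g. homog_on n W' 2 g \<and> (\<forall>t\<in>T. v (\<pi> t) i = g t)"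
  shows "\<exists>g. poly_on n W' g \<and> (\<forall>t\<in>T. f (\<pi> t) = g t)"
  using assms(1)
proof (induction rule: poly_on.induct)
  case (coord v i)
  obtain g where "homog_on n W' 2 g" "\<forall>t\<in>T. v (\<pi> t) i = g t" using assms(2)[OF coord] by blast
  then show ?case using homog_on_imp_poly_on by (intro exI[of _ g]) blast
next
  case (add f g)
  then obtain f' g' where "poly_on n W' f'" "\<forall>t\<in>T. f (\<pi> t) = f' t" "poly_on n W' g'" "\<forall>t\<in>T. g (\<pi> t) = g' t"
    by (elim exE conjE)
  then show ?case by (intro exI[of _ "\<lambda>t. f' t + g' t"]) (simp add: poly_on.add)
next
  case (mult f g)
  then obtain f' g' where "poly_on n W' f'" "\<forall>t\<in>T. f (\<pi> t) = f' t" "poly_on n W' g'" "\<forall>t\<in>T. g (\<pi> t) = g' t"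
    by (elim exE conjE)
  then show ?case by (intro exI[of _ "\<lambda>t. f' t * g' t"]) (simp add: poly_on.mult)
next
  case (const c)
  show ?case by (intro exI[of _ "\<lambda>t. c"]) (simp add: poly_on.const)
qed

text \<open>
  The condition \<open>tensor_kills\<close> for functions \<open>g\<close> on \<open>P\<close> and \<open>f\<close> on \<open>Q\<close>.
\<close>

definition fun_kills ::
  "nat \<Rightarrow> (('k::field_char_0) vec \<Rightarrow> 'k) graded_ring \<Rightarrow> ('p \<Rightarrow> nat \<Rightarrow> 'k) set \<Rightarrow> 'p set \<Rightarrow> ('p \<Rightarrow> nat \<Rightarrow> 'k) \<Rightarrow>
   'q set \<Rightarrow> ('q \<Rightarrow> nat \<Rightarrow> 'k) \<Rightarrow> ('p \<Rightarrow> 'k) \<Rightarrow> ('q \<Rightarrow> 'k) \<Rightarrow> bool" where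
  "fun_kills n S W P r Q l' g f \<longleftrightarrow> (\<exists>e1 e2 s1 s2. poly_on n W e1 \<and> poly_on n W e2 \<and>
     s1 \<in> carrier S \<and> s2 \<in> carrier S \<and> (\<forall>p\<in>P. g p = e1 p * s1 (r p) + e2 p * s2 (r p)) \<and>
     (\<forall>q\<in>Q. s1 (l' q) * f q = 0 \<and> s2 (l' q) * f q = 0))"

text \<open>
  The points \<open>t\<close> of \<open>T\<close> lie over pairs of points of \<open>P\<close> and \<open>Q\<close>, and the pairing is
  \<open>(f, g) \<mapsto> f(\<pi>\<^sub>l t) g(\<pi>\<^sub>r t)\<close>.  It is balanced because \<open>S\<close> does not distinguish the right end of \<open>\<pi>\<^sub>l t\<close>
  from the left end of \<open>\<pi>\<^sub>r t\<close>, and its values span because each coordinate of \<open>t\<close> is a coordinate of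
  one of the two projections.  The functions on \<open>Q\<close> are generated over \<open>S\<close> by \<open>fa\<close> and \<open>fb\<close>.
\<close>

theorem tensor_fun_bimod:
  fixes W :: "('p \<Rightarrow> nat \<Rightarrow> 'k::field_char_0) set" and W' :: "('q \<Rightarrow> nat \<Rightarrow> 'k) set"
    and W'' :: "('t \<Rightarrow> nat \<Rightarrow> 'k) set"
    and M :: "('k, 'm) vec_bimod"
    and N :: "('k, 'n) vec_bimod"
  assumes A: "fun_ring n A YA" and B: "fun_ring n B YB"
    and M: "graded_bimod_iso A S M (fun_bimod n W P l r)"
    and N: "graded_bimod_iso S B N (fun_bimod n W' Q l' r')"
    and T: "graded_bimodule A B (fun_bimod n W'' T l'' r'')"
    and proj: "\<And>t. t \<in> T \<Longrightarrow> \<pi>l t \<in> P" "\<And>t. t \<in> T \<Longrightarrow> \<pi>r t \<in> Q"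
    and ends: "\<And>t. t \<in> T \<Longrightarrow> l'' t = l (\<pi>l t)" "\<And>t. t \<in> T \<Longrightarrow> r'' t = r' (\<pi>r t)"
    and pull1: "\<And>v i. v \<in> W \<Longrightarrow> i \<in> {1..n+1} \<Longrightarrow> \<exists>g. homog_on n W'' 2 g \<and> (\<forall>t\<in>T. v (\<pi>l t) i = g t)"
    and pull2: "\<And>v i. v \<in> W' \<Longrightarrow> i \<in> {1..n+1} \<Longrightarrow> \<exists>g. homog_on n W'' 2 g \<and> (\<forall>t\<in>T. v (\<pi>r t) i = g t)"
    and gens: "\<And>w. w \<in> W'' \<Longrightarrow> (\<exists>v\<in>W. \<forall>t\<in>T. w t = v (\<pi>l t)) \<or> (\<exists>v\<in>W'. \<forall>t\<in>T. w t = v (\<pi>r t))"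
    and bal: "\<And>t s. t \<in> T \<Longrightarrow> s \<in> carrier S \<Longrightarrow> s (r (\<pi>l t)) = s (l' (\<pi>r t))"
    and f: "poly_on n W' fa" "poly_on n W' fb"
    and f_gen: "\<And>g. poly_on n W' g \<Longrightarrow> \<exists>s1\<in>carrier S. \<exists>s2\<in>carrier S. \<forall>q\<in>Q. g q = s1 (l' q) * fa q + s2 (l' q) * fb q"
    and indep: "\<And>g1 g2. poly_on n W g1 \<Longrightarrow> poly_on n W g2 \<Longrightarrow>
      (\<And>t. t \<in> T \<Longrightarrow> g1 (\<pi>l t) * fa (\<pi>r t) + g2 (\<pi>l t) * fb (\<pi>r t) = 0) \<Longrightarrow>
      fun_kills n S W P r Q l' g1 fa \<and> fun_kills n S W P r Q l' g2 fb"
  shows "graded_bimod_iso A B (tensor S M N) (fun_bimod n W'' T l'' r'')"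
proof -
  let ?P = "fun_bimod n W P l r" and ?Q = "fun_bimod n W' Q l' r'" and ?T = "fun_bimod n W'' T l'' r''"
  obtain h where M_gr: "graded_bimodule A S M" and P_gr: "graded_bimodule A S ?P"
    and h: "bij_betw h (carrier M) (carrier ?P)" "h \<zero>\<^bsub>M\<^esub> = \<zero>\<^bsub>?P\<^esub>" "\<And>x. x \<in> carrier M \<Longrightarrow> h x \<in> carrier ?P"
    "\<And>x y. x \<in> carrier M \<Longrightarrow> y \<in> carrier M \<Longrightarrow> h (x \<oplus>\<^bsub>M\<^esub> y) = h x \<oplus>\<^bsub>?P\<^esub> h y"
    "\<And>a x. a \<in> carrier A \<Longrightarrow> x \<in> carrier M \<Longrightarrow> h (a \<odot>\<^bsub>M\<^esub> x) = a \<odot>\<^bsub>?P\<^esub> h x"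
    "\<And>b x. b \<in> carrier S \<Longrightarrow> x \<in> carrier M \<Longrightarrow> h (rsmult M x b) = rsmult ?P (h x) b"
    "\<And>d. h ` homog M d = homog ?P d"
    by (rule graded_bimod_isoE[OF M]) blast
  obtain k where N_gr: "graded_bimodule S B N" and Q_gr: "graded_bimodule S B ?Q"
    and k: "bij_betw k (carrier N) (carrier ?Q)" "k \<zero>\<^bsub>N\<^esub> = \<zero>\<^bsub>?Q\<^esub>" "\<And>x. x \<in> carrier N \<Longrightarrow> k x \<in> carrier ?Q"
    "\<And>x y. x \<in> carrier N \<Longrightarrow> y \<in> carrier N \<Longrightarrow> k (x \<oplus>\<^bsub>N\<^esub> y) = k x \<oplus>\<^bsub>?Q\<^esub> k y"
    "\<And>a x. a \<in> carrier S \<Longrightarrow> x \<in> carrier N \<Longrightarrow> k (a \<odot>\<^bsub>N\<^esub> x) = a \<odot>\<^bsub>?Q\<^esub> k x"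
    "\<And>b x. b \<in> carrier B \<Longrightarrow> x \<in> carrier N \<Longrightarrow> k (rsmult N x b) = rsmult ?Q (k x) b"
    "\<And>d. k ` homog N d = homog ?Q d"
    by (rule graded_bimod_isoE[OF N]) blast
  have h_inj: "x = y" if "x \<in> carrier M" "y \<in> carrier M" "h x = h y" for x y
    using inj_onD[OF bij_betw_imp_inj_on[OF h(1)] that(3,1,2)] .
  have k_inj: "x = y" if "x \<in> carrier N" "y \<in> carrier N" "k x = k y" for x y
    using inj_onD[OF bij_betw_imp_inj_on[OF k(1)] that(3,1,2)] .
  have h_surj: "\<exists>x\<in>carrier M. h x = restrict g P" if "poly_on n W g" for g
  proof -
    have "restrict g P \<in> carrier ?P" using fun_bimodI[OF that] by simp
    then have "restrict g P \<in> h ` carrier M" using bij_betw_imp_surj_on[OF h(1)] by simp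
    then show ?thesis by (metis imageE)
  qed
  have k_surj: "\<exists>x\<in>carrier N. k x = restrict g Q" if "poly_on n W' g" for g
  proof -
    have "restrict g Q \<in> carrier ?Q" using fun_bimodI[OF that] by simp
    then have "restrict g Q \<in> k ` carrier N" using bij_betw_imp_surj_on[OF k(1)] by simp
    then show ?thesis by (metis imageE)
  qed
  interpret M: abelian_group M by (rule graded_bimodule_abelian_group[OF M_gr])
  interpret N: abelian_group N by (rule graded_bimodule_abelian_group[OF N_gr])
  interpret Q: abelian_group ?T by (rule abelian_group_fun_bimod)
  define \<phi> where "\<phi> x y = (\<lambda>t\<in>T. h x (\<pi>l t) * k y (\<pi>r t))" for x y
  have \<phi>_homog: "\<phi> x y \<in> homog ?T (i + j)" if x: "x \<in> homog M i" and y: "y \<in> homog N j" for x y i j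
  proof -
    have "h x \<in> homog ?P i" "k y \<in> homog ?Q j" 
      unfolding h(7)[symmetric] k(7)[symmetric] by (rule imageI[OF x], rule imageI[OF y])
    then obtain u v where u: "homog_on n W i u" "h x = restrict u P" and v: "homog_on n W' j v" "k y = restrict v Q"
      by (metis fun_bimod_homogE)
    obtain u' where u': "homog_on n W'' i u'" "\<forall>t\<in>T. u (\<pi>l t) = u' t"
      using homog_on_pullback_on[OF u(1), where T = T and \<pi> = \<pi>l and W' = W''] pull1 by blast
    obtain v' where v': "homog_on n W'' j v'" "\<forall>t\<in>T. v (\<pi>r t) = v' t"
      using homog_on_pullback_on[OF v(1), where T = T and \<pi> = \<pi>r and W' = W''] pull2 by blast
    show ?thesis unfolding \<phi>_def
      by (rule fun_bimod_homogI[OF homog_on.mult[OF u'(1) v'(1)]]) (use u v u' v' proj in simp)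
  qed
  have \<phi>_in: "\<phi> x y \<in> carrier ?T" if x: "x \<in> carrier M" and y: "y \<in> carrier N" for x y
  proof -
    obtain u v where u: "poly_on n W u" "h x = restrict u P" and v: "poly_on n W' v" "k y = restrict v Q"
      using h(3)[OF x] k(3)[OF y] by (metis fun_bimodE)
    obtain u' where u': "poly_on n W'' u'" "\<forall>t\<in>T. u (\<pi>l t) = u' t"
      using poly_on_pullback_on[OF u(1), where T = T and \<pi> = \<pi>l and W' = W''] pull1 by blast
    obtain v' where v': "poly_on n W'' v'" "\<forall>t\<in>T. v (\<pi>r t) = v' t"
      using poly_on_pullback_on[OF v(1), where T = T and \<pi> = \<pi>r and W' = W''] pull2 by blast
    show ?thesis unfolding \<phi>_def
      by (rule fun_bimodI[OF poly_on.mult[OF u'(1) v'(1)]]) (use u v u' v' proj in simp)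
  qed
  interpret balanced_pairing S M N ?T \<phi>
  proof
    show "\<phi> (rsmult M x s) y = \<phi> x (s \<odot>\<^bsub>N\<^esub> y)" if "x \<in> carrier M" "s \<in> carrier S" "y \<in> carrier N" for x s y
      using that bal[of _ s] proj by (simp add: \<phi>_def restrict_eq_iff h k)
  qed (use graded_bimodule_closed[OF M_gr] graded_bimodule_closed[OF N_gr] \<phi>_in proj in
      \<open>simp_all add: \<phi>_def restrict_eq_iff h k distrib_left distrib_right\<close>)
  let ?G = "\<lambda>d. {\<phi> x y | x y i j. x \<in> homog M i \<and> y \<in> homog N j \<and> i + j = d}"
  have span: "restrict g T \<in> generate (add_monoid ?T) (?G d)" if "product_span n W W' \<pi>l \<pi>r d g" for d g
    using that
  proof (induction rule: product_span.induct)
    case (prod i u j v)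
    have "restrict u P \<in> homog ?P i" "restrict v Q \<in> homog ?Q j"
      using fun_bimod_homogI[OF prod(1)] fun_bimod_homogI[OF prod(2)] by simp_all
    then have "restrict u P \<in> h ` homog M i" "restrict v Q \<in> k ` homog N j" using h(7) k(7) by simp_all
    then obtain x y where x: "x \<in> homog M i" "restrict u P = h x" and y: "y \<in> homog N j" "restrict v Q = k y"
      by (elim imageE) simp
    have "u (\<pi>l t) = h x (\<pi>l t)" "v (\<pi>r t) = k y (\<pi>r t)" if "t \<in> T" for t
      using proj[OF that] by (simp_all add: x(2)[symmetric] y(2)[symmetric])
    then have "(\<lambda>t\<in>T. u (\<pi>l t) * v (\<pi>r t)) = \<phi> x y"
      unfolding \<phi>_def by (simp add: restrict_eq_iff)
    moreover have "\<phi> x y \<in> generate (add_monoid ?T) (?G (i + j))"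
      by (rule generate.incl, rule CollectI, intro exI[of _ x] exI[of _ y] exI[of _ i] exI[of _ j])
        (simp add: x(1) y(1))
    ultimately show ?case by (simp only:)
  next
    case (add d f g)
    have "restrict f T \<otimes>\<^bsub>add_monoid ?T\<^esub> restrict g T \<in> generate (add_monoid ?T) (?G d)"
      by (rule generate.eng[OF add.IH])
    moreover have "restrict f T \<otimes>\<^bsub>add_monoid ?T\<^esub> restrict g T = (\<lambda>t\<in>T. f t + g t)"
      by (simp add: restrict_eq_iff)
    ultimately show ?case by (simp only:)
  qed
  obtain F1 where F1: "F1 \<in> carrier N" "k F1 = restrict fa Q" using k_surj[OF f(1)] by blast
  obtain F2 where F2: "F2 \<in> carrier N" "k F2 = restrict fb Q" using k_surj[OF f(2)] by blast
  have kills: "tensor_kills S M N m F"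
    if m: "m \<in> carrier M" "h m = restrict g P" and F: "F \<in> carrier N" "k F = restrict u Q"
      and g: "fun_kills n S W P r Q l' g u" for m g F u
  proof -
    obtain e1 e2 s1 s2 where e: "poly_on n W e1" "poly_on n W e2" and s: "s1 \<in> carrier S" "s2 \<in> carrier S"
      and eq: "\<And>p. p \<in> P \<Longrightarrow> g p = e1 p * s1 (r p) + e2 p * s2 (r p)"
      "\<And>q. q \<in> Q \<Longrightarrow> s1 (l' q) * u q = 0 \<and> s2 (l' q) * u q = 0"
      using g unfolding fun_kills_def by blast
    obtain E1 where E1: "E1 \<in> carrier M" "h E1 = restrict e1 P" using h_surj[OF e(1)] by blast
    obtain E2 where E2: "E2 \<in> carrier M" "h E2 = restrict e2 P" using h_surj[OF e(2)] by blast
    have "m = rsmult M E1 s1 \<oplus>\<^bsub>M\<^esub> rsmult M E2 s2"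
      by (rule h_inj) (use m E1 E2 s graded_bimodule_closed(2)[OF M_gr] eq in \<open>simp_all add: h restrict_eq_iff\<close>)
    moreover have "s1 \<odot>\<^bsub>N\<^esub> F = \<zero>\<^bsub>N\<^esub>" "s2 \<odot>\<^bsub>N\<^esub> F = \<zero>\<^bsub>N\<^esub>"
      by (rule k_inj; use F s graded_bimodule_closed(1)[OF N_gr] eq in \<open>simp add: k restrict_eq_iff\<close>)+
    ultimately show ?thesis using E1(1) E2(1) s unfolding tensor_kills_def by blast
  qed
  show ?thesis
  proof (rule tensor_iso_of_pairing[OF T])
    show "rhomog A d \<subseteq> carrier A" "rhomog B d \<subseteq> carrier B" for d
      using A B unfolding fun_ring_def by blast+
    show "a \<odot>\<^bsub>M\<^esub> x \<in> carrier M" if "a \<in> carrier A" "x \<in> carrier M" for a x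
      using graded_bimodule_closed(1)[OF M_gr] that by blast
    show "\<phi> (a \<odot>\<^bsub>M\<^esub> x) y = a \<odot>\<^bsub>?T\<^esub> \<phi> x y" if "a \<in> carrier A" "x \<in> carrier M" "y \<in> carrier N" for a x y
      using that proj by (simp add: \<phi>_def restrict_eq_iff h ends)
    show "rsmult N y b \<in> carrier N" if "b \<in> carrier B" "y \<in> carrier N" for b y
      using graded_bimodule_closed(2)[OF N_gr] that by blast
    show "\<phi> x (rsmult N y b) = rsmult ?T (\<phi> x y) b" if "b \<in> carrier B" "x \<in> carrier M" "y \<in> carrier N" for b x y
      using that proj by (simp add: \<phi>_def restrict_eq_iff k ends)
    show "homog M d \<subseteq> carrier M" "homog N d \<subseteq> carrier N" for d
      using homog_in_carrier[OF M_gr] homog_in_carrier[OF N_gr] by blast+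
    show "homog ?T d = generate (add_monoid ?T) (?G d)" for d
    proof
      have "subgroup (homog ?T d) (add_monoid ?T)"
        using T unfolding graded_bimodule_def additive_subgroup_def by blast
      moreover have "?G d \<subseteq> homog ?T d" using \<phi>_homog by auto
      ultimately show "generate (add_monoid ?T) (?G d) \<subseteq> homog ?T d"
        by (intro group.generate_subgroup_incl[OF comm_group.axioms(2)[OF Q.a_comm_group]])
      show "homog ?T d \<subseteq> generate (add_monoid ?T) (?G d)"
      proof
        fix x assume "x \<in> homog ?T d"
        then obtain f where f: "homog_on n W'' d f" "x = restrict f T" by (elim fun_bimod_homogE)
        obtain g where g: "product_span n W W' \<pi>l \<pi>r d g" "\<forall>t\<in>T. f t = g t"
          using homog_on_product_span[OF f(1) gens] by blast
        have "x = restrict g T" unfolding f(2) restrict_eq_iff using g(2) .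
        then show "x \<in> generate (add_monoid ?T) (?G d)" using span[OF g(1)] by simp
      qed
    qed
    show "F1 \<in> carrier N" "F2 \<in> carrier N" by fact+
    show "\<exists>s1\<in>carrier S. \<exists>s2\<in>carrier S. y = s1 \<odot>\<^bsub>N\<^esub> F1 \<oplus>\<^bsub>N\<^esub> s2 \<odot>\<^bsub>N\<^esub> F2" if y: "y \<in> carrier N" for y
    proof -
      obtain g where g: "poly_on n W' g" "k y = restrict g Q" using k(3)[OF y] by (elim fun_bimodE)
      obtain s1 s2 where s: "s1 \<in> carrier S" "s2 \<in> carrier S" "\<forall>q\<in>Q. g q = s1 (l' q) * fa q + s2 (l' q) * fb q"
        using f_gen[OF g(1)] by blast
      have "y = s1 \<odot>\<^bsub>N\<^esub> F1 \<oplus>\<^bsub>N\<^esub> s2 \<odot>\<^bsub>N\<^esub> F2"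
        by (rule k_inj) (use y g s F1 F2 graded_bimodule_closed(1)[OF N_gr] in \<open>simp_all add: k restrict_eq_iff\<close>)
      then show ?thesis using s by blast
    qed
    show "tensor_kills S M N m1 F1 \<and> tensor_kills S M N m2 F2"
      if m: "m1 \<in> carrier M" "m2 \<in> carrier M" "\<phi> m1 F1 \<oplus>\<^bsub>?T\<^esub> \<phi> m2 F2 = \<zero>\<^bsub>?T\<^esub>" for m1 m2
    proof -
      obtain g1 g2 where g: "poly_on n W g1" "h m1 = restrict g1 P" "poly_on n W g2" "h m2 = restrict g2 P"
        using h(3)[OF m(1)] h(3)[OF m(2)] by (metis fun_bimodE)
      have "g1 (\<pi>l t) * fa (\<pi>r t) + g2 (\<pi>l t) * fb (\<pi>r t) = 0" if "t \<in> T" for t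
      proof -
        have "\<phi> m1 F1 t + \<phi> m2 F2 t = 0" using m(3) that by (simp add: restrict_eq_iff)
        then show ?thesis using proj[OF that] that by (simp add: \<phi>_def g F1 F2)
      qed
      then have "fun_kills n S W P r Q l' g1 fa \<and> fun_kills n S W P r Q l' g2 fb"
        by (rule indep[OF g(1,3)])
      then show ?thesis using kills[OF m(1) g(2) F1] kills[OF m(2) g(4) F2] by blast
    qed
  qed
qed

section \<open>Regular functions as polynomial functions\<close>

lemma coord_homog_on: "i \<in> {1..n+1} \<Longrightarrow> homog_on n {\<lambda>x. x} 2 (\<lambda>x. x i)"
  using homog_on.coord[of "\<lambda>x. x" "{\<lambda>x. x}" i n] by simp

lemma coord_poly_on: "i \<in> {1..n+1} \<Longrightarrow> poly_on n {\<lambda>x. x} (\<lambda>x. x i)"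
  by (rule homog_on_imp_poly_on[OF coord_homog_on])

lemma hom_poly_imp_homog_on: "hom_poly n d f \<Longrightarrow> homog_on n {\<lambda>x. x} (2 * int d) f"
proof (induction rule: hom_poly.induct)
  case (coord i)
  then show ?case using homog_on.coord[of "\<lambda>x. x" "{\<lambda>x. x}" i n] by simp
next
  case (mult d f e g)
  then show ?case using homog_on.mult[of n "{\<lambda>x. x}" "2 * int d" f "2 * int e" g] by (simp add: algebra_simps)
qed (use homog_on.const homog_on.add in fastforce)+

lemma hom_poly_zero: "hom_poly n d (\<lambda>x :: nat \<Rightarrow> 'k::field_char_0. 0)"
proof (induction d)
  case (Suc d)
  have "hom_poly n (d + 1) (\<lambda>x :: 'k vec. 0 * x 1)"
    by (rule hom_poly.mult[OF Suc], rule hom_poly.coord) simp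
  then show ?case by simp
qed (rule hom_poly.const)

lemma homog_on_imp_hom_poly:
  assumes "homog_on n {\<lambda>x. x} e f"
  shows "f = (\<lambda>x. 0) \<or> (0 \<le> e \<and> even e \<and> hom_poly n (nat (e div 2)) f)"
  using assms
proof (induction rule: homog_on.induct)
  case (const c)
  then show ?case by (simp add: hom_poly.const)
next
  case (coord v i)
  then have "hom_poly n 1 (\<lambda>p. v p i)" using hom_poly.coord by simp
  then show ?case by simp
next
  case (add d f g)
  then consider "f = (\<lambda>x. 0)" | "g = (\<lambda>x. 0)"
    | "0 \<le> d" "even d" "hom_poly n (nat (d div 2)) f" "hom_poly n (nat (d div 2)) g" by blast
  then show ?case
  proof cases
    case 3
    then show ?thesis using hom_poly.add by blast
  qed (use add in auto)
next
  case (mult d f e g)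
  then consider "f = (\<lambda>x. 0)" | "g = (\<lambda>x. 0)"
    | "0 \<le> d" "even d" "hom_poly n (nat (d div 2)) f" "0 \<le> e" "even e" "hom_poly n (nat (e div 2)) g" by blast
  then show ?case
  proof cases
    case 3
    then have "nat ((d + e) div 2) = nat (d div 2) + nat (e div 2)"
      by (metis div_plus_div_distrib_dvd_left nat_add_distrib pos_imp_zdiv_nonneg_iff zero_less_numeral)
    then show ?thesis using hom_poly.mult[OF 3(3,6)] 3 by simp
  qed simp_all
qed simp

lemma reg_homog_eq: "reg_homog n X e = {restrict f X | f. homog_on n {\<lambda>x. x} e f}"
proof (cases "0 \<le> e \<and> even e")
  case True
  have "2 * int (nat (e div 2)) = e" using True by simp
  then have "hom_poly n (nat (e div 2)) f \<longleftrightarrow> homog_on n {\<lambda>x. x} e f" for f :: "(nat \<Rightarrow> 'a) \<Rightarrow> 'a"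
    using hom_poly_imp_homog_on[of n "nat (e div 2)" f] homog_on_imp_hom_poly[of n e f] hom_poly_zero by metis
  then show ?thesis using True by (simp add: reg_homog_def)
next
  case False
  then have "homog_on n {\<lambda>x. x} e f \<longleftrightarrow> f = (\<lambda>x. 0)" for f :: "(nat \<Rightarrow> 'a) \<Rightarrow> 'a"
    using homog_on_imp_hom_poly[of n e f] homog_on.zero by blast
  then show ?thesis using False by (auto simp: reg_homog_def)
qed

lemma poly_fun_hom_poly: "hom_poly n d f \<Longrightarrow> poly_fun n f"
  unfolding poly_fun_def
  by (intro exI[of _ d] exI[of _ "\<lambda>e. if e = d then f else (\<lambda>x. 0)"])
    (auto simp: hom_poly_zero if_distrib[of "\<lambda>h. h _"] fun_eq_iff)

lemma poly_fun_add:
  assumes "poly_fun n f" "poly_fun n g"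
  shows "poly_fun n (\<lambda>x. f x + g x)"
proof -
  obtain N u where u: "\<forall>d\<le>N. hom_poly n d (u d)" "f = (\<lambda>x. \<Sum>d\<le>N. u d x)"
    using assms(1) unfolding poly_fun_def by blast
  obtain N' u' where u': "\<forall>d\<le>N'. hom_poly n d (u' d)" "g = (\<lambda>x. \<Sum>d\<le>N'. u' d x)"
    using assms(2) unfolding poly_fun_def by blast
  let ?M = "max N N'"
  have pad: "(\<Sum>d\<le>?M. if d \<le> K then h d else 0) = (\<Sum>d\<le>K. h d)" if "K \<le> ?M" for K and h :: "nat \<Rightarrow> 'a"
  proof -
    have "{..?M} \<inter> {d. d \<le> K} = {..K}" using that by auto
    then show ?thesis by (simp add: sum.If_cases)
  qed
  let ?h = "\<lambda>d x. (if d \<le> N then u d x else 0) + (if d \<le> N' then u' d x else 0)"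
  have "hom_poly n d (?h d)" for d
  proof (rule hom_poly.add)
    show "hom_poly n d (\<lambda>x. if d \<le> N then u d x else 0)"
      using u(1) by (cases "d \<le> N") (simp_all add: hom_poly_zero)
    show "hom_poly n d (\<lambda>x. if d \<le> N' then u' d x else 0)"
      using u'(1) by (cases "d \<le> N'") (simp_all add: hom_poly_zero)
  qed
  moreover have "f x + g x = (\<Sum>d\<le>?M. ?h d x)" for x
    unfolding u(2) u'(2) sum.distrib by (simp add: pad)
  ultimately show ?thesis unfolding poly_fun_def by (intro exI[of _ ?M] exI[of _ ?h]) simp
qed

lemma poly_fun_iff: "poly_fun n f \<longleftrightarrow> poly_on n {\<lambda>x. x} f"
proof
  assume "poly_fun n f"
  then obtain N g where "\<forall>d\<le>N. hom_poly n d (g d)" "f = (\<lambda>x. \<Sum>d\<le>N. g d x)"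
    unfolding poly_fun_def by blast
  then show "poly_on n {\<lambda>x. x} f"
    using homog_on_imp_poly_on[OF hom_poly_imp_homog_on] by (auto intro!: poly_on_sum)
next
  assume "poly_on n {\<lambda>x. x} f"
  then obtain A c where A: "finite A" "\<forall>d. homog_on n {\<lambda>x. x} d (c d)" "f = (\<lambda>x. \<Sum>d\<in>A. c d x)"
    using poly_on_decomp by blast
  have c: "poly_fun n (c d)" for d
    using homog_on_imp_hom_poly[of n d "c d"] A(2) poly_fun_hom_poly hom_poly_zero by metis
  have "poly_fun n (\<lambda>x. \<Sum>d\<in>B. c d x)" if "finite B" for B
    using that
  proof (induction B rule: finite_induct)
    case empty
    then show ?case using poly_fun_hom_poly[OF hom_poly_zero] by simp
  next
    case (insert d B)
    then show ?case using poly_fun_add[OF c] by simp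
  qed
  then show "poly_fun n f" using A by simp
qed

lemma reg_bimod_eq: "reg_bimod n X = fun_bimod n {\<lambda>x. x} X (\<lambda>x. x) (\<lambda>x. x)"
  by (simp add: reg_bimod_def fun_bimod_def reg_ring_def reg_homog_eq poly_fun_iff fun_eq_iff)

lemma fun_ringI:
  assumes carrier: "\<And>a. a \<in> carrier A \<Longrightarrow> \<exists>f. poly_on n {\<lambda>x. x} f \<and> a = restrict f Y"
    and ops: "\<And>a b. a \<oplus>\<^bsub>A\<^esub> b = (\<lambda>y\<in>Y. a y + b y)" "\<And>a b. a \<otimes>\<^bsub>A\<^esub> b = (\<lambda>y\<in>Y. a y * b y)"
      "\<zero>\<^bsub>A\<^esub> = (\<lambda>y\<in>Y. 0)" "\<one>\<^bsub>A\<^esub> = (\<lambda>y\<in>Y. 1)"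
    and closed: "\<And>a b. a \<in> carrier A \<Longrightarrow> b \<in> carrier A \<Longrightarrow> (\<lambda>y\<in>Y. a y + b y) \<in> carrier A"
      "\<And>a b. a \<in> carrier A \<Longrightarrow> b \<in> carrier A \<Longrightarrow> (\<lambda>y\<in>Y. a y * b y) \<in> carrier A"
      "\<And>c. (\<lambda>y\<in>Y. c) \<in> carrier A"
    and grading: "\<And>d a. a \<in> rhomog A d \<Longrightarrow> a \<in> carrier A \<and> (\<exists>f. homog_on n {\<lambda>x. x} d f \<and> a = restrict f Y)"
  shows "fun_ring n A Y"
proof -
  have ext: "a = restrict a Y" if "a \<in> carrier A" for a
    using carrier[OF that] by (auto simp: restrict_eq_iff)
  have "cring A"
  proof (rule cringI)
    show "abelian_group A"
    proof (rule abelian_groupI)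
      fix a assume a: "a \<in> carrier A"
      show "\<exists>b\<in>carrier A. b \<oplus>\<^bsub>A\<^esub> a = \<zero>\<^bsub>A\<^esub>"
      proof
        show "(\<lambda>y\<in>Y. (\<lambda>y\<in>Y. -1) y * a y) \<in> carrier A" by (rule closed(2)[OF closed(3) a])
      qed (simp add: ops restrict_eq_iff)
      show "\<zero>\<^bsub>A\<^esub> \<oplus>\<^bsub>A\<^esub> a = a" by (subst (2) ext[OF a]) (simp add: ops restrict_eq_iff)
    qed (simp_all add: ops closed restrict_eq_iff algebra_simps)
    show "Group.comm_monoid A"
    proof (rule comm_monoidI)
      fix a assume a: "a \<in> carrier A"
      show "\<one>\<^bsub>A\<^esub> \<otimes>\<^bsub>A\<^esub> a = a" by (subst (2) ext[OF a]) (simp add: ops restrict_eq_iff)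
    qed (simp_all add: ops closed restrict_eq_iff algebra_simps)
  qed (simp add: ops restrict_eq_iff algebra_simps)
  moreover have "\<exists>f. poly_on n {\<lambda>x. x} f \<and> (\<forall>y\<in>Y. a y = f y)" if "a \<in> carrier A" for a
    using carrier[OF that] by auto
  moreover have "\<exists>f. homog_on n {\<lambda>x. x} d f \<and> (\<forall>y\<in>Y. a y = f y)" if "a \<in> rhomog A d" for a d
    using grading[OF that] by auto
  ultimately show ?thesis unfolding fun_ring_def using grading by (auto simp: ops)
qed

lemma carrier_reg_ring: "carrier (reg_ring n X) = {restrict f X | f. poly_on n {\<lambda>x. x} f}"
  by (simp add: reg_ring_def poly_fun_iff)

lemma restrict_in_reg_ring:
  "poly_on n {\<lambda>x. x} f \<Longrightarrow> (\<And>x. x \<in> X \<Longrightarrow> a x = f x) \<Longrightarrow> restrict a X \<in> carrier (reg_ring n X)"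
  unfolding carrier_reg_ring by (rule CollectI, rule exI[of _ f]) (simp add: restrict_eq_iff)

lemma reg_ring_closed:
  assumes "a \<in> carrier (reg_ring n X)" "b \<in> carrier (reg_ring n X)"
  shows "(\<lambda>x\<in>X. a x + b x) \<in> carrier (reg_ring n X)" "(\<lambda>x\<in>X. a x * b x) \<in> carrier (reg_ring n X)"
proof -
  obtain f g where f: "poly_on n {\<lambda>x. x} f" "a = restrict f X" and g: "poly_on n {\<lambda>x. x} g" "b = restrict g X"
    using assms by (auto simp: carrier_reg_ring)
  show "(\<lambda>x\<in>X. a x + b x) \<in> carrier (reg_ring n X)"
    by (rule restrict_in_reg_ring[OF poly_on.add[OF f(1) g(1)]]) (simp add: f g)
  show "(\<lambda>x\<in>X. a x * b x) \<in> carrier (reg_ring n X)"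
    by (rule restrict_in_reg_ring[OF poly_on.mult[OF f(1) g(1)]]) (simp add: f g)
qed

lemma const_in_reg_ring: "(\<lambda>x\<in>X. c) \<in> carrier (reg_ring n X)"
  by (rule restrict_in_reg_ring[OF poly_on.const]) simp

lemma reg_homog_in_carrier: "a \<in> reg_homog n X d \<Longrightarrow> a \<in> carrier (reg_ring n X)"
  by (auto simp: reg_homog_eq carrier_reg_ring dest: homog_on_imp_poly_on)

lemma reg_ring_ops:
  "a \<oplus>\<^bsub>reg_ring n X\<^esub> b = (\<lambda>x\<in>X. a x + b x)" "a \<otimes>\<^bsub>reg_ring n X\<^esub> b = (\<lambda>x\<in>X. a x * b x)"
  "\<zero>\<^bsub>reg_ring n X\<^esub> = (\<lambda>x\<in>X. 0)" "\<one>\<^bsub>reg_ring n X\<^esub> = (\<lambda>x\<in>X. 1)" "rhomog (reg_ring n X) d = reg_homog n X d"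
  by (simp_all add: reg_ring_def)

lemma fun_ring_reg_ring: "fun_ring n (reg_ring n X) X"
proof (rule fun_ringI)
  show "a \<in> carrier (reg_ring n X) \<and> (\<exists>f. homog_on n {\<lambda>x. x} d f \<and> a = restrict f X)"
    if "a \<in> rhomog (reg_ring n X) d" for a d
    using that reg_homog_in_carrier[of a n X d] by (auto simp: reg_ring_ops reg_homog_eq)
qed (auto simp: reg_ring_ops reg_ring_closed const_in_reg_ring, auto simp: carrier_reg_ring)

lemma invariant_ring_simps:
  "carrier (invariant_ring n w X) = carrier (reg_ring n X) \<inter> {f. \<forall>x\<in>X. f (act w x) = f x}"
  "add (invariant_ring n w X) = add (reg_ring n X)"
  "monoid.mult (invariant_ring n w X) = monoid.mult (reg_ring n X)"
  "\<zero>\<^bsub>invariant_ring n w X\<^esub> = \<zero>\<^bsub>reg_ring n X\<^esub>" "\<one>\<^bsub>invariant_ring n w X\<^esub> = \<one>\<^bsub>reg_ring n X\<^esub>"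
  "rhomog (invariant_ring n w X) d = reg_homog n X d \<inter> {f. \<forall>x\<in>X. f (act w x) = f x}"
  by (simp_all add: invariant_ring_def Let_def reg_ring_def)

lemma fun_ring_invariant_ring:
  assumes "\<And>x. x \<in> X \<Longrightarrow> act w x \<in> X"
  shows "fun_ring n (invariant_ring n w X) X"
proof (rule fun_ringI)
  show "a \<in> carrier (invariant_ring n w X) \<and> (\<exists>f. homog_on n {\<lambda>x. x} d f \<and> a = restrict f X)"
    if "a \<in> rhomog (invariant_ring n w X) d" for a d
    using that reg_homog_in_carrier[of a n X d] by (auto simp: invariant_ring_simps reg_homog_eq)
qed (use assms in \<open>auto simp: invariant_ring_simps reg_ring_ops reg_ring_closed const_in_reg_ring\<close>,
    auto simp: carrier_reg_ring)

section \<open>Weyl lines and two-valued vectors\<close>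

text \<open>
  A Weyl line of type A corresponds to a partition of \<open>{1..n+1}\<close> into two blocks; its vectors are
  those of coordinate sum \<open>0\<close> that are constant on the blocks.
\<close>

definition two_valued :: "nat \<Rightarrow> 'k vec \<Rightarrow> bool" where
  "two_valued n x \<longleftrightarrow> (\<forall>a\<in>{1..n+1}. \<forall>b\<in>{1..n+1}. \<forall>c\<in>{1..n+1}. x a = x b \<or> x b = x c \<or> x a = x c)"

text \<open>
  The union of the Weyl lines transverse to the transposition of \<open>a\<close> and \<open>b\<close>, by \<open>transverse_union_eq\<close>.
\<close>

definition separated :: "nat \<Rightarrow> nat \<Rightarrow> nat \<Rightarrow> ('k::field_char_0) vec set" where
  "separated n a b = {x \<in> geom_rep n. two_valued n x \<and> (x = (\<lambda>_. 0) \<or> x a \<noteq> x b)}"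

lemma act_transpose: "act (Transposition.transpose a b) x = x \<circ> Transposition.transpose a b"
  by (simp add: act_def)

lemma hyperplane_transpose:
  "hyperplane n (Transposition.transpose a b) = {x \<in> geom_rep n. x a = x b}"
proof -
  have "x \<circ> Transposition.transpose a b = x \<longleftrightarrow> x a = x b" for x :: "nat \<Rightarrow> 'a"
  proof
    assume "x \<circ> Transposition.transpose a b = x"
    from fun_cong[OF this, of b] show "x a = x b" by simp
  next
    assume "x a = x b"
    then show "x \<circ> Transposition.transpose a b = x" by (simp add: fun_eq_iff Transposition.transpose_def)
  qed
  then show ?thesis unfolding hyperplane_def act_transpose by simp
qed

lemma geom_rep_iff:
  "x \<in> geom_rep n \<longleftrightarrow> (\<forall>i. i \<notin> {1..n+1} \<longrightarrow> x i = 0) \<and> sum x {1..n+1} = 0"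
  by (simp only: geom_rep_def mem_Collect_eq)

lemma geom_rep_scale: "x \<in> geom_rep n \<Longrightarrow> (\<lambda>i. c * x i) \<in> geom_rep n"
  unfolding geom_rep_iff sum_distrib_left[symmetric] by simp

lemma two_valued_scale: "two_valued n x \<Longrightarrow> two_valued n (\<lambda>i. c * x i)"
  unfolding two_valued_def by metis

lemma geom_rep_nonzero:
  assumes "x \<in> geom_rep n" "x \<noteq> (\<lambda>_. 0)" shows "\<exists>i\<in>{1..n+1}. x i \<noteq> 0"
  using assms unfolding geom_rep_def fun_eq_iff by blast

text \<open>
  If a vector on a Weyl line took three values \<open>u\<close>, \<open>v\<close>, \<open>w\<close>, each vector supported on the places
  of two of these values, constant on each of them and of coordinate sum \<open>0\<close>, would satisfy the
  same equations, hence lie on the same line; so each of the three values would be \<open>0\<close>.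
\<close>

lemma weyl_line_two_valued:
  fixes x :: "('k::field_char_0) vec"
  assumes L: "L \<in> weyl_lines n" and x: "x \<in> L"
  shows "x \<in> geom_rep n" "two_valued n x"
proof -
  obtain S v where S: "S \<subseteq> reflections n" "L = geom_rep n \<inter> (\<Inter>t\<in>S. hyperplane n t)"
    and v: "v \<noteq> (\<lambda>_. 0)" "L = {\<lambda>i. c * v i | c. True}"
    using L unfolding weyl_lines_def by blast
  show "x \<in> geom_rep n" using x S by blast
  let ?I = "{1..n+1}"
  have "(\<lambda>i. 1 * v i) \<in> L" unfolding v(2) by blast
  then have vL: "v \<in> L" by simp
  have inL: "\<exists>c. w = (\<lambda>i. c * v i)"
    if w: "w \<in> geom_rep n" "\<And>p q. p \<in> ?I \<Longrightarrow> q \<in> ?I \<Longrightarrow> v p = v q \<Longrightarrow> w p = w q" for w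
  proof -
    have "w \<in> hyperplane n t" if t: "t \<in> S" for t
    proof -
      obtain p q where pq: "t = Transposition.transpose p q" "p \<in> ?I" "q \<in> ?I"
        using t S(1) unfolding reflections_def by blast
      have "v \<in> hyperplane n t" using vL S(2) t by blast
      then have "v p = v q" using pq(1) by (simp add: hyperplane_transpose)
      then show ?thesis using w(1) w(2)[OF pq(2,3)] by (simp add: pq(1) hyperplane_transpose)
    qed
    then have "w \<in> L" using S(2) w(1) by blast
    then show ?thesis using v(2) by blast
  qed
  have zero: "v c = 0"
    if abc: "a \<in> ?I" "b \<in> ?I" "c \<in> ?I" "v a \<noteq> v b" "v b \<noteq> v c" "v a \<noteq> v c" for a b c
  proof -
    let ?A = "{k \<in> ?I. v k = v a}" and ?B = "{k \<in> ?I. v k = v b}"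
    define \<alpha> where "\<alpha> = inverse (of_nat (card ?A) :: 'k)"
    define \<beta> where "\<beta> = - inverse (of_nat (card ?B) :: 'k)"
    have "card ?A \<noteq> 0" "card ?B \<noteq> 0" using abc by auto
    then have \<alpha>: "of_nat (card ?A) * \<alpha> = 1" "\<alpha> \<noteq> 0" and \<beta>: "of_nat (card ?B) * \<beta> = - 1"
      by (simp_all add: \<alpha>_def \<beta>_def)
    define w where "w k = (if k \<in> ?A then \<alpha> else 0) + (if k \<in> ?B then \<beta> else 0)" for k
    have "(\<Sum>k\<in>?I. w k) = 0"
    proof -
      have "(\<Sum>k\<in>?I. w k) = (\<Sum>k\<in>?A. \<alpha>) + (\<Sum>k\<in>?B. \<beta>)"
        unfolding w_def sum.distrib by (intro arg_cong2[of _ _ _ _ "(+)"] sum.mono_neutral_cong_right) auto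
      then show ?thesis using \<alpha> \<beta> by simp
    qed
    then have "w \<in> geom_rep n" unfolding geom_rep_def by (auto simp: w_def)
    then obtain e where e: "w = (\<lambda>i. e * v i)" using inL[of w] by (auto simp: w_def)
    have "w a = \<alpha>" using abc by (simp add: w_def)
    then have "e \<noteq> 0" using \<alpha> e by auto
    moreover have "w c = 0" using abc by (simp add: w_def)
    ultimately show ?thesis using e by auto
  qed
  have "two_valued n v"
    unfolding two_valued_def
  proof (intro ballI)
    fix a b c assume "a \<in> ?I" "b \<in> ?I" "c \<in> ?I"
    then show "v a = v b \<or> v b = v c \<or> v a = v c"
      using zero[of a b c] zero[of c b a] by metis
  qed
  then show "two_valued n x" using x v(2) two_valued_scale by blast
qed

text \<open>
  The transpositions that fix \<open>x\<close> cut out the vectors that are constant on the two level sets of \<open>x\<close>,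
  and coordinate sum \<open>0\<close> leaves one parameter.
\<close>

lemma two_valued_weyl_line:
  fixes x :: "('k::field_char_0) vec"
  assumes x: "x \<in> geom_rep n" "two_valued n x" "x \<noteq> (\<lambda>_. 0)"
  shows "{\<lambda>i. c * x i | c. True} \<in> weyl_lines n"
proof -
  let ?I = "{1..n+1}"
  let ?S = "{Transposition.transpose p q | p q. p \<in> ?I \<and> q \<in> ?I \<and> p \<noteq> q \<and> x p = x q}"
  obtain a where a: "a \<in> ?I" "x a \<noteq> 0" using geom_rep_nonzero[OF x(1,3)] by blast
  have "geom_rep n \<inter> (\<Inter>t\<in>?S. hyperplane n t) = {\<lambda>i. c * x i | c. True}"
  proof
    show "{\<lambda>i. c * x i | c. True} \<subseteq> geom_rep n \<inter> (\<Inter>t\<in>?S. hyperplane n t)"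
      using geom_rep_scale[OF x(1)] by (auto simp: hyperplane_transpose)
    show "geom_rep n \<inter> (\<Inter>t\<in>?S. hyperplane n t) \<subseteq> {\<lambda>i. c * x i | c. True}"
    proof
      fix y :: "'k vec" assume y: "y \<in> geom_rep n \<inter> (\<Inter>t\<in>?S. hyperplane n t)"
      have y_const: "y p = y q" if "p \<in> ?I" "q \<in> ?I" "x p = x q" for p q
      proof (cases "p = q")
        case False
        then have "Transposition.transpose p q \<in> ?S" using that by blast
        then have "y \<in> hyperplane n (Transposition.transpose p q)" using y by blast
        then show ?thesis by (simp add: hyperplane_transpose)
      qed simp
      define w where "w k = y k - y a / x a * x k" for k
      have w_const: "w p = w q" if "p \<in> ?I" "q \<in> ?I" "x p = x q" for p q
        using y_const[OF that] that by (simp add: w_def)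
      have wa: "w a = 0" using a by (simp add: w_def)
      have "(\<Sum>k\<in>?I. w k) = sum y ?I - y a / x a * sum x ?I"
        unfolding w_def sum_subtractf sum_distrib_left ..
      then have "(\<Sum>k\<in>?I. w k) = 0"
        using y x(1) by (simp only: Int_iff geom_rep_iff) simp
      moreover have "w p = w q" if "p \<in> ?I" "q \<in> ?I" "x p \<noteq> x a" "x q \<noteq> x a" for p q
        using w_const[of p q] x(2) that a(1) unfolding two_valued_def by metis
      moreover have "w p = 0" if "p \<in> ?I" "x p = x a" for p
        using w_const[OF that(1) a(1) that(2)] wa by simp
      ultimately have w0: "w p = 0" if p: "p \<in> ?I" for p
      proof (cases "x p = x a")
        case False
        let ?B = "{k \<in> ?I. x k \<noteq> x a}"
        have "(\<Sum>k\<in>?I. w k) = (\<Sum>k\<in>?B. w k)"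
          by (rule sum.mono_neutral_right) (use \<open>\<And>p. p \<in> ?I \<Longrightarrow> x p = x a \<Longrightarrow> w p = 0\<close> in auto)
        also have "\<dots> = (\<Sum>k\<in>?B. w p)"
          by (rule sum.cong[OF refl])
            (use \<open>\<And>p q. p \<in> ?I \<Longrightarrow> q \<in> ?I \<Longrightarrow> x p \<noteq> x a \<Longrightarrow> x q \<noteq> x a \<Longrightarrow> w p = w q\<close> p False in blast)
        also have "\<dots> = of_nat (card ?B) * w p" by (rule sum_constant)
        finally have "of_nat (card ?B) * w p = 0" using \<open>(\<Sum>k\<in>?I. w k) = 0\<close> by simp
        moreover have "card ?B \<noteq> 0" using p False by auto
        ultimately show ?thesis by (metis mult_eq_0_iff of_nat_eq_0_iff)
      qed (use \<open>\<And>p. p \<in> ?I \<Longrightarrow> x p = x a \<Longrightarrow> w p = 0\<close> p in blast)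
      have "y k = y a / x a * x k" for k
      proof (cases "k \<in> ?I")
        case True
        then show ?thesis using w0[OF True] by (simp add: w_def)
      next
        case False
        then show ?thesis using y x(1) unfolding geom_rep_def by auto
      qed
      then show "y \<in> {\<lambda>i. c * x i | c. True}" by blast
    qed
  qed
  then have eq: "{\<lambda>i. c * x i | c. True} = geom_rep n \<inter> (\<Inter>t\<in>?S. hyperplane n t)" by (rule sym)
  have "?S \<subseteq> reflections n" unfolding reflections_def by blast
  then show ?thesis unfolding weyl_lines_def
    by (intro CollectI conjI exI[of _ ?S] exI[of _ x] eq x(3) refl)
qed

lemma two_valued_vector:
  assumes A: "A \<subseteq> {1..n+1}" and a: "a \<in> A" "b \<in> {1..n+1} - A"
  shows "\<exists>x \<in> geom_rep n. two_valued n (x :: ('k::field_char_0) vec) \<and> x \<noteq> (\<lambda>_. 0) \<and>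
    (\<forall>p\<in>A. \<forall>q\<in>{1..n+1} - A. x p \<noteq> x q)"
proof -
  let ?I = "{1..n+1}"
  define u :: 'k where "u = of_nat (card (?I - A))"
  define v :: 'k where "v = of_nat (card A)"
  define x where "x k = (if k \<in> A then u else if k \<in> ?I then - v else 0)" for k
  have fin: "finite A" using A finite_subset by blast
  have "u + v = of_nat (card (?I - A) + card A)" by (simp add: u_def v_def)
  moreover have "card A \<noteq> 0" using a fin by auto
  ultimately have "u + v \<noteq> 0" by (simp only: of_nat_eq_0_iff add_is_0 simp_thms)
  then have uv: "u \<noteq> - v" by (metis add.left_inverse)
  have "(\<Sum>k\<in>?I. x k) = (\<Sum>k\<in>A. x k) + (\<Sum>k\<in>?I - A. x k)"
    using A by (metis finite_atLeastAtMost sum.subset_diff add.commute)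
  also have "\<dots> = v * u + u * (- v)" by (simp add: x_def u_def v_def)
  finally have "x \<in> geom_rep n" using A unfolding geom_rep_def by (auto simp: x_def)
  moreover have "two_valued n x" unfolding two_valued_def by (auto simp: x_def)
  moreover have "\<forall>p\<in>A. \<forall>q\<in>?I - A. x p \<noteq> x q" using uv by (auto simp: x_def)
  moreover from this have "x a \<noteq> x b" using a by blast
  then have "x \<noteq> (\<lambda>_. 0)" by auto
  ultimately show ?thesis by blast
qed

lemma weyl_union_eq:
  assumes "n \<ge> 1"
  shows "weyl_union n = {x \<in> geom_rep n. two_valued n (x :: ('k::field_char_0) vec)}" (is "?L = ?R")
proof
  show "?L \<subseteq> ?R"
    unfolding weyl_union_def using weyl_line_two_valued by blast
  have line: "x \<in> weyl_union n" if "x \<in> geom_rep n" "two_valued n x" "x \<noteq> (\<lambda>_. 0)" for x :: "'k vec"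
  proof -
    have "x \<in> {\<lambda>i. c * x i | c. True}" by (rule CollectI, rule exI[of _ 1]) simp
    then show ?thesis unfolding weyl_union_def by (rule UnionI[OF two_valued_weyl_line[OF that]])
  qed
  obtain x :: "'k vec" where x: "x \<in> geom_rep n" "two_valued n x" "x \<noteq> (\<lambda>_. 0)"
    using two_valued_vector[of "{1}" n 1 2] assms by auto
  have "(\<lambda>_. 0) \<in> {\<lambda>i. c * x i | c. True}" by (rule CollectI, rule exI[of _ 0]) simp
  then have "(\<lambda>_. 0 :: 'k) \<in> weyl_union n"
    unfolding weyl_union_def by (rule UnionI[OF two_valued_weyl_line[OF x]])
  then show "?R \<subseteq> ?L" using line by blast
qed

lemma transverse_union_eq:
  assumes ab: "a \<in> {1..n+1}" "b \<in> {1..n+1}" "a \<noteq> b"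
  shows "transverse_union n (Transposition.transpose a b) = (separated n a b :: ('k::field_char_0) vec set)" (is "?L = ?R")
proof
  show "?L \<subseteq> ?R"
  proof
    fix x :: "'k vec" assume "x \<in> transverse_union n (Transposition.transpose a b)"
    then obtain L where L: "L \<in> weyl_lines n" "\<not> L \<subseteq> hyperplane n (Transposition.transpose a b)" "x \<in> L"
      unfolding transverse_union_def by blast
    obtain v where v: "L = {\<lambda>i. c * v i | c. True}" using L(1) unfolding weyl_lines_def by blast
    obtain y where "y \<in> L" "y a \<noteq> y b"
      using L(2) weyl_line_two_valued(1)[OF L(1)] by (auto simp: hyperplane_transpose)
    then have "v a \<noteq> v b" using v by auto
    then have "x = (\<lambda>_. 0) \<or> x a \<noteq> x b" using L(3) v by auto
    then show "x \<in> ?R"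
      using weyl_line_two_valued[OF L(1,3)] unfolding separated_def by blast
  qed
  have line: "(\<lambda>i. c * x i) \<in> transverse_union n (Transposition.transpose a b)"
    if "x \<in> geom_rep n" "two_valued n x" "x a \<noteq> x b" for x and c :: 'k
  proof -
    let ?L = "{\<lambda>i. c * x i | c. True}"
    have L: "?L \<in> weyl_lines n" by (rule two_valued_weyl_line) (use that in auto)
    have "(\<lambda>i. 1 * x i) \<in> ?L" "(\<lambda>i. c * x i) \<in> ?L" by blast+
    moreover have "(\<lambda>i. 1 * x i) \<notin> hyperplane n (Transposition.transpose a b)"
      using that by (simp add: hyperplane_transpose)
    ultimately show ?thesis using L unfolding transverse_union_def by blast
  qed
  obtain x :: "'k vec" where "x \<in> geom_rep n" "two_valued n x"
      "\<forall>p\<in>{a}. \<forall>q\<in>{1..n+1} - {a}. x p \<noteq> x q"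
    using two_valued_vector[of "{a}" n a b] ab by blast
  moreover from this(3) have "x a \<noteq> x b" using ab by blast
  ultimately have "(\<lambda>_. 0 :: 'k) \<in> transverse_union n (Transposition.transpose a b)"
    using line[of x 0] by simp
  moreover have "x \<in> transverse_union n (Transposition.transpose a b)"
    if "x \<in> geom_rep n" "two_valued n x" "x a \<noteq> x b" for x :: "'k vec"
    using line[OF that, of 1] by simp
  ultimately show "?R \<subseteq> ?L"
    unfolding separated_def by blast
qed

subsection \<open>Exchanging two coordinates\<close>

definition exch :: "nat \<Rightarrow> nat \<Rightarrow> 'k vec \<Rightarrow> 'k vec" where
  "exch a b x = (\<lambda>k. if k = a then x b else if k = b then x a else x k)"

lemma exch_comp: "exch a b x = x \<circ> Transposition.transpose a b"
  by (auto simp: exch_def fun_eq_iff Transposition.transpose_def)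

lemma act_eq_exch: "act (Transposition.transpose a b) = exch a b"
  by (rule ext) (simp add: act_transpose exch_comp)

lemma exch_involutive [simp]: "exch a b (exch a b x) = x"
  by (auto simp: exch_def)

lemma exch_sum:
  assumes "a \<in> I" "b \<in> I"
  shows "sum (exch a b x) I = sum x I"
proof -
  have "bij_betw (Transposition.transpose a b) I I" using assms by simp
  from sum.reindex_bij_betw[OF this, of x] show ?thesis by (simp add: exch_comp o_def)
qed

lemma exch_geom_rep:
  "a \<in> {1..n+1} \<Longrightarrow> b \<in> {1..n+1} \<Longrightarrow> x \<in> geom_rep n \<Longrightarrow> exch a b x \<in> geom_rep n"
  unfolding geom_rep_iff by (simp only: exch_sum) (auto simp: exch_def)

lemma exch_two_valued:
  assumes ab: "a \<in> {1..n+1}" "b \<in> {1..n+1}" and x: "two_valued n x"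
  shows "two_valued n (exch a b x)"
  unfolding two_valued_def
proof (intro ballI)
  fix p q r assume "p \<in> {1..n+1}" "q \<in> {1..n+1}" "r \<in> {1..n+1}"
  then have "Transposition.transpose a b p \<in> {1..n+1}" "Transposition.transpose a b q \<in> {1..n+1}"
    "Transposition.transpose a b r \<in> {1..n+1}"
    using ab by (simp_all add: Transposition.transpose_def)
  then show "exch a b x p = exch a b x q \<or> exch a b x q = exch a b x r \<or> exch a b x p = exch a b x r"
    using x unfolding two_valued_def exch_comp o_def by blast
qed

lemma exch_zero [simp]: "exch a b (\<lambda>_. 0) = (\<lambda>_. 0)"
  by (auto simp: exch_def)

lemma exch_scale: "exch a b (\<lambda>i. c * x i) = (\<lambda>i. c * exch a b x i)"
  by (auto simp: exch_def)

lemma exch_separated: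
  assumes "a \<in> {1..n+1}" "b \<in> {1..n+1}" "x \<in> separated n c d"
    and "{c, d} = {a, b} \<or> {c, d} \<inter> {a, b} = {}"
  shows "exch a b x \<in> separated n c d"
proof -
  have "x = (\<lambda>_. 0) \<or> exch a b x c \<noteq> exch a b x d"
    using assms(3,4) unfolding separated_def by (auto simp: exch_def doubleton_eq_iff)
  moreover have "x \<in> geom_rep n" "two_valued n x" using assms(3) unfolding separated_def by blast+
  then have "exch a b x \<in> geom_rep n" "two_valued n (exch a b x)"
    using exch_geom_rep[OF assms(1,2)] exch_two_valued[OF assms(1,2)] by blast+
  ultimately show ?thesis unfolding separated_def by (auto simp only: mem_Collect_eq exch_zero)
qed

lemma separated_scale: "x \<in> separated n a b \<Longrightarrow> (\<lambda>i. c * x i) \<in> separated n a b"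
  unfolding separated_def using geom_rep_scale[of x n c] two_valued_scale[of n x c]
  by (auto simp: fun_eq_iff)

lemma separated_in_weyl_union: "n \<ge> 1 \<Longrightarrow> separated n a b \<subseteq> weyl_union n"
  by (auto simp: weyl_union_eq separated_def)

lemma restrict_in_weyl_ring:
  "poly_on n {\<lambda>x. x} f \<Longrightarrow> restrict f (weyl_union n) \<in> carrier (weyl_ring n)"
  unfolding weyl_ring_def by (rule restrict_in_reg_ring) simp_all

lemma fun_ring_weyl_ring: "fun_ring n (weyl_ring n) (weyl_union n)"
  unfolding weyl_ring_def by (rule fun_ring_reg_ring)

text \<open>
  On vectors whose coordinates \<open>a\<close>, \<open>b\<close> differ, each coordinate \<open>c\<close> equals one of these two, so
  that \<open>(x\<^sub>a - x\<^sub>c) (x\<^sub>b - x\<^sub>c)\<close> vanishes; these functions cut out the vectors in question.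
\<close>

lemma separated_closed:
  fixes z :: "('k::field_char_0) vec"
  assumes n: "n \<ge> 1" and ab: "a \<in> {1..n+1}" "b \<in> {1..n+1}"
    and z: "z \<in> weyl_union n"
    and van: "\<And>f. f \<in> carrier (weyl_ring n) \<Longrightarrow> \<forall>x\<in>separated n a b. f x = 0 \<Longrightarrow> f z = 0"
  shows "z \<in> separated n a b"
proof (rule ccontr)
  assume "z \<notin> separated n a b"
  then have z': "z \<in> geom_rep n" "z \<noteq> (\<lambda>_. 0)" "z a = z b"
    using z n unfolding separated_def weyl_union_eq[OF n] by auto
  have "\<exists>c\<in>{1..n+1}. z c \<noteq> z a"
  proof (rule ccontr)
    assume "\<not> ?thesis"
    then have eq: "\<And>c. c \<in> {1..n+1} \<Longrightarrow> z c = z a" by blast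
    then have "sum z {1..n+1} = (\<Sum>c\<in>{1..n+1}. z a)" by (rule sum.cong[OF refl])
    also have "\<dots> = of_nat (Suc n) * z a" by simp
    finally have "of_nat (Suc n) * z a = 0" using z'(1) unfolding geom_rep_iff by simp
    then have "z a = 0" by (metis mult_eq_0_iff of_nat_eq_0_iff nat.distinct(1))
    then show False using eq geom_rep_nonzero[OF z'(1,2)] by auto
  qed
  then obtain c where c: "c \<in> {1..n+1}" "z c \<noteq> z a" by blast
  let ?f = "\<lambda>x :: 'k vec. (x a - x c) * (x b - x c)"
  have "restrict ?f (weyl_union n) \<in> carrier (weyl_ring n)"
    by (intro restrict_in_weyl_ring poly_on.mult poly_on_minus coord_poly_on ab c)
  moreover have "restrict ?f (weyl_union n) x = 0" if x: "x \<in> separated n a b" for x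
  proof -
    have "x \<in> weyl_union n" using separated_in_weyl_union[OF n] x by blast
    moreover have "x c = x a \<or> x c = x b \<or> x a = x b"
      using x ab c unfolding separated_def two_valued_def by blast
    ultimately show ?thesis using x unfolding separated_def by auto
  qed
  ultimately have "restrict ?f (weyl_union n) z = 0" using van by blast
  then show False using z z'(3) c(2) by simp
qed

lemma left_support_fun_bimod:
  assumes n: "n \<ge> 1" and ab: "a \<in> {1..n+1}" "b \<in> {1..n+1}" and l: "l ` P = separated n a b"
  shows "left_support n (fun_bimod n W P l r) = separated n a b"
proof -
  have "(\<forall>m\<in>carrier (fun_bimod n W P l r). f \<odot>\<^bsub>fun_bimod n W P l r\<^esub> m = \<zero>\<^bsub>fun_bimod n W P l r\<^esub>)
      \<longleftrightarrow> (\<forall>x\<in>separated n a b. f x = 0)" for f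
  proof
    assume *: "\<forall>m\<in>carrier (fun_bimod n W P l r). f \<odot>\<^bsub>fun_bimod n W P l r\<^esub> m = \<zero>\<^bsub>fun_bimod n W P l r\<^esub>"
    have "(\<lambda>p\<in>P. 1) \<in> carrier (fun_bimod n W P l r)" by (rule fun_bimodI[OF poly_on.const]) simp
    from bspec[OF * this] show "\<forall>x\<in>separated n a b. f x = 0"
      by (simp add: restrict_eq_iff flip: l)
  qed (auto simp: restrict_eq_iff simp flip: l)
  then show ?thesis
    using separated_closed[OF n ab] separated_in_weyl_union[OF n] unfolding left_support_def by blast
qed

lemma right_support_fun_bimod:
  assumes n: "n \<ge> 1" and ab: "a \<in> {1..n+1}" "b \<in> {1..n+1}" and r: "r ` P = separated n a b"
  shows "right_support n (fun_bimod n W P l r) = separated n a b"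
proof -
  have "(\<forall>m\<in>carrier (fun_bimod n W P l r). rsmult (fun_bimod n W P l r) m f = \<zero>\<^bsub>fun_bimod n W P l r\<^esub>)
      \<longleftrightarrow> (\<forall>x\<in>separated n a b. f x = 0)" for f
  proof
    assume *: "\<forall>m\<in>carrier (fun_bimod n W P l r). rsmult (fun_bimod n W P l r) m f = \<zero>\<^bsub>fun_bimod n W P l r\<^esub>"
    have "(\<lambda>p\<in>P. 1) \<in> carrier (fun_bimod n W P l r)" by (rule fun_bimodI[OF poly_on.const]) simp
    from bspec[OF * this] show "\<forall>x\<in>separated n a b. f x = 0"
      by (simp add: restrict_eq_iff flip: r)
  qed (auto simp: restrict_eq_iff simp flip: r)
  then show ?thesis
    using separated_closed[OF n ab] separated_in_weyl_union[OF n] unfolding right_support_def by blast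
qed

section \<open>The bimodule of a reflection\<close>

lemma bexI2: "P x y \<Longrightarrow> x \<in> A \<Longrightarrow> y \<in> B \<Longrightarrow> \<exists>x\<in>A. \<exists>y\<in>B. P x y"
  by blast

lemma exI2: "P x y \<Longrightarrow> \<exists>x y. P x y"
  by blast

text \<open>
  The symmetric and the antisymmetric part of \<open>f\<close>, the latter divided by the root \<open>x\<^sub>a - x\<^sub>b\<close>.
  Induction on \<open>f\<close> avoids the division, since the square of the root is invariant.
\<close>

lemma invariant_decomposition:
  fixes f :: "('k::field_char_0) vec \<Rightarrow> 'k"
  assumes f: "poly_on n {\<lambda>x. x} f" and ab: "a \<in> {1..n+1}" "b \<in> {1..n+1}"
  shows "\<exists>g h. poly_on n {\<lambda>x. x} g \<and> poly_on n {\<lambda>x. x} h \<and> (\<forall>x. g (exch a b x) = g x) \<and>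
    (\<forall>x. h (exch a b x) = h x) \<and> (\<forall>x. f x = g x + h x * (x a - x b))"
  using f
proof (induction rule: poly_on.induct)
  case (const c)
  show ?case
    by (intro exI2[of _ "\<lambda>x. c" "\<lambda>x. 0"]) (simp add: poly_on.const)
next
  case (coord v i)
  then have v: "v = (\<lambda>x. x)" and i: "i \<in> {1..n+1}" by simp_all
  let ?g = "\<lambda>x :: 'k vec. 1 / 2 * (x a + x b)"
  have g: "poly_on n {\<lambda>x. x} ?g" by (intro poly_on.mult poly_on.add poly_on.const coord_poly_on ab)
  have half: "u = 1 / 2 * (u + w) + 1 / 2 * (u - w)" "w = 1 / 2 * (u + w) + - (1 / 2) * (u - w)" for u w :: 'k
    by (simp_all add: field_simps)
  consider "i = a" | "i = b" "i \<noteq> a" | "i \<noteq> a" "i \<noteq> b" by blast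
  then show ?case
  proof cases
    case 1
    show ?thesis unfolding v \<open>i = a\<close>
      by (intro exI2[of _ ?g "\<lambda>x. 1 / 2"] conjI allI g poly_on.const half(1)) (simp_all add: exch_def add.commute)
  next
    case 2
    show ?thesis unfolding v \<open>i = b\<close>
      by (intro exI2[of _ ?g "\<lambda>x. - (1 / 2)"] conjI allI g poly_on.const half(2)) (simp_all add: exch_def add.commute)
  next
    case 3
    then show ?thesis unfolding v using coord_poly_on[OF i]
      by (intro exI2[of _ "\<lambda>x. x i" "\<lambda>x. 0"]) (simp add: poly_on.const exch_def)
  qed
next
  case (add f f')
  then obtain g h g' h' where *: "poly_on n {\<lambda>x. x} g" "poly_on n {\<lambda>x. x} h" "poly_on n {\<lambda>x. x} g'" "poly_on n {\<lambda>x. x} h'"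
    "\<forall>x. g (exch a b x) = g x" "\<forall>x. h (exch a b x) = h x" "\<forall>x. g' (exch a b x) = g' x" "\<forall>x. h' (exch a b x) = h' x"
    "\<forall>x. f x = g x + h x * (x a - x b)" "\<forall>x. f' x = g' x + h' x * (x a - x b)"
    by (elim exE conjE)
  show ?case
    by (intro exI2[of _ "\<lambda>x. g x + g' x" "\<lambda>x. h x + h' x"])
      (simp add: * poly_on.add algebra_simps)
next
  case (mult f f')
  then obtain g h g' h' where *: "poly_on n {\<lambda>x. x} g" "poly_on n {\<lambda>x. x} h" "poly_on n {\<lambda>x. x} g'" "poly_on n {\<lambda>x. x} h'"
    "\<forall>x. g (exch a b x) = g x" "\<forall>x. h (exch a b x) = h x" "\<forall>x. g' (exch a b x) = g' x" "\<forall>x. h' (exch a b x) = h' x"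
    "\<forall>x. f x = g x + h x * (x a - x b)" "\<forall>x. f' x = g' x + h' x * (x a - x b)"
    by (elim exE conjE)
  have sq: "poly_on n {\<lambda>x. x} (\<lambda>x :: 'k vec. (x a - x b) * (x a - x b))"
    by (intro poly_on.mult poly_on_minus coord_poly_on ab)
  have sq': "(exch a b x a - exch a b x b) * (exch a b x a - exch a b x b) = (x a - x b) * (x a - x b)" for x :: "'k vec"
    by (simp add: exch_def algebra_simps)
  show ?case
  proof (intro exI conjI allI)
    show "poly_on n {\<lambda>x. x} (\<lambda>x. g x * g' x + h x * h' x * ((x a - x b) * (x a - x b)))"
      by (intro poly_on.add poly_on.mult * sq)
    show "poly_on n {\<lambda>x. x} (\<lambda>x. g x * h' x + h x * g' x)"
      by (intro poly_on.add poly_on.mult *)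
  qed (simp_all only: * sq', simp add: algebra_simps)
qed

text \<open>
  If the vector \<open>u p\<close> is \<open>\<rho> (\<tau> p)\<close> up to exchange of the coordinates \<open>a\<close> and \<open>b\<close>, then its other coordinates,
  the sum of these two and the square of their difference are functions of \<open>\<tau> p\<close>.  The lemma
  provides generators \<open>1\<close> and \<open>u\<^sub>a - u\<^sub>b\<close> over functions of the left end of a point, of its right end, or of
  both ends of a triple.
\<close>

lemma homog_decomposition:
  fixes g :: "'p \<Rightarrow> 'k::field_char_0" and \<tau> :: "'p \<Rightarrow> 'q"
  assumes g: "homog_on n W d g" and ab: "a \<in> {1..n+1}" "b \<in> {1..n+1}"
    and other: "\<And>w i. w \<in> W \<Longrightarrow> w \<noteq> u \<Longrightarrow> i \<in> {1..n+1} \<Longrightarrow> \<exists>c. homog_on n W0 2 c \<and> (\<forall>p\<in>P. w p i = c (\<tau> p))"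
    and \<rho>: "\<And>i. i \<in> {1..n+1} \<Longrightarrow> homog_on n W0 2 (\<lambda>q. \<rho> q i)"
    and u: "\<And>p. p \<in> P \<Longrightarrow> u p = \<rho> (\<tau> p) \<or> u p = exch a b (\<rho> (\<tau> p))"
  shows "\<exists>s1 s2. homog_on n W0 d s1 \<and> homog_on n W0 (d - 2) s2 \<and>
    (\<forall>p\<in>P. g p = s1 (\<tau> p) + (u p a - u p b) * s2 (\<tau> p))"
  using g
proof (induction rule: homog_on.induct)
  case (zero e)
  show ?case by (intro exI2[of _ "\<lambda>q. 0" "\<lambda>q. 0"]) (simp add: homog_on.zero)
next
  case (const c)
  show ?case by (intro exI2[of _ "\<lambda>q. c" "\<lambda>q. 0"]) (simp add: homog_on.zero homog_on.const)
next
  case (coord w i)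
  show ?case
  proof (cases "w = u")
    case False
    obtain c where "homog_on n W0 2 c" "\<forall>p\<in>P. w p i = c (\<tau> p)" using other[OF coord(1) False coord(2)] by blast
    then show ?thesis by (intro exI2[of _ c "\<lambda>q. 0"]) (simp add: homog_on.zero)
  next
    case True
    let ?h = "\<lambda>q. 1 / 2 * (\<rho> q a + \<rho> q b)"
    have h: "homog_on n W0 2 ?h" by (intro homog_on_cmult homog_on.add \<rho> ab)
    have half: "x = 1 / 2 * (x + y) + (x - y) * (1 / 2)" "y = 1 / 2 * (x + y) + (x - y) * (- 1 / 2)" for x y :: 'k
      by (simp_all add: field_simps)
    have c: "homog_on n W0 (2 - 2) (\<lambda>q. c)" for c using homog_on.const[of n W0 c] by simp
    have sum: "\<rho> (\<tau> p) a + \<rho> (\<tau> p) b = u p a + u p b" if "p \<in> P" for p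
      using u[OF that] by (auto simp: exch_def)
    consider "i = a" | "i = b" | "i \<noteq> a" "i \<noteq> b" by blast
    then show ?thesis
    proof cases
      case 1
      show ?thesis unfolding True 1
        by (intro exI2[of _ ?h "\<lambda>q. 1 / 2"] conjI h c ballI) (simp only: sum half(1)[symmetric])
    next
      case 2
      show ?thesis unfolding True 2
        by (intro exI2[of _ ?h "\<lambda>q. - 1 / 2"] conjI h c ballI) (simp only: sum half(2)[symmetric])
    next
      case 3
      have "u p i = \<rho> (\<tau> p) i" if "p \<in> P" for p using u[OF that] 3 by (auto simp: exch_def)
      then show ?thesis using \<rho>[OF coord(2)] True
        by (intro exI2[of _ "\<lambda>q. \<rho> q i" "\<lambda>q. 0"]) (simp add: homog_on.zero)
    qed
  qed
next
  case (add d f f')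
  then obtain s1 s2 s1' s2' where *: "homog_on n W0 d s1" "homog_on n W0 (d - 2) s2" "homog_on n W0 d s1'" "homog_on n W0 (d - 2) s2'"
    "\<forall>p\<in>P. f p = s1 (\<tau> p) + (u p a - u p b) * s2 (\<tau> p)" "\<forall>p\<in>P. f' p = s1' (\<tau> p) + (u p a - u p b) * s2' (\<tau> p)"
    by (elim exE conjE)
  have "f p + f' p = (s1 (\<tau> p) + s1' (\<tau> p)) + (u p a - u p b) * (s2 (\<tau> p) + s2' (\<tau> p))" if "p \<in> P" for p
    unfolding bspec[OF *(5) that] bspec[OF *(6) that] by (simp add: algebra_simps)
  then show ?case
    by (intro exI2[of _ "\<lambda>q. s1 q + s1' q" "\<lambda>q. s2 q + s2' q"] conjI ballI homog_on.add *)
next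
  case (mult d f e f')
  then obtain s1 s2 s1' s2' where *: "homog_on n W0 d s1" "homog_on n W0 (d - 2) s2" "homog_on n W0 e s1'" "homog_on n W0 (e - 2) s2'"
    and eq: "\<forall>p\<in>P. f p = s1 (\<tau> p) + (u p a - u p b) * s2 (\<tau> p)" "\<forall>p\<in>P. f' p = s1' (\<tau> p) + (u p a - u p b) * s2' (\<tau> p)"
    by (elim exE conjE)
  let ?q = "\<lambda>q. (\<rho> q a - \<rho> q b) * (\<rho> q a - \<rho> q b)"
  have sq: "(u p a - u p b) * (u p a - u p b) = ?q (\<tau> p)" if "p \<in> P" for p
    using u[OF that] by (auto simp: exch_def algebra_simps)
  have "homog_on n W0 ((d - 2 + (e - 2)) + (2 + 2)) (\<lambda>q. s2 q * s2' q * ?q q)"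
    by (intro homog_on.mult homog_on_minus \<rho> ab *)
  moreover have "(d - 2 + (e - 2)) + (2 + 2) = d + e" by simp
  ultimately have "homog_on n W0 (d + e) (\<lambda>q. s2 q * s2' q * ?q q)" by (simp only:)
  then have 1: "homog_on n W0 (d + e) (\<lambda>q. s1 q * s1' q + s2 q * s2' q * ?q q)"
    by (rule homog_on.add[OF homog_on.mult[OF *(1,3)]])
  have "homog_on n W0 (d + e - 2) (\<lambda>q. s1 q * s2' q)" "homog_on n W0 (d + e - 2) (\<lambda>q. s2 q * s1' q)"
    using homog_on.mult[OF *(1,4)] homog_on.mult[OF *(2,3)] by (simp_all add: algebra_simps)
  then have 2: "homog_on n W0 (d + e - 2) (\<lambda>q. s1 q * s2' q + s2 q * s1' q)"
    by (rule homog_on.add)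
  have 3: "f p * f' p = (s1 (\<tau> p) * s1' (\<tau> p) + s2 (\<tau> p) * s2' (\<tau> p) * ?q (\<tau> p)) +
      (u p a - u p b) * (s1 (\<tau> p) * s2' (\<tau> p) + s2 (\<tau> p) * s1' (\<tau> p))" if p: "p \<in> P" for p
    unfolding sq[OF p, symmetric] bspec[OF eq(1) p] bspec[OF eq(2) p] by (simp add: algebra_simps)
  show ?case using 1 2 3 by (intro exI conjI ballI)
qed

lemma poly_decomposition:
  fixes g :: "'p \<Rightarrow> 'k::field_char_0" and \<tau> :: "'p \<Rightarrow> 'q"
  assumes g: "poly_on n W g" and ab: "a \<in> {1..n+1}" "b \<in> {1..n+1}"
    and other: "\<And>w i. w \<in> W \<Longrightarrow> w \<noteq> u \<Longrightarrow> i \<in> {1..n+1} \<Longrightarrow> \<exists>c. homog_on n W0 2 c \<and> (\<forall>p\<in>P. w p i = c (\<tau> p))"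
    and \<rho>: "\<And>i. i \<in> {1..n+1} \<Longrightarrow> homog_on n W0 2 (\<lambda>q. \<rho> q i)"
    and u: "\<And>p. p \<in> P \<Longrightarrow> u p = \<rho> (\<tau> p) \<or> u p = exch a b (\<rho> (\<tau> p))"
  shows "\<exists>s1 s2. poly_on n W0 s1 \<and> poly_on n W0 s2 \<and>
    (\<forall>p\<in>P. g p = s1 (\<tau> p) + (u p a - u p b) * s2 (\<tau> p))"
proof -
  obtain A c where A: "finite A" "\<forall>d. homog_on n W d (c d)" "g = (\<lambda>p. \<Sum>d\<in>A. c d p)"
    using poly_on_decomp[OF g] by blast
  have "\<forall>d. \<exists>s1 s2. homog_on n W0 d s1 \<and> homog_on n W0 (d - 2) s2 \<and>
    (\<forall>p\<in>P. c d p = s1 (\<tau> p) + (u p a - u p b) * s2 (\<tau> p))"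
  proof
    fix d
    show "\<exists>s1 s2. homog_on n W0 d s1 \<and> homog_on n W0 (d - 2) s2 \<and>
      (\<forall>p\<in>P. c d p = s1 (\<tau> p) + (u p a - u p b) * s2 (\<tau> p))"
      by (rule homog_decomposition[OF A(2)[rule_format] ab, where \<rho> = \<rho>]) (use other \<rho> u in blast)+
  qed
  then obtain s1 s2 where s: "\<And>d. homog_on n W0 d (s1 d)" "\<And>d. homog_on n W0 (d - 2) (s2 d)"
    "\<And>d p. p \<in> P \<Longrightarrow> c d p = s1 d (\<tau> p) + (u p a - u p b) * s2 d (\<tau> p)" by metis
  show ?thesis
  proof (intro exI conjI ballI)
    show "poly_on n W0 (\<lambda>q. \<Sum>d\<in>A. s1 d q)" "poly_on n W0 (\<lambda>q. \<Sum>d\<in>A. s2 d q)"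
      by (rule poly_on_sum[OF A(1) homog_on_imp_poly_on[OF s(1)]], rule poly_on_sum[OF A(1) homog_on_imp_poly_on[OF s(2)]])
    show "g p = (\<Sum>d\<in>A. s1 d (\<tau> p)) + (u p a - u p b) * (\<Sum>d\<in>A. s2 d (\<tau> p))" if "p \<in> P" for p
      unfolding A(3) s(3)[OF that] sum.distrib sum_distrib_left ..
  qed
qed

abbreviation pair_bimod ::
  "nat \<Rightarrow> (('k::field_char_0) vec \<times> 'k vec) set \<Rightarrow>
   ('k vec \<Rightarrow> 'k, 'k vec \<Rightarrow> 'k, 'k vec \<times> 'k vec \<Rightarrow> 'k) bimod" where
  "pair_bimod n P \<equiv> fun_bimod n {fst, snd} P fst snd"

definition scale_closed :: "(('k::field_char_0) vec \<times> 'k vec) set \<Rightarrow> bool" where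
  "scale_closed P \<longleftrightarrow> (\<forall>x y t. (x, y) \<in> P \<longrightarrow> ((\<lambda>i. t * x i), (\<lambda>i. t * y i)) \<in> P)"

definition refl_pairs :: "nat \<Rightarrow> nat \<Rightarrow> nat \<Rightarrow> (('k::field_char_0) vec \<times> 'k vec) set" where
  "refl_pairs n a b = {(x, y). x \<in> separated n a b \<and> (y = x \<or> y = exch a b x)}"

lemma nonzero_pair: "nonzero_pt n {fst, snd} p \<Longrightarrow> fst p \<noteq> (\<lambda>_. 0) \<or> snd p \<noteq> (\<lambda>_. 0)"
  by (auto simp: nonzero_pt_def)

lemma nonzero_vec: "nonzero_pt n {\<lambda>x. x} x \<Longrightarrow> x \<noteq> (\<lambda>_. 0)"
  by (auto simp: nonzero_pt_def)

lemma cone_pairs: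
  assumes "scale_closed P" "(x, y) \<in> P" "y \<in> geom_rep n" "y \<noteq> (\<lambda>_. 0)"
  shows "cone n {fst, snd} P"
  unfolding cone_def
proof
  show "\<forall>p\<in>P. \<forall>t. \<exists>q\<in>P. scaled n {fst, snd} t p q"
  proof clarify
    fix x y t assume "(x, y) \<in> P"
    then have "((\<lambda>i. t * x i), (\<lambda>i. t * y i)) \<in> P" using assms(1) unfolding scale_closed_def by blast
    then show "\<exists>q\<in>P. scaled n {fst, snd} t (x, y) q" by (rule bexI[rotated]) (simp add: scaled_def)
  qed
  have "nonzero_pt n {fst, snd} (x, y)"
    using geom_rep_nonzero[OF assms(3,4)] unfolding nonzero_pt_def by auto
  then show "\<exists>p\<in>P. nonzero_pt n {fst, snd} p" using assms(2) by blast
qed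

lemma cone_vecs:
  assumes "\<And>x t. x \<in> X \<Longrightarrow> (\<lambda>i. t * x i) \<in> X" "x \<in> X" "x \<in> geom_rep n" "x \<noteq> (\<lambda>_. 0)"
  shows "cone n {\<lambda>x. x} X"
  unfolding cone_def
proof
  show "\<forall>p\<in>X. \<forall>t. \<exists>q\<in>X. scaled n {\<lambda>x. x} t p q"
  proof (intro ballI allI)
    fix p t assume "p \<in> X"
    show "\<exists>q\<in>X. scaled n {\<lambda>x. x} t p q"
      by (rule bexI[OF _ assms(1)[OF \<open>p \<in> X\<close>, of t]]) (simp add: scaled_def)
  qed
  have "nonzero_pt n {\<lambda>x. x} x" using geom_rep_nonzero[OF assms(3,4)] unfolding nonzero_pt_def by auto
  then show "\<exists>p\<in>X. nonzero_pt n {\<lambda>x. x} p" using assms(2) by blast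
qed

lemma graded_pair_bimod:
  assumes n: "n \<ge> 1" and P: "cone n {fst, snd} P" and Z: "fst ` P \<subseteq> weyl_union n" "snd ` P \<subseteq> weyl_union n"
  shows "graded_bimodule (weyl_ring n) (weyl_ring n) (pair_bimod n P)"
  by (rule graded_bimodule_fun_bimod[OF fun_ring_weyl_ring fun_ring_weyl_ring P]) (use Z in auto)

lemma separated_nonzero:
  assumes "a \<in> {1..n+1}" "b \<in> {1..n+1}" "a \<noteq> b"
  shows "\<exists>x \<in> separated n a b. x \<noteq> (\<lambda>_. 0 :: 'k::field_char_0)"
proof -
  obtain x :: "'k vec" where x: "x \<in> geom_rep n" "two_valued n x" "x \<noteq> (\<lambda>_. 0)"
      "\<forall>p\<in>{a}. \<forall>q\<in>{1..n+1} - {a}. x p \<noteq> x q"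
    using two_valued_vector[of "{a}" n a b] assms by blast
  then have "x a \<noteq> x b" using assms by blast
  then show ?thesis using x unfolding separated_def by blast
qed

lemma cone_separated:
  assumes ab: "a \<in> {1..n+1}" "b \<in> {1..n+1}" "a \<noteq> b"
  shows "cone n {\<lambda>x. x} (separated n a b :: ('k::field_char_0) vec set)"
proof -
  obtain x :: "'k vec" where x: "x \<in> separated n a b" "x \<noteq> (\<lambda>_. 0)" using separated_nonzero[OF ab] by blast
  then have "x \<in> geom_rep n" unfolding separated_def by blast
  from cone_vecs[OF separated_scale x(1) this x(2)] show ?thesis .
qed

lemma separated_commute: "separated n a b = separated n b a"
  by (auto simp: separated_def)

lemma exch_commute: "exch a b = exch b a"
  by (auto simp: exch_def fun_eq_iff)

lemma refl_pairs_commute: "refl_pairs n a b = refl_pairs n b a"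
  by (simp only: refl_pairs_def separated_commute[of n a b] exch_commute[of a b])

lemma scale_closed_refl_pairs: "scale_closed (refl_pairs n a b)"
  unfolding scale_closed_def refl_pairs_def
  by (auto simp: exch_scale separated_scale)

lemma refl_pairsD:
  assumes ab: "a \<in> {1..n+1}" "b \<in> {1..n+1}" and p: "p \<in> refl_pairs n a b"
  shows "fst p \<in> separated n a b" "snd p \<in> separated n a b"
    "snd p = fst p \<or> snd p = exch a b (fst p)" "fst p = snd p \<or> fst p = exch a b (snd p)"
proof -
  have "exch a b x \<in> separated n a b" if "x \<in> separated n a b" for x
    by (rule exch_separated[OF ab that]) simp
  then show "fst p \<in> separated n a b" "snd p \<in> separated n a b"
    "snd p = fst p \<or> snd p = exch a b (fst p)" "fst p = snd p \<or> fst p = exch a b (snd p)"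
    using p unfolding refl_pairs_def by auto
qed

lemma image_refl_pairs:
  assumes ab: "a \<in> {1..n+1}" "b \<in> {1..n+1}"
  shows "fst ` refl_pairs n a b = separated n a b" "snd ` refl_pairs n a b = separated n a b"
proof -
  have diag: "(x, x) \<in> refl_pairs n a b" if "x \<in> separated n a b" for x
    using that unfolding refl_pairs_def by blast
  show "fst ` refl_pairs n a b = separated n a b" "snd ` refl_pairs n a b = separated n a b"
    using refl_pairsD(1,2)[OF ab] diag by force+
qed

lemma cone_refl_pairs:
  assumes ab: "a \<in> {1..n+1}" "b \<in> {1..n+1}" "a \<noteq> b"
  shows "cone n {fst, snd} (refl_pairs n a b :: (('k::field_char_0) vec \<times> 'k vec) set)"
proof -
  obtain x :: "'k vec" where x: "x \<in> separated n a b" "x \<noteq> (\<lambda>_. 0)" using separated_nonzero[OF ab] by blast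
  then have "x \<in> geom_rep n" "(x, x) \<in> refl_pairs n a b" unfolding separated_def refl_pairs_def by blast+
  from cone_pairs[OF scale_closed_refl_pairs this(2,1) x(2)] show ?thesis .
qed

lemma graded_refl_pairs:
  assumes n: "n \<ge> 1" and ab: "a \<in> {1..n+1}" "b \<in> {1..n+1}" "a \<noteq> b"
  shows "graded_bimodule (weyl_ring n) (weyl_ring n) (pair_bimod n (refl_pairs n a b))"
  by (rule graded_pair_bimod[OF n cone_refl_pairs[OF ab]])
    (simp_all add: image_refl_pairs[OF ab(1,2)] separated_in_weyl_union[OF n])

lemma refl_pairs_sep:
  assumes ab: "a \<in> {1..n+1}" "b \<in> {1..n+1}" and y: "y \<in> separated n a b" "y \<noteq> (\<lambda>_. 0)"
  shows "exch a b y \<in> separated n a b" "y a - y b \<noteq> exch a b y a - exch a b y b"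
proof -
  show "exch a b y \<in> separated n a b" by (rule exch_separated[OF ab y(1)]) simp
  have ne: "y a \<noteq> y b" using y unfolding separated_def by blast
  have "y a - y b \<noteq> y b - y a"
  proof
    assume "y a - y b = y b - y a"
    then have "2 * (y a - y b) = 0" by (simp add: algebra_simps)
    then show False using ne by simp
  qed
  then show "y a - y b \<noteq> exch a b y a - exch a b y b" by (auto simp: exch_def)
qed

lemma refl_pairs_zero:
  assumes "(x, y) \<in> refl_pairs n a b"
  shows "x = (\<lambda>_. 0) \<longleftrightarrow> y = (\<lambda>_. 0)"
proof -
  have "y = x \<or> y = exch a b x" using assms unfolding refl_pairs_def by blast
  moreover have "x = (\<lambda>_. 0)" if "exch a b x = (\<lambda>_. 0)"
    using arg_cong[OF that, of "exch a b"] by simp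
  ultimately show ?thesis by auto
qed

lemma fun_kills_zero:
  assumes S: "fun_ring n S Y" and Q: "l' ` Q \<subseteq> Y" and g: "\<And>p. p \<in> P \<Longrightarrow> g p = 0"
  shows "fun_kills n S W P r Q l' g f"
proof -
  have "\<zero>\<^bsub>S\<^esub> \<in> carrier S"
    using S unfolding fun_ring_def by (metis abelian_monoid.zero_closed cring.axioms(1) ring.is_abelian_group abelian_group.axioms(1))
  moreover have "\<zero>\<^bsub>S\<^esub> (l' q) = 0" if "q \<in> Q" for q
    using S Q that unfolding fun_ring_def by blast
  ultimately show ?thesis unfolding fun_kills_def
    by (intro exI[of _ "\<lambda>p. 0"] exI[of _ "\<zero>\<^bsub>S\<^esub>"]) (simp add: g poly_on.const)
qed

text \<open>
  The right factor has generators \<open>1\<close> and \<open>y\<^sub>a - y\<^sub>b\<close> over the invariants.  If \<open>g\<^sub>1(x) + g\<^sub>2(x) (y\<^sub>a - y\<^sub>b)\<close>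
  vanishes for both \<open>y = x\<close> and \<open>y = exch a b x\<close>, then \<open>g\<^sub>1(x) = 0\<close> and \<open>g\<^sub>2(x) (x\<^sub>a - x\<^sub>b) = 0\<close>, so that \<open>g\<^sub>2\<close>
  vanishes off the origin, hence everywhere.
\<close>

theorem reflection_bimod_iso:
  fixes a b n :: nat
  assumes n: "n \<ge> 1" and ab: "a \<in> {1..n+1}" "b \<in> {1..n+1}" "a \<noteq> b"
  defines "X \<equiv> separated n a b :: ('k::field_char_0) vec set"
  shows "weyl_bimod_iso n
    (tensor (invariant_ring n (Transposition.transpose a b) X) (reg_bimod n X) (reg_bimod n X))
    (pair_bimod n (refl_pairs n a b))"
proof -
  let ?S = "invariant_ring n (Transposition.transpose a b) X"
  have S: "fun_ring n ?S X"
    by (rule fun_ring_invariant_ring) (use exch_separated[OF ab(1,2)] in \<open>auto simp: act_eq_exch X_def\<close>)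
  have X: "cone n {\<lambda>x. x} X" unfolding X_def by (rule cone_separated[OF ab])
  have XZ: "X \<subseteq> weyl_union n" unfolding X_def by (rule separated_in_weyl_union[OF n])
  have reg: "graded_bimodule (weyl_ring n) ?S (reg_bimod n X)" "graded_bimodule ?S (weyl_ring n) (reg_bimod n X)"
    unfolding reg_bimod_eq
    by (rule graded_bimodule_fun_bimod[OF fun_ring_weyl_ring S X] graded_bimodule_fun_bimod[OF S fun_ring_weyl_ring X];
        use XZ in auto)+
  have inS: "restrict g X \<in> carrier ?S"
    if "poly_on n {\<lambda>x. x} g" "\<forall>x. g (exch a b x) = g x" for g
    using that(2) restrict_in_reg_ring[OF that(1), of X g] exch_separated[OF ab(1,2), where c = a and d = b]
    by (auto simp: invariant_ring_simps act_eq_exch X_def)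
  let ?F = "fun_bimod n {\<lambda>x. x} X (\<lambda>x. x) (\<lambda>x. x)"
  have iso: "graded_bimod_iso (weyl_ring n) ?S (reg_bimod n X) ?F"
    "graded_bimod_iso ?S (weyl_ring n) (reg_bimod n X) ?F"
    using graded_bimod_iso_refl[OF reg(1)] graded_bimod_iso_refl[OF reg(2)] by (simp_all only: reg_bimod_eq)
  have memX: "fst t \<in> X" "snd t \<in> X" if "t \<in> refl_pairs n a b" for t
    using refl_pairsD(1,2)[OF ab(1,2) that] unfolding X_def .
  show ?thesis
  proof (rule tensor_fun_bimod[OF fun_ring_weyl_ring fun_ring_weyl_ring iso graded_refl_pairs[OF n ab],
        where \<pi>l = fst and \<pi>r = snd and fa = "\<lambda>x. 1" and fb = "\<lambda>x. x a - x b"])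
    show "\<exists>g. homog_on n {fst, snd} 2 g \<and> (\<forall>t\<in>refl_pairs n a b. v (fst t) i = g t)"
      if "v \<in> {\<lambda>x. x}" "i \<in> {1..n+1}" for v :: "'k vec \<Rightarrow> nat \<Rightarrow> 'k" and i
      using homog_on.coord[of fst "{fst, snd}" i n] that by auto
    show "\<exists>g. homog_on n {fst, snd} 2 g \<and> (\<forall>t\<in>refl_pairs n a b. v (snd t) i = g t)"
      if "v \<in> {\<lambda>x. x}" "i \<in> {1..n+1}" for v :: "'k vec \<Rightarrow> nat \<Rightarrow> 'k" and i
      using homog_on.coord[of snd "{fst, snd}" i n] that by auto
    show "s (fst t) = s (snd t)" if t: "t \<in> refl_pairs n a b" and s: "s \<in> carrier ?S" for t s
    proof -
      have "s (exch a b (fst t)) = s (fst t)"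
        using s memX(1)[OF t] by (simp add: invariant_ring_simps act_eq_exch)
      then show ?thesis using refl_pairsD(3)[OF ab(1,2) t] by auto
    qed
    show "poly_on n {\<lambda>x. x} (\<lambda>x :: 'k vec. x a - x b)" by (intro poly_on_minus coord_poly_on ab)
    show "\<exists>s1\<in>carrier ?S. \<exists>s2\<in>carrier ?S. \<forall>q\<in>X. g q = s1 q * 1 + s2 q * (q a - q b)"
      if g: "poly_on n {\<lambda>x. x} g" for g
    proof -
      obtain u v where uv: "poly_on n {\<lambda>x. x} u" "poly_on n {\<lambda>x. x} v" "\<forall>x. u (exch a b x) = u x"
        "\<forall>x. v (exch a b x) = v x" "\<forall>x. g x = u x + v x * (x a - x b)"
        using invariant_decomposition[OF g ab(1,2)] by blast
      show ?thesis
        by (rule bexI[OF _ inS[OF uv(1,3)]], rule bexI[OF _ inS[OF uv(2,4)]]) (simp add: uv(5))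
    qed
    show "fun_kills n ?S {\<lambda>x. x} X (\<lambda>x. x) X (\<lambda>x. x) g1 (\<lambda>x. 1) \<and>
        fun_kills n ?S {\<lambda>x. x} X (\<lambda>x. x) X (\<lambda>x. x) g2 (\<lambda>x. x a - x b)"
      if g: "poly_on n {\<lambda>x. x} g1" "poly_on n {\<lambda>x. x} g2"
        and zero: "\<And>t. t \<in> refl_pairs n a b \<Longrightarrow> g1 (fst t) * 1 + g2 (fst t) * (snd t a - snd t b) = 0" for g1 g2
    proof -
      have "g1 x = 0 \<and> g2 x = 0" if x: "x \<in> X" "nonzero_pt n {\<lambda>x. x} x" for x
      proof -
        have 1: "g1 x + g2 x * (x a - x b) = 0" "g1 x - g2 x * (x a - x b) = 0"
          using zero[of "(x, x)"] zero[of "(x, exch a b x)"] x(1) unfolding X_def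
          by (simp_all add: refl_pairs_def exch_def algebra_simps split: if_splits)
        have "g1 x + g1 x = (g1 x + g2 x * (x a - x b)) + (g1 x - g2 x * (x a - x b))" by simp
        then have "g1 x + g1 x = 0" unfolding 1 by simp
        then have "g1 x = 0" by (simp flip: mult_2)
        moreover have "x a \<noteq> x b" using x(1) nonzero_vec[OF x(2)] unfolding X_def separated_def by blast
        ultimately show ?thesis using 1(1) by simp
      qed
      then have 0: "g1 x = 0" "g2 x = 0" if "x \<in> X" for x
        using vanish_on_cone[OF g(1) X _ that] vanish_on_cone[OF g(2) X _ that] by blast+
      show ?thesis by (intro conjI fun_kills_zero[OF S] 0) simp_all
    qed
  qed (use memX in \<open>auto simp: poly_on.const\<close>)
qed

text \<open>
  A \<open>\<star>\<close>-product \<open>M \<star> N\<close> is computed in two steps, both of which only compose the points of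
  the factors where they meet: first the points of \<open>M\<close> are restricted to those with right end in
  the common support \<open>X\<close>, then they are continued by the points of \<open>N\<close>.
\<close>

lemma restrict_right_end:
  fixes M :: "('k::field_char_0, 'm) vec_bimod"
  assumes M: "weyl_bimod_iso n M (pair_bimod n P)"
    and PX: "graded_bimodule (weyl_ring n) (weyl_ring n) (pair_bimod n {p \<in> P. snd p \<in> X})"
    and P: "snd ` P \<subseteq> weyl_union n"
    and X: "X \<subseteq> weyl_union n" "cone n {\<lambda>x. x} X"
    and ab: "a \<in> {1..n+1}" "b \<in> {1..n+1}"
    and \<rho>: "\<And>i. i \<in> {1..n+1} \<Longrightarrow> homog_on n {\<lambda>x. x} 2 (\<lambda>x :: 'k vec. \<rho> x i)"
    and fst_P: "\<And>p. p \<in> P \<Longrightarrow> fst p = \<rho> (snd p) \<or> fst p = exch a b (\<rho> (snd p))"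
    and sep: "\<And>x. x \<in> X \<Longrightarrow> x \<noteq> (\<lambda>_. 0) \<Longrightarrow> \<exists>y z. (y, x) \<in> P \<and> (z, x) \<in> P \<and> y a - y b \<noteq> z a - z b"
  shows "weyl_bimod_iso n (tensor (weyl_ring n) M (reg_bimod n X)) (pair_bimod n {p \<in> P. snd p \<in> X})"
proof -
  let ?R = "weyl_ring n"
  let ?\<beta> = "\<lambda>p :: 'k vec \<times> 'k vec. fst p a - fst p b"
  have \<beta>: "poly_on n {fst, snd} ?\<beta>"
    using poly_on.coord[of fst "{fst, snd}" _ n] ab by (intro poly_on_minus) auto
  have dec: "\<exists>s1 s2. poly_on n {\<lambda>x. x} s1 \<and> poly_on n {\<lambda>x. x} s2 \<and>
      (\<forall>p\<in>P. g p = s1 (snd p) + ?\<beta> p * s2 (snd p))" if g: "poly_on n {fst, snd} g" for g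
  proof (rule poly_decomposition[OF g ab, where u = fst and \<tau> = snd and \<rho> = \<rho>])
    show "\<exists>c. homog_on n {\<lambda>x. x} 2 c \<and> (\<forall>p\<in>P. w p i = c (snd p))"
      if "w \<in> {fst, snd}" "w \<noteq> fst" "i \<in> {1..n+1}" for w :: "'k vec \<times> 'k vec \<Rightarrow> nat \<Rightarrow> 'k" and i
      using that coord_homog_on by (intro exI[of _ "\<lambda>x. x i"]) auto
  qed (use \<rho> fst_P in auto)
  have reg: "weyl_bimod_iso n (reg_bimod n X) (fun_bimod n {\<lambda>x. x} X (\<lambda>x. x) (\<lambda>x. x))"
    unfolding reg_bimod_eq
    by (rule graded_bimod_iso_refl, rule graded_bimodule_fun_bimod[OF fun_ring_weyl_ring fun_ring_weyl_ring X(2)])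
      (use X(1) in auto)
  show ?thesis
  proof (rule tensor_fun_bimod[OF fun_ring_weyl_ring fun_ring_weyl_ring M reg PX,
        where \<pi>l = "\<lambda>p. p" and \<pi>r = snd and fa = "\<lambda>x. 1" and fb = "\<lambda>x. 0"])
    show "\<exists>g. homog_on n {fst, snd} 2 g \<and> (\<forall>t\<in>{p \<in> P. snd p \<in> X}. v t i = g t)"
      if "v \<in> {fst, snd}" "i \<in> {1..n+1}" for v :: "'k vec \<times> 'k vec \<Rightarrow> nat \<Rightarrow> 'k" and i
      using homog_on.coord[OF that] by blast
    show "\<exists>g. homog_on n {fst, snd} 2 g \<and> (\<forall>t\<in>{p \<in> P. snd p \<in> X}. v (snd t) i = g t)"
      if "v \<in> {\<lambda>x. x}" "i \<in> {1..n+1}" for v :: "'k vec \<Rightarrow> nat \<Rightarrow> 'k" and i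
      using homog_on.coord[of snd "{fst, snd}" i n] that by auto
    show "\<exists>s1\<in>carrier ?R. \<exists>s2\<in>carrier ?R. \<forall>q\<in>X. g q = s1 q * 1 + s2 q * 0"
      if "poly_on n {\<lambda>x. x} g" for g :: "'k vec \<Rightarrow> 'k"
      by (rule bexI[OF _ restrict_in_weyl_ring[OF that]], rule bexI[OF _ restrict_in_weyl_ring[OF that]]) (use X(1) in auto)
    show "fun_kills n ?R {fst, snd} P snd X (\<lambda>x. x) g1 (\<lambda>x. 1) \<and> fun_kills n ?R {fst, snd} P snd X (\<lambda>x. x) g2 (\<lambda>x. 0)"
      if g: "poly_on n {fst, snd} g1" "poly_on n {fst, snd} g2"
        and zero: "\<And>t. t \<in> {p \<in> P. snd p \<in> X} \<Longrightarrow> g1 t * 1 + g2 t * 0 = 0" for g1 g2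
    proof
      obtain s1 s2 where s: "poly_on n {\<lambda>x. x} s1" "poly_on n {\<lambda>x. x} s2"
        "\<And>p. p \<in> P \<Longrightarrow> g1 p = s1 (snd p) + ?\<beta> p * s2 (snd p)" using dec[OF g(1)] by blast
      have "s1 x = 0 \<and> s2 x = 0" if x: "x \<in> X" "nonzero_pt n {\<lambda>x. x} x" for x
      proof -
        obtain y z where yz: "(y, x) \<in> P" "(z, x) \<in> P" "y a - y b \<noteq> z a - z b"
          using sep[OF x(1) nonzero_vec[OF x(2)]] by blast
        have 1: "s1 x + (y a - y b) * s2 x = 0" "s1 x + (z a - z b) * s2 x = 0"
          using zero[of "(y, x)"] zero[of "(z, x)"] s(3)[OF yz(1)] s(3)[OF yz(2)] x(1) yz by simp_all
        have "((y a - y b) - (z a - z b)) * s2 x = (s1 x + (y a - y b) * s2 x) - (s1 x + (z a - z b) * s2 x)"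
          by (simp add: algebra_simps)
        then have "s2 x = 0" unfolding 1 using yz(3) by simp
        then show ?thesis using 1(1) by simp
      qed
      then have s0: "s1 x = 0" "s2 x = 0" if "x \<in> X" for x
        using vanish_on_cone[OF s(1) X(2) _ that] vanish_on_cone[OF s(2) X(2) _ that] by blast+
      show "fun_kills n ?R {fst, snd} P snd X (\<lambda>x. x) g1 (\<lambda>x. 1)"
        unfolding fun_kills_def
      proof (intro exI conjI ballI)
        show "poly_on n {fst, snd} (\<lambda>p. 1)" by (rule poly_on.const)
        show "g1 p = 1 * restrict s1 (weyl_union n) (snd p) + ?\<beta> p * restrict s2 (weyl_union n) (snd p)"
          if "p \<in> P" for p using s(3)[OF that] P that by auto
        show "restrict s1 (weyl_union n) \<in> carrier ?R" "restrict s2 (weyl_union n) \<in> carrier ?R"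
          by (rule restrict_in_weyl_ring[OF s(1)], rule restrict_in_weyl_ring[OF s(2)])
      qed (use \<beta> s0 X(1) in auto)
      have "poly_on n {\<lambda>x. x} (\<lambda>x :: 'k vec. 1 :: 'k)" by (rule poly_on.const)
      note one = restrict_in_weyl_ring[OF this]
      show "fun_kills n ?R {fst, snd} P snd X (\<lambda>x. x) g2 (\<lambda>x. 0)"
        unfolding fun_kills_def
      proof (intro exI conjI ballI)
        show "g2 p = g2 p * restrict (\<lambda>x. 1) (weyl_union n) (snd p) + 0 * restrict (\<lambda>x. 1) (weyl_union n) (snd p)"
          if "p \<in> P" for p using P that by auto
        show "restrict (\<lambda>x :: 'k vec. 1 :: 'k) (weyl_union n) \<in> carrier ?R"
          "restrict (\<lambda>x :: 'k vec. 1 :: 'k) (weyl_union n) \<in> carrier ?R"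
          by (rule one, rule one)
        show "poly_on n {fst, snd} (\<lambda>p :: 'k vec \<times> 'k vec. 0 :: 'k)" by (rule poly_on.const)
      qed (use g(2) in auto)
    qed
    show "(\<exists>v\<in>{fst, snd}. \<forall>t\<in>{p \<in> P. snd p \<in> X}. w t = v t) \<or> (\<exists>v\<in>{\<lambda>x. x}. \<forall>t\<in>{p \<in> P. snd p \<in> X}. w t = v (snd t))"
      if "w \<in> {fst, snd}" for w :: "'k vec \<times> 'k vec \<Rightarrow> nat \<Rightarrow> 'k"
      by (rule disjI1, rule bexI[OF _ that]) simp
  qed (simp_all add: poly_on.const)
qed

text \<open>
  The points of \<open>T\<close> are the \<open>(x, y, z)\<close> with \<open>(x, y)\<close> in \<open>P\<close> and \<open>(y, z)\<close> in \<open>refl_pairs\<close>, by \<open>proj\<close> and \<open>comp\<close>;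
  a middle vector \<open>\<mu> t\<close> that depends linearly on the ends is not recorded among the coordinates
  \<open>W''\<close>.  Over each nonzero \<open>y\<close> the form \<open>z\<^sub>c - z\<^sub>d\<close> takes two different values, which determines both
  coefficients of an element of the tensor product.
\<close>

lemma continue_by_reflection:
  fixes M :: "('k::field_char_0, 'm) vec_bimod"
    and W'' :: "('t \<Rightarrow> nat \<Rightarrow> 'k) set"
  assumes n: "n \<ge> 1" and cd: "c \<in> {1..n+1}" "d \<in> {1..n+1}"
    and M: "weyl_bimod_iso n M (pair_bimod n P)" and P: "cone n {fst, snd} P" "snd ` P \<subseteq> separated n c d"
      "\<And>x. (x, (\<lambda>_. 0)) \<in> P \<Longrightarrow> x = (\<lambda>_. 0)"
    and N: "weyl_bimod_iso n N (pair_bimod n (refl_pairs n c d))"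
    and T: "graded_bimodule (weyl_ring n) (weyl_ring n) (fun_bimod n W'' T l'' r'')"
    and proj: "\<And>t. t \<in> T \<Longrightarrow> (l'' t, \<mu> t) \<in> P" "\<And>t. t \<in> T \<Longrightarrow> (\<mu> t, r'' t) \<in> refl_pairs n c d"
    and lr: "l'' \<in> W''" "r'' \<in> W''" "W'' \<subseteq> {l'', \<mu>, r''}"
    and \<mu>: "\<And>i. i \<in> {1..n+1} \<Longrightarrow> homog_on n W'' 2 (\<lambda>t. \<mu> t i)"
    and comp: "\<And>x y z. (x, y) \<in> P \<Longrightarrow> (y, z) \<in> refl_pairs n c d \<Longrightarrow> \<exists>t\<in>T. l'' t = x \<and> \<mu> t = y \<and> r'' t = z"
  shows "weyl_bimod_iso n (tensor (weyl_ring n) M N) (fun_bimod n W'' T l'' r'')"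
proof -
  let ?R = "weyl_ring n" and ?Q = "refl_pairs n c d :: ('k vec \<times> 'k vec) set"
  let ?\<gamma> = "\<lambda>q :: 'k vec \<times> 'k vec. snd q c - snd q d"
  have QZ: "fst q \<in> weyl_union n" if "q \<in> ?Q" for q
    using refl_pairsD(1)[OF cd that] separated_in_weyl_union[OF n] by blast
  have dec: "\<exists>s1 s2. poly_on n {\<lambda>x. x} s1 \<and> poly_on n {\<lambda>x. x} s2 \<and>
      (\<forall>q\<in>?Q. g q = s1 (fst q) + ?\<gamma> q * s2 (fst q))" if g: "poly_on n {fst, snd} g" for g
  proof (rule poly_decomposition[OF g cd, where u = snd and \<tau> = fst and \<rho> = "\<lambda>x. x"])
    show "\<exists>c. homog_on n {\<lambda>x. x} 2 c \<and> (\<forall>p\<in>?Q. w p i = c (fst p))"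
      if "w \<in> {fst, snd}" "w \<noteq> snd" "i \<in> {1..n+1}" for w :: "'k vec \<times> 'k vec \<Rightarrow> nat \<Rightarrow> 'k" and i
      using that coord_homog_on by (intro exI[of _ "\<lambda>x. x i"]) auto
  qed (use coord_homog_on refl_pairsD(3)[OF cd] in auto)
  have ends: "homog_on n W'' 2 (\<lambda>t. l'' t i)" "homog_on n W'' 2 (\<lambda>t. r'' t i)" if "i \<in> {1..n+1}" for i
    using homog_on.coord[OF lr(1) that] homog_on.coord[OF lr(2) that] .
  show ?thesis
  proof (rule tensor_fun_bimod[OF fun_ring_weyl_ring fun_ring_weyl_ring M N T,
        where \<pi>l = "\<lambda>t. (l'' t, \<mu> t)" and \<pi>r = "\<lambda>t. (\<mu> t, r'' t)" and fa = "\<lambda>q. 1" and fb = ?\<gamma>])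
    show "\<exists>g. homog_on n W'' 2 g \<and> (\<forall>t\<in>T. v (l'' t, \<mu> t) i = g t)"
      if "v \<in> {fst, snd}" "i \<in> {1..n+1}" for v :: "'k vec \<times> 'k vec \<Rightarrow> nat \<Rightarrow> 'k" and i
      using ends(1)[OF that(2)] \<mu>[OF that(2)] that(1) by auto
    show "\<exists>g. homog_on n W'' 2 g \<and> (\<forall>t\<in>T. v (\<mu> t, r'' t) i = g t)"
      if "v \<in> {fst, snd}" "i \<in> {1..n+1}" for v :: "'k vec \<times> 'k vec \<Rightarrow> nat \<Rightarrow> 'k" and i
      using ends(2)[OF that(2)] \<mu>[OF that(2)] that(1) by auto
    show "(\<exists>v\<in>{fst, snd}. \<forall>t\<in>T. w t = v (l'' t, \<mu> t)) \<or> (\<exists>v\<in>{fst, snd}. \<forall>t\<in>T. w t = v (\<mu> t, r'' t))"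
      if "w \<in> W''" for w using that lr(3) by auto
    show "poly_on n {fst, snd} ?\<gamma>"
      using poly_on.coord[of snd "{fst, snd}" _ n] cd by (intro poly_on_minus) auto
    show "\<exists>s1\<in>carrier ?R. \<exists>s2\<in>carrier ?R. \<forall>q\<in>?Q. g q = s1 (fst q) * 1 + s2 (fst q) * ?\<gamma> q"
      if g: "poly_on n {fst, snd} g" for g
    proof -
      obtain s1 s2 where s: "poly_on n {\<lambda>x. x} s1" "poly_on n {\<lambda>x. x} s2"
        "\<forall>q\<in>?Q. g q = s1 (fst q) + ?\<gamma> q * s2 (fst q)" using dec[OF g] by blast
      show ?thesis
        by (rule bexI[OF _ restrict_in_weyl_ring[OF s(1)]], rule bexI[OF _ restrict_in_weyl_ring[OF s(2)]]) (use s(3) QZ in \<open>simp add: mult.commute\<close>)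
    qed
    show "fun_kills n ?R {fst, snd} P snd ?Q fst g1 (\<lambda>q. 1) \<and> fun_kills n ?R {fst, snd} P snd ?Q fst g2 ?\<gamma>"
      if g: "poly_on n {fst, snd} g1" "poly_on n {fst, snd} g2"
        and zero: "\<And>t. t \<in> T \<Longrightarrow> g1 (l'' t, \<mu> t) * 1 + g2 (l'' t, \<mu> t) * ?\<gamma> (\<mu> t, r'' t) = 0" for g1 g2
    proof -
      have "g1 p = 0 \<and> g2 p = 0" if p: "p \<in> P" "nonzero_pt n {fst, snd} p" for p
      proof -
        obtain x y where xy: "p = (x, y)" by fastforce
        have y: "y \<in> separated n c d" "y \<noteq> (\<lambda>_. 0)"
          using p(1) nonzero_pair[OF p(2)] P(2) P(3)[of x] unfolding xy by auto
        note e = refl_pairs_sep[OF cd y]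
        have yy: "(y, y) \<in> ?Q" "(y, exch c d y) \<in> ?Q" using y(1) unfolding refl_pairs_def by simp_all
        obtain t where t: "t \<in> T" "l'' t = x" "\<mu> t = y" "r'' t = y"
          using comp[OF p(1)[unfolded xy] yy(1)] by blast
        obtain t' where t': "t' \<in> T" "l'' t' = x" "\<mu> t' = y" "r'' t' = exch c d y"
          using comp[OF p(1)[unfolded xy] yy(2)] by blast
        have 1: "g1 p + g2 p * (y c - y d) = 0" "g1 p + g2 p * (exch c d y c - exch c d y d) = 0"
          using zero[OF t(1)] zero[OF t'(1)] t t' xy by simp_all
        have "g2 p * ((y c - y d) - (exch c d y c - exch c d y d)) =
            (g1 p + g2 p * (y c - y d)) - (g1 p + g2 p * (exch c d y c - exch c d y d))"
          by (simp add: algebra_simps)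
        then have "g2 p = 0" unfolding 1 using e(2) by simp
        then show ?thesis using 1(1) by simp
      qed
      then have 0: "g1 p = 0" "g2 p = 0" if "p \<in> P" for p
        using vanish_on_cone[OF g(1) P(1) _ that] vanish_on_cone[OF g(2) P(1) _ that] by blast+
      show ?thesis
        by (intro conjI fun_kills_zero[OF fun_ring_weyl_ring] 0) (use QZ in auto)
    qed
  qed (use proj in \<open>auto simp: poly_on.const\<close>)
qed

section \<open>The product with the bimodule of a reflection\<close>

text \<open>
  By the hypotheses on \<open>\<rho>\<close>, the functions \<open>1\<close> and \<open>x\<^sub>a - x\<^sub>b\<close> generate the functions of \<open>(x, y) \<in> P\<close> over
  those of \<open>y\<close>; by \<open>sep\<close> they are independent over functions on the intersection of the supports.
  This is what allows restricting \<open>y\<close> to the intersection.  As before, \<open>proj\<close> and \<open>comp\<close> describe \<open>T\<close> as a fibre product.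
\<close>

lemma star_prod_reflection:
  fixes M :: "('k::field_char_0, 'm) vec_bimod"
    and W'' :: "('t \<Rightarrow> nat \<Rightarrow> 'k) set"
  assumes n: "n \<ge> 1" and ab: "a \<in> {1..n+1}" "b \<in> {1..n+1}"
    and a'b': "a' \<in> {1..n+1}" "b' \<in> {1..n+1}" and cd: "c \<in> {1..n+1}" "d \<in> {1..n+1}"
    and M: "weyl_bimod_iso n M (pair_bimod n P)"
    and P: "fst ` P \<subseteq> weyl_union n" "snd ` P = separated n a' b'" "scale_closed P"
      "\<And>x. (x, (\<lambda>_. 0)) \<in> P \<Longrightarrow> x = (\<lambda>_. 0)"
    and N: "weyl_bimod_iso n N (pair_bimod n (refl_pairs n c d))"
    and T: "graded_bimodule (weyl_ring n) (weyl_ring n) (fun_bimod n W'' T l'' r'')"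
    and X_nz: "\<exists>x \<in> separated n a' b' \<inter> separated n c d. x \<noteq> (\<lambda>_. 0 :: 'k)"
    and \<rho>: "\<And>i. i \<in> {1..n+1} \<Longrightarrow> homog_on n {\<lambda>x. x} 2 (\<lambda>x :: 'k vec. \<rho> x i)"
    and fst_P: "\<And>p. p \<in> P \<Longrightarrow> fst p = \<rho> (snd p) \<or> fst p = exch a b (\<rho> (snd p))"
    and sep: "\<And>x. x \<in> separated n a' b' \<inter> separated n c d \<Longrightarrow> x \<noteq> (\<lambda>_. 0) \<Longrightarrow>
      \<exists>y z. (y, x) \<in> P \<and> (z, x) \<in> P \<and> y a - y b \<noteq> z a - z b"
    and proj: "\<And>t. t \<in> T \<Longrightarrow> (l'' t, \<mu> t) \<in> P \<and> \<mu> t \<in> separated n c d" "\<And>t. t \<in> T \<Longrightarrow> (\<mu> t, r'' t) \<in> refl_pairs n c d"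
    and lr: "l'' \<in> W''" "r'' \<in> W''" "W'' \<subseteq> {l'', \<mu>, r''}"
    and \<mu>: "\<And>i. i \<in> {1..n+1} \<Longrightarrow> homog_on n W'' 2 (\<lambda>t. \<mu> t i)"
    and comp: "\<And>x y z. (x, y) \<in> P \<Longrightarrow> (y, z) \<in> refl_pairs n c d \<Longrightarrow> \<exists>t\<in>T. l'' t = x \<and> \<mu> t = y \<and> r'' t = z"
  shows "weyl_bimod_iso n (star_prod n M N) (fun_bimod n W'' T l'' r'')"
proof -
  let ?X = "separated n a' b' \<inter> separated n c d :: 'k vec set"
  let ?P = "{p \<in> P. snd p \<in> ?X}"
  have "right_support n M = separated n a' b'"
    unfolding right_support_cong[OF M] by (rule right_support_fun_bimod[OF n a'b' P(2)])
  moreover have "left_support n N = separated n c d"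
    unfolding left_support_cong[OF N] by (rule left_support_fun_bimod[OF n cd image_refl_pairs(1)[OF cd]])
  ultimately have supp: "right_support n M \<inter> left_support n N = ?X" by simp
  obtain x where x: "x \<in> ?X" "x \<noteq> (\<lambda>_. 0)" using X_nz by blast
  have xg: "x \<in> geom_rep n" using x unfolding separated_def by blast
  have Xscale: "(\<lambda>i. t * x i) \<in> ?X" if "x \<in> ?X" for x t using that separated_scale by blast
  have X: "cone n {\<lambda>x. x} ?X" by (rule cone_vecs[OF Xscale x(1) xg x(2)])
  obtain y where y: "(y, x) \<in> P" using sep[OF x] by blast
  have Pscale: "scale_closed ?P"
    using P(3) Xscale unfolding scale_closed_def by fastforce
  have Pcone: "cone n {fst, snd} ?P" by (rule cone_pairs[OF Pscale, of y x]) (use y x xg in simp_all)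
  have X_sub: "?X \<subseteq> weyl_union n" using separated_in_weyl_union[OF n] by blast
  have gr: "graded_bimodule (weyl_ring n) (weyl_ring n) (pair_bimod n ?P)"
    by (rule graded_pair_bimod[OF n Pcone]) (use P(1) X_sub in auto)
  have step: "weyl_bimod_iso n (tensor (weyl_ring n) M (reg_bimod n ?X)) (pair_bimod n ?P)"
    by (rule restrict_right_end[OF M gr _ X_sub X ab \<rho> fst_P sep])
      (use P(2) separated_in_weyl_union[OF n] in auto)
  have in_P: "(l'' t, \<mu> t) \<in> ?P" if "t \<in> T" for t
  proof -
    have "snd (l'' t, \<mu> t) \<in> snd ` P" by (rule imageI) (use proj(1)[OF that] in blast)
    then show ?thesis using proj(1)[OF that] unfolding P(2) by simp
  qed
  show ?thesis
    unfolding star_prod_def supp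
    by (rule continue_by_reflection[OF n cd step Pcone _ _ N T in_P proj(2) lr \<mu>]) (use comp P(4) in auto)
qed

corollary star_prod_two_reflections:
  fixes B :: "('k::field_char_0, 'm) vec_bimod"
    and W'' :: "('t \<Rightarrow> nat \<Rightarrow> 'k) set"
  assumes n: "n \<ge> 1" and ab: "a \<in> {1..n+1}" "b \<in> {1..n+1}" and cd: "c \<in> {1..n+1}" "d \<in> {1..n+1}"
    and B: "weyl_bimod_iso n B (pair_bimod n (refl_pairs n a b))"
    and B': "weyl_bimod_iso n B' (pair_bimod n (refl_pairs n c d))"
    and T: "graded_bimodule (weyl_ring n) (weyl_ring n) (fun_bimod n W'' T l'' r'')"
    and X_nz: "\<exists>x \<in> separated n a b \<inter> separated n c d. x \<noteq> (\<lambda>_. 0 :: 'k)"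
    and proj: "\<And>t. t \<in> T \<Longrightarrow> (l'' t, \<mu> t) \<in> refl_pairs n a b \<and> (\<mu> t, r'' t) \<in> refl_pairs n c d"
    and lr: "l'' \<in> W''" "r'' \<in> W''" "W'' \<subseteq> {l'', \<mu>, r''}"
    and \<mu>: "\<And>i. i \<in> {1..n+1} \<Longrightarrow> homog_on n W'' 2 (\<lambda>t. \<mu> t i)"
    and comp: "\<And>x y z. (x, y) \<in> refl_pairs n a b \<Longrightarrow> (y, z) \<in> refl_pairs n c d \<Longrightarrow>
      \<exists>t\<in>T. l'' t = x \<and> \<mu> t = y \<and> r'' t = z"
  shows "weyl_bimod_iso n (star_prod n B B') (fun_bimod n W'' T l'' r'')"
proof (rule star_prod_reflection[OF n ab ab cd B _ image_refl_pairs(2)[OF ab]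
      scale_closed_refl_pairs _ B' T X_nz coord_homog_on refl_pairsD(4)[OF ab] _ _ _ lr \<mu> comp])
  show "fst ` refl_pairs n a b \<subseteq> weyl_union n"
    unfolding image_refl_pairs(1)[OF ab] by (rule separated_in_weyl_union[OF n])
  show "x = (\<lambda>_. 0)" if "(x, (\<lambda>_. 0)) \<in> refl_pairs n a b" for x
    using refl_pairs_zero[OF that] by simp
  show "\<exists>y z. (y, x) \<in> refl_pairs n a b \<and> (z, x) \<in> refl_pairs n a b \<and> y a - y b \<noteq> z a - z b"
    if x: "x \<in> separated n a b \<inter> separated n c d" "x \<noteq> (\<lambda>_. 0)" for x
  proof (intro exI conjI)
    show "(x, x) \<in> refl_pairs n a b" using x unfolding refl_pairs_def by blast
    show "(exch a b x, x) \<in> refl_pairs n a b"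
      using refl_pairs_sep(1)[OF ab, of x] x unfolding refl_pairs_def by simp
    show "x a - x b \<noteq> exch a b x a - exch a b x b" using refl_pairs_sep(2)[OF ab] x by blast
  qed
  show "(l'' t, \<mu> t) \<in> refl_pairs n a b \<and> \<mu> t \<in> separated n c d" "(\<mu> t, r'' t) \<in> refl_pairs n c d"
    if "t \<in> T" for t
    using proj[OF that] refl_pairsD(1)[OF cd, of "(\<mu> t, r'' t)"] by simp_all
qed

subsection \<open>The square of the bimodule of a reflection\<close>

definition refl_triples :: "nat \<Rightarrow> nat \<Rightarrow> nat \<Rightarrow>
    (('k::field_char_0) vec \<times> 'k vec \<times> 'k vec) set" where
  "refl_triples n a b = {(x, y, z). (x, y) \<in> refl_pairs n a b \<and> (y, z) \<in> refl_pairs n a b}"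

abbreviation "triple_bimod n T \<equiv> fun_bimod n {fst, fst \<circ> snd, snd \<circ> snd} T fst (snd \<circ> snd)"

lemma refl_pairs_compose:
  assumes ab: "a \<in> {1..n+1}" "b \<in> {1..n+1}"
  shows "(x, y, z) \<in> refl_triples n a b \<longleftrightarrow> (x, z) \<in> refl_pairs n a b \<and> (y = x \<or> y = exch a b x)"
proof -
  have "exch a b x \<in> separated n a b" if "x \<in> separated n a b" for x :: "nat \<Rightarrow> 'a"
    by (rule exch_separated[OF ab that]) simp
  then show ?thesis unfolding refl_triples_def refl_pairs_def by auto
qed

lemma graded_refl_triples:
  assumes n: "n \<ge> 1" and ab: "a \<in> {1..n+1}" "b \<in> {1..n+1}" "a \<noteq> b"
  shows "graded_bimodule (weyl_ring n) (weyl_ring n)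
    (triple_bimod n (refl_triples n a b :: (('k::field_char_0) vec \<times> 'k vec \<times> 'k vec) set))"
proof (rule graded_bimodule_fun_bimod[OF fun_ring_weyl_ring fun_ring_weyl_ring])
  let ?T = "refl_triples n a b :: ('k vec \<times> 'k vec \<times> 'k vec) set"
  let ?W = "{fst, fst \<circ> snd, snd \<circ> snd} :: ('k vec \<times> 'k vec \<times> 'k vec \<Rightarrow> nat \<Rightarrow> 'k) set"
  obtain x :: "'k vec" where x: "x \<in> separated n a b" "x \<noteq> (\<lambda>_. 0)" using separated_nonzero[OF ab] by blast
  have "x \<in> geom_rep n" using x unfolding separated_def by blast
  then have "nonzero_pt n ?W (x, x, x)"
    using geom_rep_nonzero[OF _ x(2)] unfolding nonzero_pt_def by auto
  moreover have "(x, x, x) \<in> ?T" using x(1) unfolding refl_triples_def refl_pairs_def by auto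
  moreover have "\<exists>q\<in>?T. scaled n ?W t (x, y, z) q" if "(x, y, z) \<in> ?T" for x y z t
  proof
    show "((\<lambda>i. t * x i), (\<lambda>i. t * y i), (\<lambda>i. t * z i)) \<in> ?T"
      using that scale_closed_refl_pairs[of n a b] unfolding refl_triples_def scale_closed_def by blast
  qed (simp add: scaled_def)
  ultimately show "cone n ?W ?T" unfolding cone_def by auto
  show "fst ` ?T \<subseteq> weyl_union n"
    using refl_pairsD(1)[OF ab(1,2)] separated_in_weyl_union[OF n] unfolding refl_triples_def by fastforce
  show "(snd \<circ> snd) ` ?T \<subseteq> weyl_union n"
    using refl_pairsD(2)[OF ab(1,2)] separated_in_weyl_union[OF n] unfolding refl_triples_def by fastforce
qed auto

lemma square_iso:
  fixes B :: "('k::field_char_0, 'm) vec_bimod"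
  assumes n: "n \<ge> 1" and ab: "a \<in> {1..n+1}" "b \<in> {1..n+1}" "a \<noteq> b"
    and B: "weyl_bimod_iso n B (pair_bimod n (refl_pairs n a b))"
  shows "weyl_bimod_iso n (star_prod n B B) (triple_bimod n (refl_triples n a b))"
proof (rule star_prod_two_reflections[OF n ab(1,2) ab(1,2) B B graded_refl_triples[OF n ab],
      where \<mu> = "fst \<circ> snd"])
  show "\<exists>x\<in>separated n a b \<inter> separated n a b. x \<noteq> (\<lambda>_. 0 :: 'k)" using separated_nonzero[OF ab] by blast
  show "homog_on n {fst, fst \<circ> snd, snd \<circ> snd} 2 (\<lambda>t. (fst \<circ> snd) t i)" if "i \<in> {1..n+1}" for i
    by (rule homog_on.coord) (use that in auto)
  show "\<exists>t\<in>refl_triples n a b. fst t = x \<and> (fst \<circ> snd) t = y \<and> (snd \<circ> snd) t = z"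
    if "(x, y) \<in> refl_pairs n a b" "(y, z) \<in> refl_pairs n a b" for x y z
    by (rule bexI[of _ "(x, y, z)"]) (use that in \<open>simp_all add: refl_triples_def\<close>)
qed (auto simp: refl_triples_def)

text \<open>
  A function of \<open>(x, y, z)\<close> with \<open>y = x\<close> or \<open>y = exch a b x\<close> is uniquely \<open>u (x, z) + (y\<^sub>a - y\<^sub>b) v (x, z)\<close>;
  the linear form \<open>y\<^sub>a - y\<^sub>b\<close> has degree 2, which explains the shift.
\<close>

lemma triple_bimod_direct_sum:
  fixes B :: "('k::field_char_0, 'm) vec_bimod"
  assumes n: "n \<ge> 1" and ab: "a \<in> {1..n+1}" "b \<in> {1..n+1}" "a \<noteq> b"
    and B: "weyl_bimod_iso n B (pair_bimod n (refl_pairs n a b))"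
  shows "weyl_bimod_iso n (direct_sum B (shift B (- 2))) (triple_bimod n (refl_triples n a b))"
proof -
  let ?R = "weyl_ring n" and ?P = "refl_pairs n a b :: ('k vec \<times> 'k vec) set"
    and ?T = "refl_triples n a b :: ('k vec \<times> 'k vec \<times> 'k vec) set"
  let ?W = "{fst, fst \<circ> snd, snd \<circ> snd} :: ('k vec \<times> 'k vec \<times> 'k vec \<Rightarrow> nat \<Rightarrow> 'k) set"
  let ?\<tau> = "\<lambda>t :: 'k vec \<times> 'k vec \<times> 'k vec. (fst t, snd (snd t))"
  let ?\<alpha> = "\<lambda>t :: 'k vec \<times> 'k vec \<times> 'k vec. (fst \<circ> snd) t a - (fst \<circ> snd) t b"
  let ?M = "direct_sum B (shift B (- 2))"
  obtain k where B_gr: "graded_bimodule ?R ?R B"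
    and k: "bij_betw k (carrier B) (carrier (pair_bimod n ?P))" "k \<zero>\<^bsub>B\<^esub> = \<zero>\<^bsub>pair_bimod n ?P\<^esub>"
    "\<And>x. x \<in> carrier B \<Longrightarrow> k x \<in> carrier (pair_bimod n ?P)"
    "\<And>x y. x \<in> carrier B \<Longrightarrow> y \<in> carrier B \<Longrightarrow> k (x \<oplus>\<^bsub>B\<^esub> y) = k x \<oplus>\<^bsub>pair_bimod n ?P\<^esub> k y"
    "\<And>a x. a \<in> carrier ?R \<Longrightarrow> x \<in> carrier B \<Longrightarrow> k (a \<odot>\<^bsub>B\<^esub> x) = a \<odot>\<^bsub>pair_bimod n ?P\<^esub> k x"
    "\<And>b x. b \<in> carrier ?R \<Longrightarrow> x \<in> carrier B \<Longrightarrow> k (rsmult B x b) = rsmult (pair_bimod n ?P) (k x) b"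
    "\<And>d. k ` homog B d = homog (pair_bimod n ?P) d"
    by (rule graded_bimod_isoE[OF B]) blast
  interpret B: abelian_group B by (rule graded_bimodule_abelian_group[OF B_gr])
  have k_surj: "\<exists>x\<in>carrier B. k x = restrict g ?P" if "poly_on n {fst, snd} g" for g
  proof -
    have "restrict g ?P \<in> carrier (pair_bimod n ?P)" using fun_bimodI[OF that] by simp
    then have "restrict g ?P \<in> k ` carrier B" using bij_betw_imp_surj_on[OF k(1)] by simp
    then show ?thesis by (metis imageE)
  qed
  have k_surj_homog: "\<exists>x\<in>homog B d. k x = restrict g ?P" if "homog_on n {fst, snd} d g" for g d
  proof -
    have "restrict g ?P \<in> homog (pair_bimod n ?P) d" using fun_bimod_homogI[OF that] by simp
    then have "restrict g ?P \<in> k ` homog B d" using k(7) by simp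
    then show ?thesis by (metis imageE)
  qed
  have \<tau>: "?\<tau> t \<in> ?P" "(fst \<circ> snd) t = fst (?\<tau> t) \<or> (fst \<circ> snd) t = exch a b (fst (?\<tau> t))" if t: "t \<in> ?T" for t
  proof -
    obtain x y z where "t = (x, y, z)" by (cases t)
    then show "?\<tau> t \<in> ?P" "(fst \<circ> snd) t = fst (?\<tau> t) \<or> (fst \<circ> snd) t = exch a b (fst (?\<tau> t))"
      using t refl_pairs_compose[OF ab(1,2), of x y z] by simp_all
  qed
  have two: "\<exists>t\<in>?T. \<exists>t'\<in>?T. ?\<tau> t = p \<and> ?\<tau> t' = p \<and> ?\<alpha> t = fst p a - fst p b \<and> ?\<alpha> t' = - (fst p a - fst p b)"
    if "p \<in> ?P" for p
  proof -
    obtain x z where p: "p = (x, z)" by (cases p)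
    have "(x, x, z) \<in> ?T" "(x, exch a b x, z) \<in> ?T"
      using that p refl_pairs_compose[OF ab(1,2), of x _ z] by simp_all
    moreover have "?\<alpha> (x, exch a b x, z) = - (x a - x b)" by (auto simp: exch_def)
    ultimately show ?thesis
      by (intro bexI2[of _ "(x, x, z)" "(x, exch a b x, z)"]) (simp_all add: p)
  qed
  define h where "h m = (\<lambda>t\<in>?T. k (fst m) (?\<tau> t) + ?\<alpha> t * k (snd m) (?\<tau> t))" for m
  have M: "carrier ?M = carrier B \<times> carrier B" "\<zero>\<^bsub>?M\<^esub> = (\<zero>\<^bsub>B\<^esub>, \<zero>\<^bsub>B\<^esub>)"
    "\<And>x y. x \<oplus>\<^bsub>?M\<^esub> y = (fst x \<oplus>\<^bsub>B\<^esub> fst y, snd x \<oplus>\<^bsub>B\<^esub> snd y)"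
    "\<And>a x. a \<odot>\<^bsub>?M\<^esub> x = (a \<odot>\<^bsub>B\<^esub> fst x, a \<odot>\<^bsub>B\<^esub> snd x)"
    "\<And>x a. rsmult ?M x a = (rsmult B (fst x) a, rsmult B (snd x) a)"
    "\<And>d. homog ?M d = homog B d \<times> homog B (d - 2)"
    by (simp_all add: direct_sum_def shift_def case_prod_unfold)
  have dec_side: "\<exists>c. homog_on n {fst, snd} 2 c \<and> (\<forall>p\<in>?T. w p i = c (?\<tau> p))"
    if "w \<in> ?W" "w \<noteq> fst \<circ> snd" "i \<in> {1..n+1}" for w i
  proof -
    have c: "homog_on n {fst, snd} 2 (\<lambda>p :: 'k vec \<times> 'k vec. fst p i)" "homog_on n {fst, snd} 2 (\<lambda>p :: 'k vec \<times> 'k vec. snd p i)"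
      using homog_on.coord[of fst "{fst, snd}" i n] homog_on.coord[of snd "{fst, snd}" i n] that(3) by auto
    from that(1) show ?thesis
    proof (elim insertE emptyE)
      assume "w = fst"
      then show ?thesis by (intro exI[of _ "\<lambda>p. fst p i"]) (use c(1) in simp)
    next
      assume "w = fst \<circ> snd"
      with that(2) show ?thesis by contradiction
    next
      assume "w = snd \<circ> snd"
      then show ?thesis by (intro exI[of _ "\<lambda>p. snd p i"]) (use c(2) in simp)
    qed
  qed
  have \<rho>: "homog_on n {fst, snd} 2 (\<lambda>q :: 'k vec \<times> 'k vec. fst q i)" if "i \<in> {1..n+1}" for i
    by (rule homog_on.coord) (use that in auto)
  have pull: "\<exists>g'. homog_on n ?W d g' \<and> (\<forall>t\<in>?T. g (?\<tau> t) = g' t)" if "homog_on n {fst, snd} d g" for d g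
  proof (rule homog_on_pullback_on[OF that])
    fix v :: "'k vec \<times> 'k vec \<Rightarrow> nat \<Rightarrow> 'k" and i assume v: "v \<in> {fst, snd}" "i \<in> {1..n+1}"
    have "homog_on n ?W 2 (\<lambda>t. fst t i)" "homog_on n ?W 2 (\<lambda>t. (snd \<circ> snd) t i)"
      by (rule homog_on.coord[of fst], simp, rule v(2), rule homog_on.coord[of "snd \<circ> snd"], simp, rule v(2))
    then show "\<exists>g. homog_on n ?W 2 g \<and> (\<forall>t\<in>?T. v (?\<tau> t) i = g t)" using v(1) by auto
  qed
  have pull_poly: "\<exists>g'. poly_on n ?W g' \<and> (\<forall>t\<in>?T. g (?\<tau> t) = g' t)" if "poly_on n {fst, snd} g" for g
  proof (rule poly_on_pullback_on[OF that])
    fix v :: "'k vec \<times> 'k vec \<Rightarrow> nat \<Rightarrow> 'k" and i assume v: "v \<in> {fst, snd}" "i \<in> {1..n+1}"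
    have "homog_on n ?W 2 (\<lambda>t. fst t i)" "homog_on n ?W 2 (\<lambda>t. (snd \<circ> snd) t i)"
      by (rule homog_on.coord[of fst], simp, rule v(2), rule homog_on.coord[of "snd \<circ> snd"], simp, rule v(2))
    then show "\<exists>g. homog_on n ?W 2 g \<and> (\<forall>t\<in>?T. v (?\<tau> t) i = g t)" using v(1) by auto
  qed
  have \<alpha>: "homog_on n ?W 2 ?\<alpha>"
    by (intro homog_on_minus homog_on.coord[of "fst \<circ> snd"] ab) simp_all
  show ?thesis
  proof (rule graded_bimod_iso_transport[OF graded_refl_triples[OF n ab], where h = h])
    show "rhomog ?R d \<subseteq> carrier ?R" "rhomog ?R d \<subseteq> carrier ?R" for d
      using fun_ring_weyl_ring unfolding fun_ring_def by blast+
    show "\<zero>\<^bsub>?M\<^esub> \<in> carrier ?M" unfolding M by simp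
    show "h \<zero>\<^bsub>?M\<^esub> = \<zero>\<^bsub>triple_bimod n ?T\<^esub>"
      using \<tau>(1) unfolding M h_def by (simp add: restrict_eq_iff k(2))
    show "x \<oplus>\<^bsub>?M\<^esub> y \<in> carrier ?M" if "x \<in> carrier ?M" "y \<in> carrier ?M" for x y
      using that unfolding M by auto
    show "h (x \<oplus>\<^bsub>?M\<^esub> y) = h x \<oplus>\<^bsub>triple_bimod n ?T\<^esub> h y" if "x \<in> carrier ?M" "y \<in> carrier ?M" for x y
      using that \<tau>(1) unfolding M h_def by (auto simp: restrict_eq_iff k(4) algebra_simps)
    show "f \<odot>\<^bsub>?M\<^esub> x \<in> carrier ?M" if "f \<in> carrier ?R" "x \<in> carrier ?M" for f x
      using that graded_bimodule_closed(1)[OF B_gr] unfolding M by auto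
    show "h (f \<odot>\<^bsub>?M\<^esub> x) = f \<odot>\<^bsub>triple_bimod n ?T\<^esub> h x" if "f \<in> carrier ?R" "x \<in> carrier ?M" for f x
      using that \<tau>(1) unfolding M h_def by (auto simp: restrict_eq_iff k(5) algebra_simps)
    show "rsmult ?M x f \<in> carrier ?M" if "f \<in> carrier ?R" "x \<in> carrier ?M" for f x
      using that graded_bimodule_closed(2)[OF B_gr] unfolding M by auto
    show "h (rsmult ?M x f) = rsmult (triple_bimod n ?T) (h x) f" if "f \<in> carrier ?R" "x \<in> carrier ?M" for f x
      using that \<tau>(1) unfolding M h_def by (auto simp: restrict_eq_iff k(6) algebra_simps)
    show "homog ?M d \<subseteq> carrier ?M" for d
      unfolding M using homog_in_carrier[OF B_gr] by blast
    show "h ` homog ?M d = homog (triple_bimod n ?T) d" for d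
    proof
      show "h ` homog ?M d \<subseteq> homog (triple_bimod n ?T) d"
      proof clarify
        fix u v assume "(u, v) \<in> homog ?M d"
        then have "k u \<in> homog (pair_bimod n ?P) d" "k v \<in> homog (pair_bimod n ?P) (d - 2)"
          unfolding M k(7)[symmetric] by auto
        then obtain f g where f: "homog_on n {fst, snd} d f" "k u = restrict f ?P"
          and g: "homog_on n {fst, snd} (d - 2) g" "k v = restrict g ?P" by (metis fun_bimod_homogE)
        obtain f' where f': "homog_on n ?W d f'" "\<forall>t\<in>?T. f (?\<tau> t) = f' t" using pull[OF f(1)] by blast
        obtain g' where g': "homog_on n ?W (d - 2) g'" "\<forall>t\<in>?T. g (?\<tau> t) = g' t" using pull[OF g(1)] by blast
        have "homog_on n ?W d (\<lambda>t. ?\<alpha> t * g' t)" using homog_on.mult[OF \<alpha> g'(1)] by simp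
        from homog_on.add[OF f'(1) this] show "h (u, v) \<in> homog (triple_bimod n ?T) d"
          unfolding h_def by (rule fun_bimod_homogI) (use f(2) g(2) f'(2) g'(2) \<tau>(1) in simp)
      qed
      show "homog (triple_bimod n ?T) d \<subseteq> h ` homog ?M d"
      proof
        fix m assume "m \<in> homog (triple_bimod n ?T) d"
        then obtain f where f: "homog_on n ?W d f" "m = restrict f ?T" by (elim fun_bimod_homogE)
        have "\<exists>s1 s2. homog_on n {fst, snd} d s1 \<and> homog_on n {fst, snd} (d - 2) s2 \<and>
            (\<forall>t\<in>?T. f t = s1 (?\<tau> t) + ?\<alpha> t * s2 (?\<tau> t))"
          by (rule homog_decomposition[OF f(1) ab(1,2), where \<rho> = fst]) (fact dec_side \<rho> \<tau>(2))+
        then obtain s1 s2 where s: "homog_on n {fst, snd} d s1" "homog_on n {fst, snd} (d - 2) s2"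
          "\<forall>t\<in>?T. f t = s1 (?\<tau> t) + ?\<alpha> t * s2 (?\<tau> t)" by blast
        obtain u where u: "u \<in> homog B d" "k u = restrict s1 ?P" using k_surj_homog[OF s(1)] by blast
        obtain v where v: "v \<in> homog B (d - 2)" "k v = restrict s2 ?P" using k_surj_homog[OF s(2)] by blast
        have "m = h (u, v)" unfolding f(2) h_def using s(3) u(2) v(2) \<tau>(1) by (simp add: restrict_eq_iff)
        then show "m \<in> h ` homog ?M d" using u v unfolding M by blast
      qed
    qed
    show "bij_betw h (carrier ?M) (carrier (triple_bimod n ?T))"
      unfolding bij_betw_def
    proof
      show "inj_on h (carrier ?M)"
      proof (rule inj_onI)
        fix m m' assume m: "m \<in> carrier ?M" "m' \<in> carrier ?M" "h m = h m'"
        then have c: "fst m \<in> carrier B" "snd m \<in> carrier B" "fst m' \<in> carrier B" "snd m' \<in> carrier B"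
          unfolding M by auto
        obtain f g f' g' where f: "poly_on n {fst, snd} f" "k (fst m) = restrict f ?P"
          and g: "poly_on n {fst, snd} g" "k (snd m) = restrict g ?P"
          and f': "poly_on n {fst, snd} f'" "k (fst m') = restrict f' ?P"
          and g': "poly_on n {fst, snd} g'" "k (snd m') = restrict g' ?P"
          using k(3)[OF c(1)] k(3)[OF c(2)] k(3)[OF c(3)] k(3)[OF c(4)] by (metis fun_bimodE)
        have val: "h m t = f (?\<tau> t) + ?\<alpha> t * g (?\<tau> t)" "h m' t = f' (?\<tau> t) + ?\<alpha> t * g' (?\<tau> t)" if "t \<in> ?T" for t
          using that \<tau>(1)[OF that] unfolding h_def by (simp_all add: f g f' g')
        have eq: "f p - f' p = 0 \<and> (fst p a - fst p b) * (g p - g' p) = 0" if p: "p \<in> ?P" for p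
        proof -
          let ?c = "fst p a - fst p b"
          obtain t t' where t: "t \<in> ?T" "t' \<in> ?T" "?\<tau> t = p" "?\<tau> t' = p" "?\<alpha> t = ?c" "?\<alpha> t' = - ?c"
            using two[OF p] by blast
          have "f p + ?c * g p = f' p + ?c * g' p" "f p + - ?c * g p = f' p + - ?c * g' p"
            using val[OF t(1)] val[OF t(2)] m(3) unfolding t by simp_all
          then have 1: "f p - f' p + ?c * (g p - g' p) = 0" "f p - f' p - ?c * (g p - g' p) = 0"
            by (simp_all add: algebra_simps)
          have "(f p - f' p) + (f p - f' p) = (f p - f' p + ?c * (g p - g' p)) + (f p - f' p - ?c * (g p - g' p))"
            by simp
          then have "(f p - f' p) + (f p - f' p) = 0" unfolding 1 by simp
          then have "f p - f' p = 0" by (simp flip: mult_2)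
          then show ?thesis using 1(1) by simp
        qed
        have "g p - g' p = 0" if p: "p \<in> ?P" "nonzero_pt n {fst, snd} p" for p
        proof -
          have "fst p \<noteq> (\<lambda>_. 0)"
            using nonzero_pair[OF p(2)] refl_pairs_zero[of "fst p" "snd p" n a b] p(1) by auto
          then have "fst p a \<noteq> fst p b" using refl_pairsD(1)[OF ab(1,2) p(1)] unfolding separated_def by blast
          then show ?thesis using eq[OF p(1)] by simp
        qed
        then have "g p - g' p = 0" if "p \<in> ?P" for p
          using vanish_on_cone[OF poly_on_minus[OF g(1) g'(1)] cone_refl_pairs[OF ab] _ that] by blast
        then have "k (fst m) = k (fst m')" "k (snd m) = k (snd m')"
          unfolding f g f' g' restrict_eq_iff using eq by auto
        then have "fst m = fst m'" "snd m = snd m'"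
          using inj_onD[OF bij_betw_imp_inj_on[OF k(1)]] c by blast+
        then show "m = m'" by (rule prod_eqI)
      qed
      show "h ` carrier ?M = carrier (triple_bimod n ?T)"
      proof
        show "h ` carrier ?M \<subseteq> carrier (triple_bimod n ?T)"
        proof clarify
          fix u v assume "(u, v) \<in> carrier ?M"
          then have "u \<in> carrier B" "v \<in> carrier B" unfolding M by auto
          then obtain f g where f: "poly_on n {fst, snd} f" "k u = restrict f ?P"
            and g: "poly_on n {fst, snd} g" "k v = restrict g ?P" using k(3) by (metis fun_bimodE)
          obtain f' where f': "poly_on n ?W f'" "\<forall>t\<in>?T. f (?\<tau> t) = f' t" using pull_poly[OF f(1)] by blast
          obtain g' where g': "poly_on n ?W g'" "\<forall>t\<in>?T. g (?\<tau> t) = g' t" using pull_poly[OF g(1)] by blast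
          from poly_on.add[OF f'(1) poly_on.mult[OF homog_on_imp_poly_on[OF \<alpha>] g'(1)]]
          show "h (u, v) \<in> carrier (triple_bimod n ?T)"
            unfolding h_def by (rule fun_bimodI) (use f(2) g(2) f'(2) g'(2) \<tau>(1) in simp)
        qed
        show "carrier (triple_bimod n ?T) \<subseteq> h ` carrier ?M"
        proof
          fix m assume "m \<in> carrier (triple_bimod n ?T)"
          then obtain f where f: "poly_on n ?W f" "m = restrict f ?T" by (elim fun_bimodE)
          have "\<exists>s1 s2. poly_on n {fst, snd} s1 \<and> poly_on n {fst, snd} s2 \<and>
              (\<forall>t\<in>?T. f t = s1 (?\<tau> t) + ?\<alpha> t * s2 (?\<tau> t))"
            by (rule poly_decomposition[OF f(1) ab(1,2), where \<rho> = fst]) (fact dec_side \<rho> \<tau>(2))+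
          then obtain s1 s2 where s: "poly_on n {fst, snd} s1" "poly_on n {fst, snd} s2"
            "\<forall>t\<in>?T. f t = s1 (?\<tau> t) + ?\<alpha> t * s2 (?\<tau> t)" by blast
          obtain u where u: "u \<in> carrier B" "k u = restrict s1 ?P" using k_surj[OF s(1)] by blast
          obtain v where v: "v \<in> carrier B" "k v = restrict s2 ?P" using k_surj[OF s(2)] by blast
          have "m = h (u, v)" unfolding f(2) h_def using s(3) u(2) v(2) \<tau>(1) by (simp add: restrict_eq_iff)
          then show "m \<in> h ` carrier ?M" using u v unfolding M by blast
        qed
      qed
    qed
  qed
qed

subsection \<open>Commuting reflections\<close>

text \<open>
  The compositions of \<open>refl_pairs n a b\<close> and \<open>refl_pairs n c d\<close>, with the middle vector forgotten: it agrees
  with \<open>z\<close> at the coordinates \<open>a\<close> and \<open>b\<close>, and with \<open>x\<close> elsewhere.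
\<close>

definition commuting_pairs :: "nat \<Rightarrow> nat \<Rightarrow> nat \<Rightarrow> nat \<Rightarrow> nat \<Rightarrow> (('k::field_char_0) vec \<times> 'k vec) set" where
  "commuting_pairs n a b c d = {(x, z). x \<in> separated n a b \<inter> separated n c d \<and>
     (z = x \<or> z = exch a b x \<or> z = exch c d x \<or> z = exch a b (exch c d x))}"

definition replace_coords :: "nat \<Rightarrow> nat \<Rightarrow> 'k vec \<Rightarrow> 'k vec \<Rightarrow> 'k vec" where
  "replace_coords a b x z = (\<lambda>k. if k = a \<or> k = b then z k else x k)"

lemma exch_disjoint_commute:
  "{a, b} \<inter> {c, d} = {} \<Longrightarrow> exch a b (exch c d x) = exch c d (exch a b x)"
  by (auto simp: exch_def fun_eq_iff)

lemma commuting_pairs_commute: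
  assumes "{a, b} \<inter> {c, d} = {}"
  shows "commuting_pairs n a b c d = commuting_pairs n c d a b"
  unfolding commuting_pairs_def exch_disjoint_commute[OF assms] by auto

lemma replace_coords_exch:
  assumes "{a, b} \<inter> {c, d} = {}"
  shows "replace_coords a b x x = x" "replace_coords a b x (exch a b x) = exch a b x"
    "replace_coords a b x (exch c d x) = x" "replace_coords a b x (exch a b (exch c d x)) = exch a b x"
  using assms by (auto simp: replace_coords_def exch_def fun_eq_iff)

lemma commuting_iso:
  fixes B :: "('k::field_char_0, 'm) vec_bimod"
  assumes n: "n \<ge> 1" and ab: "a \<in> {1..n+1}" "b \<in> {1..n+1}" "a \<noteq> b"
    and cd: "c \<in> {1..n+1}" "d \<in> {1..n+1}" "c \<noteq> d" and disj: "{a, b} \<inter> {c, d} = {}"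
    and B: "weyl_bimod_iso n B (pair_bimod n (refl_pairs n a b))"
    and B': "weyl_bimod_iso n B' (pair_bimod n (refl_pairs n c d))"
  shows "weyl_bimod_iso n (star_prod n B B') (pair_bimod n (commuting_pairs n a b c d))"
proof -
  let ?X = "separated n a b \<inter> separated n c d :: 'k vec set"
  let ?T = "commuting_pairs n a b c d :: ('k vec \<times> 'k vec) set"
  obtain x0 :: "'k vec" where x0: "x0 \<in> geom_rep n" "two_valued n x0" "x0 \<noteq> (\<lambda>_. 0)"
      "\<forall>p\<in>{a, c}. \<forall>q\<in>{1..n+1} - {a, c}. x0 p \<noteq> x0 q"
    using two_valued_vector[of "{a, c}" n a b] ab cd disj by auto
  have "x0 a \<noteq> x0 b" "x0 c \<noteq> x0 d" using x0(4) ab cd disj by auto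
  then have x0X: "x0 \<in> ?X" using x0 unfolding separated_def by blast
  have disj': "{c, d} \<inter> {a, b} = {}" using disj by (simp only: Int_commute)
  have eX: "exch a b x \<in> ?X" "exch c d x \<in> ?X" if "x \<in> ?X" for x
  proof -
    have x: "x \<in> separated n a b" "x \<in> separated n c d" using that by simp_all
    show "exch a b x \<in> ?X"
      by (intro IntI exch_separated[OF ab(1,2)] x disjI1[OF refl] disjI2[OF disj'])
    show "exch c d x \<in> ?X"
      by (intro IntI exch_separated[OF cd(1,2)] x disjI1[OF refl] disjI2[OF disj])
  qed
  have T_in: "fst t \<in> ?X" "snd t \<in> ?X" if "t \<in> ?T" for t
  proof -
    obtain x z where xz: "t = (x, z)" by (cases t)
    have x: "x \<in> ?X" and z: "z = x \<or> z = exch a b x \<or> z = exch c d x \<or> z = exch a b (exch c d x)"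
      using that unfolding xz commuting_pairs_def by auto
    show "fst t \<in> ?X" unfolding xz using x by simp
    show "snd t \<in> ?X" unfolding xz snd_conv using z x eX(1)[OF x] eX(2)[OF x] eX(1)[OF eX(2)[OF x]] by (elim disjE) (simp_all only:)
  qed
  have T_scale: "scale_closed ?T"
    unfolding scale_closed_def commuting_pairs_def by (auto simp: exch_scale separated_scale)
  have "(x0, x0) \<in> ?T" using x0X unfolding commuting_pairs_def by auto
  then have T_cone: "cone n {fst, snd} ?T" by (rule cone_pairs[OF T_scale _ x0(1,3)])
  have XZ: "?X \<subseteq> weyl_union n" using separated_in_weyl_union[OF n] by blast
  have T_gr: "graded_bimodule (weyl_ring n) (weyl_ring n) (pair_bimod n ?T)"
    by (rule graded_pair_bimod[OF n T_cone]) (use T_in XZ in blast)+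
  have T_cases: "(fst t, replace_coords a b (fst t) (snd t)) \<in> refl_pairs n a b \<and> replace_coords a b (fst t) (snd t) \<in> ?X \<and>
      (replace_coords a b (fst t) (snd t), snd t) \<in> refl_pairs n c d" if t: "t \<in> ?T" for t
  proof -
    obtain x z where xz: "t = (x, z)" by (cases t)
    have x: "x \<in> ?X" and z: "z = x \<or> z = exch a b x \<or> z = exch c d x \<or> z = exch a b (exch c d x)"
      using t xz unfolding commuting_pairs_def by auto
    from z eX(1)[OF x] x show ?thesis unfolding xz fst_conv snd_conv refl_pairs_def
      by (elim disjE)
        (simp_all add: replace_coords_exch[OF disj] replace_coords_exch(4)[OF disj, unfolded exch_disjoint_commute[OF disj]]
          exch_disjoint_commute[OF disj])
  qed
  show ?thesis
  proof (rule star_prod_two_reflections[OF n ab(1,2) cd(1,2) B B' T_gr,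
        where \<mu> = "\<lambda>t. replace_coords a b (fst t) (snd t)"])
    show "\<exists>x\<in>?X. x \<noteq> (\<lambda>_. 0)" using x0X x0(3) by blast
    show "(fst t, replace_coords a b (fst t) (snd t)) \<in> refl_pairs n a b \<and>
        (replace_coords a b (fst t) (snd t), snd t) \<in> refl_pairs n c d" if "t \<in> ?T" for t
      using T_cases[OF that] by simp
    show "homog_on n {fst, snd} 2 (\<lambda>t :: 'k vec \<times> 'k vec. replace_coords a b (fst t) (snd t) i)"
      if i: "i \<in> {1..n+1}" for i
      using homog_on.coord[of snd "{fst, snd}" i n] homog_on.coord[of fst "{fst, snd}" i n] i
      by (cases "i = a \<or> i = b") (simp_all add: replace_coords_def)
    show "\<exists>t\<in>?T. fst t = x \<and> replace_coords a b (fst t) (snd t) = y \<and> snd t = z"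
      if xy: "(x, y) \<in> refl_pairs n a b" and yz: "(y, z) \<in> refl_pairs n c d" for x y z
    proof (rule bexI[of _ "(x, z)"], intro conjI)
      have yX: "y \<in> ?X" and x: "x = y \<or> x = exch a b y" "y = x \<or> y = exch a b x" and z: "z = y \<or> z = exch c d y"
        using refl_pairsD(2,3,4)[OF ab(1,2) xy] refl_pairsD(1,3)[OF cd(1,2) yz] by simp_all
      have xX: "x \<in> ?X" using x(1) yX eX(1)[OF yX] by (elim disjE) (simp_all only:)
      show "(x, z) \<in> ?T"
        using xX x(2) z unfolding commuting_pairs_def by (auto simp: exch_disjoint_commute[OF disj])
      show "replace_coords a b (fst (x, z)) (snd (x, z)) = y"
        using z x(2) unfolding fst_conv snd_conv
        by (elim disjE) (simp_all add: replace_coords_exch[OF disj] exch_disjoint_commute[OF disj, symmetric])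
    qed simp_all
  qed auto
qed

subsection \<open>Adjacent reflections\<close>

text \<open>
  On two-valued vectors with \<open>x\<^sub>a \<noteq> x\<^sub>b\<close> this linear map exchanges the coordinates \<open>a\<close> and \<open>b\<close> if \<open>x\<^sub>c = x\<^sub>b\<close>, and
  it is the identity otherwise, since then \<open>x\<^sub>c = x\<^sub>a\<close>.
\<close>

definition fold_onto :: "nat \<Rightarrow> nat \<Rightarrow> nat \<Rightarrow> ('k::field_char_0) vec \<Rightarrow> 'k vec" where
  "fold_onto a b c x = (\<lambda>k. if k = a then x c else if k = b then x a + x b - x c else x k)"

lemma fold_onto_homog_on:
  assumes "a \<in> {1..n+1}" "b \<in> {1..n+1}" "c \<in> {1..n+1}" "i \<in> {1..n+1}"
  shows "homog_on n {\<lambda>x. x} 2 (\<lambda>x. fold_onto a b c x i)"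
proof -
  consider "i = a" | "i = b" "i \<noteq> a" | "i \<noteq> a" "i \<noteq> b" by blast
  then show ?thesis
  proof cases
    case 1
    then show ?thesis using coord_homog_on[OF assms(3)] by (simp add: fold_onto_def)
  next
    case 2
    have "homog_on n {\<lambda>x. x} 2 (\<lambda>x. x a + x b - x c)"
      by (intro homog_on_minus homog_on.add coord_homog_on assms)
    then show ?thesis using 2 by (simp add: fold_onto_def)
  next
    case 3
    then show ?thesis using coord_homog_on[OF assms(4)] by (simp add: fold_onto_def)
  qed
qed

context
  fixes n a b c :: nat
  assumes I: "a \<in> {1..n+1}" "b \<in> {1..n+1}" "c \<in> {1..n+1}" and ne: "a \<noteq> b" "a \<noteq> c" "b \<noteq> c"
begin

lemma doubly_separated_eq:
  assumes "y \<in> separated n a b \<inter> separated n c b"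
  shows "y a = y c"
proof (cases "y = (\<lambda>_. 0)")
  case False
  then have "y a \<noteq> y b" "y c \<noteq> y b" "two_valued n y" using assms unfolding separated_def by blast+
  then show ?thesis using I unfolding two_valued_def by metis
qed simp

lemma fold_onto_doubly_separated:
  assumes y: "y \<in> separated n a b \<inter> separated n c b"
  shows "fold_onto a b c y = y" "fold_onto a b c (exch a b y) = y"
  using doubly_separated_eq[OF y] ne by (auto simp: fold_onto_def exch_def fun_eq_iff)

lemma fold_onto_separated:
  assumes x: "x \<in> separated n a b"
  shows "fold_onto a b c x \<in> separated n a b \<inter> separated n c b"
    "x = fold_onto a b c x \<or> x = exch a b (fold_onto a b c x)"
proof -
  have "\<exists>y \<in> separated n a b \<inter> separated n c b. x = y \<or> x = exch a b y"
  proof (cases "x = (\<lambda>_. 0) \<or> x c \<noteq> x b")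
    case True
    then have "x \<in> separated n c b" using x unfolding separated_def by blast
    then show ?thesis using x by blast
  next
    case False
    have e: "exch a b x \<in> separated n a b" by (rule exch_separated[OF I(1,2) x]) simp
    have "x a \<noteq> x b" using x False unfolding separated_def by blast
    then have "exch a b x c \<noteq> exch a b x b" using False ne by (auto simp: exch_def)
    then have "exch a b x \<in> separated n c b" using e unfolding separated_def by blast
    then show ?thesis using e by (intro bexI[of _ "exch a b x"]) auto
  qed
  then obtain y where y: "y \<in> separated n a b \<inter> separated n c b" "x = y \<or> x = exch a b y" by blast
  then have "fold_onto a b c x = y" using fold_onto_doubly_separated[OF y(1)] by blast
  then show "fold_onto a b c x \<in> separated n a b \<inter> separated n c b"
    "x = fold_onto a b c x \<or> x = exch a b (fold_onto a b c x)" using y by simp_all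
qed

end

definition adjacent_pairs :: "nat \<Rightarrow> nat \<Rightarrow> nat \<Rightarrow> nat \<Rightarrow> (('k::field_char_0) vec \<times> 'k vec) set" where
  "adjacent_pairs n a b c = {(x, z). \<exists>y \<in> separated n a b \<inter> separated n c b.
     (x = y \<or> x = exch a b y) \<and> (z = y \<or> z = exch c b y)}"

context
  fixes n a b c :: nat
  assumes n: "n \<ge> 1" and I: "a \<in> {1..n+1}" "b \<in> {1..n+1}" "c \<in> {1..n+1}" and ne: "a \<noteq> b" "a \<noteq> c" "b \<noteq> c"
begin

lemma doubly_separated_nonzero:
  "\<exists>x \<in> separated n a b \<inter> separated n c b. x \<noteq> (\<lambda>_. 0 :: 'k::field_char_0)"
proof -
  obtain x :: "'k vec" where x: "x \<in> geom_rep n" "two_valued n x" "x \<noteq> (\<lambda>_. 0)"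
      "\<forall>p\<in>{b}. \<forall>q\<in>{1..n+1} - {b}. x p \<noteq> x q"
    using two_valued_vector[of "{b}" n b a] I ne by blast
  have "x b \<noteq> x a" "x b \<noteq> x c" using x(4) I ne by blast+
  then have "x \<in> separated n a b \<inter> separated n c b" using x unfolding separated_def by fastforce
  then show ?thesis using x(3) by blast
qed

lemma adjacent_pairs_ends:
  assumes "(x, z) \<in> adjacent_pairs n a b c"
  shows "x \<in> separated n a b" "z \<in> separated n c b"
    "fold_onto a b c x = fold_onto c b a z" "fold_onto a b c x \<in> separated n a b \<inter> separated n c b"
    "x = fold_onto a b c x \<or> x = exch a b (fold_onto a b c x)"
    "z = fold_onto a b c x \<or> z = exch c b (fold_onto a b c x)"
proof -
  obtain y where y: "y \<in> separated n a b \<inter> separated n c b" "x = y \<or> x = exch a b y" "z = y \<or> z = exch c b y"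
    using assms unfolding adjacent_pairs_def by blast
  have "exch a b y \<in> separated n a b" "exch c b y \<in> separated n c b"
    using y(1) exch_separated[OF I(1,2), of y a b] exch_separated[OF I(3,2), of y c b] by auto
  then show "x \<in> separated n a b" "z \<in> separated n c b" using y by auto
  have f: "fold_onto a b c x = y" "fold_onto c b a z = y"
    using fold_onto_doubly_separated[OF I ne y(1)] y(2,3)
      fold_onto_doubly_separated[OF I(3,2,1) ne(3)[symmetric] ne(2)[symmetric] ne(1)[symmetric], of y] y(1) by auto
  then show "fold_onto a b c x = fold_onto c b a z" by simp
  show "fold_onto a b c x \<in> separated n a b \<inter> separated n c b"
    "x = fold_onto a b c x \<or> x = exch a b (fold_onto a b c x)"
    "z = fold_onto a b c x \<or> z = exch c b (fold_onto a b c x)" using f y by simp_all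
qed

lemma scale_closed_adjacent_pairs: "scale_closed (adjacent_pairs n a b c)"
  unfolding scale_closed_def
proof (intro allI impI)
  fix x z :: "nat \<Rightarrow> 'a" and t assume "(x, z) \<in> adjacent_pairs n a b c"
  then obtain y where y: "y \<in> separated n a b \<inter> separated n c b" "x = y \<or> x = exch a b y" "z = y \<or> z = exch c b y"
    unfolding adjacent_pairs_def by blast
  then show "((\<lambda>i. t * x i), (\<lambda>i. t * z i)) \<in> adjacent_pairs n a b c"
    unfolding adjacent_pairs_def
    by (intro CollectI case_prodI bexI[of _ "\<lambda>i. t * y i"]) (auto simp: exch_scale separated_scale)
qed

lemma image_snd_adjacent_pairs:
  "snd ` adjacent_pairs n a b c = (separated n c b :: ('k::field_char_0) vec set)" (is "?L = ?R")
proof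
  show "?L \<subseteq> ?R" using adjacent_pairs_ends(2) by auto
  show "?R \<subseteq> ?L"
  proof
    fix z assume z: "z \<in> ?R"
    note f = fold_onto_separated[OF I(3,2,1) ne(3)[symmetric] ne(2)[symmetric] ne(1)[symmetric] z]
    have "(fold_onto c b a z, z) \<in> adjacent_pairs n a b c"
      unfolding adjacent_pairs_def
      by (intro CollectI case_prodI bexI[of _ "fold_onto c b a z"]) (use f in auto)
    then show "z \<in> ?L" by force
  qed
qed

lemma graded_adjacent_pairs:
  "graded_bimodule (weyl_ring n) (weyl_ring n)
     (pair_bimod n (adjacent_pairs n a b c :: (('k::field_char_0) vec \<times> 'k vec) set))"
proof (rule graded_pair_bimod[OF n])
  let ?P = "adjacent_pairs n a b c :: ('k vec \<times> 'k vec) set"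
  obtain x :: "'k vec" where x: "x \<in> separated n a b \<inter> separated n c b" "x \<noteq> (\<lambda>_. 0)"
    using doubly_separated_nonzero by blast
  then have "(x, x) \<in> ?P" "x \<in> geom_rep n" unfolding adjacent_pairs_def separated_def by blast+
  then show "cone n {fst, snd} ?P"
    by (rule cone_pairs[OF scale_closed_adjacent_pairs _ _ x(2)])
  show "fst ` ?P \<subseteq> weyl_union n"
    using adjacent_pairs_ends(1) separated_in_weyl_union[OF n] by fastforce
  show "snd ` ?P \<subseteq> weyl_union n"
    unfolding image_snd_adjacent_pairs by (rule separated_in_weyl_union[OF n])
qed

text \<open>
  The middle vector is transverse to both reflections, so it is the vector onto which both ends fold.
\<close>

lemma adjacent_iso:
  fixes B :: "('k::field_char_0, 'm) vec_bimod"
  assumes B: "weyl_bimod_iso n B (pair_bimod n (refl_pairs n a b))"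
    and B': "weyl_bimod_iso n B' (pair_bimod n (refl_pairs n c b))"
  shows "weyl_bimod_iso n (star_prod n B B') (pair_bimod n (adjacent_pairs n a b c))"
proof (rule star_prod_two_reflections[OF n I(1,2) I(3,2) B B' graded_adjacent_pairs doubly_separated_nonzero,
      where \<mu> = "\<lambda>t. fold_onto a b c (fst t)"])
  show "(fst t, fold_onto a b c (fst t)) \<in> refl_pairs n a b \<and> (fold_onto a b c (fst t), snd t) \<in> refl_pairs n c b"
    if t: "t \<in> adjacent_pairs n a b c" for t
  proof -
    obtain x z where xz: "t = (x, z)" by (cases t)
    note e = adjacent_pairs_ends[OF t[unfolded xz]]
    have "fold_onto a b c x = x \<or> fold_onto a b c x = exch a b x" using e(5) by (metis exch_involutive)
    then show ?thesis using e(1,4,6) unfolding xz refl_pairs_def by simp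
  qed
  show "homog_on n {fst, snd} 2 (\<lambda>t :: 'k vec \<times> 'k vec. fold_onto a b c (fst t) i)" if "i \<in> {1..n+1}" for i
    by (rule homog_on_pullback[OF fold_onto_homog_on[OF I that]]) (simp add: homog_on.coord)
  show "\<exists>t\<in>adjacent_pairs n a b c. fst t = x \<and> fold_onto a b c (fst t) = y \<and> snd t = z"
    if xy: "(x, y) \<in> refl_pairs n a b" and yz: "(y, z) \<in> refl_pairs n c b" for x y z
  proof (rule bexI[of _ "(x, z)"], intro conjI)
    have y: "y \<in> separated n a b \<inter> separated n c b" and x: "x = y \<or> x = exch a b y" and z: "z = y \<or> z = exch c b y"
      using refl_pairsD(2,4)[OF I(1,2) xy] refl_pairsD(1,3)[OF I(3,2) yz] by simp_all
    show "(x, z) \<in> adjacent_pairs n a b c" using x y z unfolding adjacent_pairs_def by blast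
    show "fold_onto a b c (fst (x, z)) = y" using x fold_onto_doubly_separated[OF I ne y] by auto
  qed simp_all
qed auto

text \<open>
  In a composition \<open>(x, y, z)\<close> of \<open>adjacent_pairs\<close> and \<open>refl_pairs n a b\<close>, the vector \<open>y\<close> is transverse to both
  reflections and thus equals the vector onto which \<open>x\<close> folds.  Hence \<open>z\<close> is \<open>x\<close> or its exchange, and all
  such pairs \<open>(x, z)\<close> occur.
\<close>

lemma adjacent_triple_iso:
  fixes B :: "('k::field_char_0, 'm) vec_bimod"
  assumes B: "weyl_bimod_iso n B (pair_bimod n (refl_pairs n a b))"
    and B': "weyl_bimod_iso n B' (pair_bimod n (refl_pairs n c b))"
  shows "weyl_bimod_iso n (star_prod n (star_prod n B B') B) (pair_bimod n (refl_pairs n a b))"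
proof (rule star_prod_reflection[OF n I(1,2) I(3,2) I(1,2) adjacent_iso[OF B B'] _ image_snd_adjacent_pairs
      scale_closed_adjacent_pairs _ B graded_refl_pairs[OF n I(1,2) ne(1)],
      where \<rho> = "fold_onto c b a" and \<mu> = "\<lambda>t. fold_onto a b c (fst t)"])
  show "fst ` adjacent_pairs n a b c \<subseteq> weyl_union n"
    using adjacent_pairs_ends(1) separated_in_weyl_union[OF n] by fastforce
  show "x = (\<lambda>_. 0)" if "(x, (\<lambda>_. 0)) \<in> adjacent_pairs n a b c" for x
  proof -
    from adjacent_pairs_ends(6)[OF that] have "fold_onto a b c x = (\<lambda>_. 0)"
    proof
      assume "(\<lambda>_. 0) = exch c b (fold_onto a b c x)"
      from arg_cong[OF this, of "exch c b"] show ?thesis by simp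
    qed simp
    then show ?thesis using adjacent_pairs_ends(5)[OF that] by auto
  qed
  show "\<exists>x\<in>separated n c b \<inter> separated n a b. x \<noteq> (\<lambda>_. 0 :: 'k)"
    using doubly_separated_nonzero by blast
  show "homog_on n {\<lambda>x. x} 2 (\<lambda>x :: 'k vec. fold_onto c b a x i)" if "i \<in> {1..n+1}" for i
    by (rule fold_onto_homog_on[OF I(3,2,1) that])
  show "fst p = fold_onto c b a (snd p) \<or> fst p = exch a b (fold_onto c b a (snd p))"
    if p: "p \<in> adjacent_pairs n a b c" for p
    using adjacent_pairs_ends(3,5)[of "fst p" "snd p"] p by simp
  show "\<exists>y z. (y, x) \<in> adjacent_pairs n a b c \<and> (z, x) \<in> adjacent_pairs n a b c \<and> y a - y b \<noteq> z a - z b"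
    if x: "x \<in> separated n c b \<inter> separated n a b" "x \<noteq> (\<lambda>_. 0)" for x
  proof (intro exI conjI)
    show "(x, x) \<in> adjacent_pairs n a b c" "(exch a b x, x) \<in> adjacent_pairs n a b c"
      using x unfolding adjacent_pairs_def by blast+
    show "x a - x b \<noteq> exch a b x a - exch a b x b" using refl_pairs_sep(2)[OF I(1,2)] x by blast
  qed
  show "(fst t, fold_onto a b c (fst t)) \<in> adjacent_pairs n a b c \<and> fold_onto a b c (fst t) \<in> separated n a b"
    "(fold_onto a b c (fst t), snd t) \<in> refl_pairs n a b" if t: "t \<in> refl_pairs n a b" for t
  proof -
    obtain x z where xz: "t = (x, z)" by (cases t)
    have x: "x \<in> separated n a b" and z: "z = x \<or> z = exch a b x"
      using t unfolding xz refl_pairs_def by auto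
    note f = fold_onto_separated[OF I ne x]
    have "z = fold_onto a b c x \<or> z = exch a b (fold_onto a b c x)" using z f(2) by (metis exch_involutive)
    then show "(fold_onto a b c (fst t), snd t) \<in> refl_pairs n a b" using f(1) unfolding xz refl_pairs_def by simp
    show "(fst t, fold_onto a b c (fst t)) \<in> adjacent_pairs n a b c \<and> fold_onto a b c (fst t) \<in> separated n a b"
      using f unfolding xz adjacent_pairs_def by auto
  qed
  show "homog_on n {fst, snd} 2 (\<lambda>t :: 'k vec \<times> 'k vec. fold_onto a b c (fst t) i)" if "i \<in> {1..n+1}" for i
    by (rule homog_on_pullback[OF fold_onto_homog_on[OF I that]]) (simp add: homog_on.coord)
  show "\<exists>t\<in>refl_pairs n a b. fst t = x \<and> fold_onto a b c (fst t) = y \<and> snd t = z"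
    if xy: "(x, y) \<in> adjacent_pairs n a b c" and yz: "(y, z) \<in> refl_pairs n a b" for x y z
  proof -
    define u where "u = fold_onto a b c x"
    have u: "u \<in> separated n a b \<inter> separated n c b" "x = u \<or> x = exch a b u" "y = u \<or> y = exch c b u"
      using adjacent_pairs_ends[OF xy] unfolding u_def by blast+
    have y: "y \<in> separated n a b" and z: "z = y \<or> z = exch a b y"
      using refl_pairsD(1,3)[OF I(1,2) yz] by simp_all
    \<comment> \<open>The image of \<open>u\<close> under the second reflection has equal coordinates \<open>a\<close> and \<open>b\<close>, so it is
       not transverse to the first one.\<close>
    have "y = u"
    proof (rule ccontr)
      assume "y \<noteq> u"
      then have yc: "y = exch c b u" using u(3) by blast
      then have "y a = y b" using doubly_separated_eq[OF I ne u(1)] ne by (simp add: exch_def)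
      then have y0: "y = (\<lambda>_. 0)" using y unfolding separated_def by blast
      then have "u = (\<lambda>_. 0)" using arg_cong[OF yc, of "exch c b"] by simp
      then show False using y0 \<open>y \<noteq> u\<close> by simp
    qed
    then have x: "x = y \<or> x = exch a b y" and fx: "fold_onto a b c x = y" using u unfolding u_def by blast+
    have "z = x \<or> z = exch a b x" using x z by (elim disjE) simp_all
    moreover have "x \<in> separated n a b" by (rule adjacent_pairs_ends(1)[OF xy])
    ultimately show ?thesis
      by (intro bexI[of _ "(x, z)"]) (simp_all add: fx refl_pairs_def)
  qed
qed auto

end

section \<open>The Temperley--Lieb relations\<close>

lemma TL_gen_iso:
  assumes "n \<ge> 1" "i \<in> {1..n}"
  shows "weyl_bimod_iso n (TL_gen n i :: 'k::field_char_0 TL_bimod) (pair_bimod n (refl_pairs n i (i + 1)))"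
proof -
  have i: "i \<in> {1..n+1}" "i + 1 \<in> {1..n+1}" "i \<noteq> i + 1" using assms by auto
  show ?thesis
    using reflection_bimod_iso[OF assms(1) i, where 'k = 'k]
    unfolding TL_gen_def Let_def simple_reflection_def transverse_union_eq[OF i] .
qed

theorem theorem3p5:
  fixes n i j :: nat and B :: "nat \<Rightarrow> 'k::field_char_0 TL_bimod"
  assumes "n \<ge> 1" and "i \<in> {1..n}" and "j \<in> {1..n}"
    and "B = TL_gen n"
  shows "(\<bar>int i - int j\<bar> = 1 \<longrightarrow>
            weyl_bimod_iso n (star_prod n (star_prod n (B j) (B i)) (B j)) (B j)) \<and>
         (\<bar>int i - int j\<bar> > 1 \<longrightarrow>
            weyl_bimod_iso n (star_prod n (B i) (B j)) (star_prod n (B j) (B i))) \<and>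
         weyl_bimod_iso n (star_prod n (B i) (B i)) (direct_sum (B i) (shift (B i) (-2)))"
proof (intro conjI impI)
  note n = assms(1)
  have B: "weyl_bimod_iso n (B k) (pair_bimod n (refl_pairs n k (k + 1)))" if "k \<in> {1..n}" for k
    unfolding assms(4) by (rule TL_gen_iso[OF n that])
  have I: "k \<in> {1..n+1}" "k + 1 \<in> {1..n+1}" "k \<noteq> k + 1" if "k \<in> {1..n}" for k
    using that by auto
  show "weyl_bimod_iso n (star_prod n (star_prod n (B j) (B i)) (B j)) (B j)" if "\<bar>int i - int j\<bar> = 1"
  proof -
    have "i = j + 1 \<or> j = i + 1" using that by linarith
    then consider "i = j + 1" | "j = i + 1" by blast
    then have "weyl_bimod_iso n (star_prod n (star_prod n (B j) (B i)) (B j)) (pair_bimod n (refl_pairs n j (j + 1)))"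
    proof cases
      case 1
      have "weyl_bimod_iso n (B i) (pair_bimod n (refl_pairs n (j + 2) (j + 1)))"
        by (subst refl_pairs_commute) (use B[OF assms(2)] 1 in simp)
      from adjacent_triple_iso[OF n _ _ _ _ _ _ B[OF assms(3)] this] show ?thesis
        using assms(2,3) 1 by simp
    next
      case 2
      have "weyl_bimod_iso n (B j) (pair_bimod n (refl_pairs n (i + 2) (i + 1)))"
        by (subst refl_pairs_commute) (use B[OF assms(3)] 2 in simp)
      from adjacent_triple_iso[OF n _ _ _ _ _ _ this B[OF assms(2)]]
      have "weyl_bimod_iso n (star_prod n (star_prod n (B j) (B i)) (B j)) (pair_bimod n (refl_pairs n (i + 2) (i + 1)))"
        using assms(2,3) 2 by simp
      moreover have "j + 1 = i + 2" using 2 by simp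
      ultimately show ?thesis by (subst refl_pairs_commute) (simp only: 2)
    qed
    then show ?thesis by (rule graded_bimod_iso_trans) (rule graded_bimod_iso_sym[OF B[OF assms(3)]])
  qed
  show "weyl_bimod_iso n (star_prod n (B i) (B j)) (star_prod n (B j) (B i))" if "\<bar>int i - int j\<bar> > 1"
  proof -
    have disj: "{i, i + 1} \<inter> {j, j + 1} = {}" "{j, j + 1} \<inter> {i, i + 1} = {}" using that by auto
    have "weyl_bimod_iso n (star_prod n (B i) (B j)) (pair_bimod n (commuting_pairs n i (i + 1) j (j + 1)))"
      by (rule commuting_iso[OF n I[OF assms(2)] I[OF assms(3)] disj(1) B[OF assms(2)] B[OF assms(3)]])
    moreover have "weyl_bimod_iso n (star_prod n (B j) (B i)) (pair_bimod n (commuting_pairs n i (i + 1) j (j + 1)))"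
      unfolding commuting_pairs_commute[OF disj(1)]
      by (rule commuting_iso[OF n I[OF assms(3)] I[OF assms(2)] disj(2) B[OF assms(3)] B[OF assms(2)]])
    ultimately show ?thesis by (rule graded_bimod_iso_trans[OF _ graded_bimod_iso_sym])
  qed
  show "weyl_bimod_iso n (star_prod n (B i) (B i)) (direct_sum (B i) (shift (B i) (-2)))"
    by (rule graded_bimod_iso_trans[OF square_iso[OF n I[OF assms(2)] B[OF assms(2)]]
          graded_bimod_iso_sym[OF triple_bimod_direct_sum[OF n I[OF assms(2)] B[OF assms(2)]]]])
qed

end
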